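(* Let $\rho^n=\rho_1\otimes\cdots\otimes\rho_n$ and $\sigma^n=\sigma_1\otimes\cdots\otimes\sigma_n$ be two sequences of product states on $\mathcal H^{\otimes n}$, with charges $A_j^{(n)}$, $j=1,\dots,c$. These sequences are asymptotically equivalent if and only if there exist ancillary quantum systems with Hilbert spaces $\mathcal K$ (depending on $n$) of dimension $2^{o(n)}$, with trivial charges $A_j'=0$, states $\omega,\omega'$ on $\mathcal K$, and almost-commuting unitaries $U$ on $\mathcal H^{\otimes n}\otimes\mathcal K$ such that \[ \lim_{n\to\infty}\big\|U(\rho^n\otimes\omega')U^\dagger-\sigma^n\otimes\omega\big\|_1=0. \]
   Context: $\mathcal H$ is a finite-dimensional Hilbert space with Hermitian charges $A_1,\dots,A_c$; $A_j^{(n)}=\sum_{i=1}^n\mathbb1^{\otimes(i-1)}\otimes A_j\otimes\mathbb1^{\otimes(n-i)}$. Two sequences of product states $\rho^n,\sigma^n$ are asymptotically equivalent if $\lim_n\frac1n|S(\rho^n)-S(\sigma^n)|=0$ and $\lim_n\frac1n|\mathrm{Tr}\rho^nA_j^{(n)}-\mathrm{Tr}\sigma^nA_j^{(n)}|=0$ for all $j$. A sequence of unitaries $U$ on $\mathcal H^{\otimes n}\otimes\mathcal K$, with $\mathcal K$ an ancilla of dimension $2^{o(n)}$ carrying charges $A_j'$ with $\|A_j'\|_\infty\le o(n)$, is almost-commuting if $\lim_{n\to\infty}\frac1n\|U(A_j^{(n)}+A_j')-(A_j^{(n)}+A_j')U\|_\infty=0$ for all $j=1,\dots,c$. *)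

theory Defs
  imports "Jordan_Normal_Form.Spectral_Radius" "Jordan_Normal_Form.Schur_Decomposition"
    "HOL-Library.Landau_Symbols"
begin

text \<open>Finite-dimensional operators are complex matrices; the Hilbert space H is C^d.\<close>

definition mtrace :: "complex mat \<Rightarrow> complex" where
  "mtrace X = (\<Sum>i<dim_row X. X $$ (i, i))"

definition hermitian :: "complex mat \<Rightarrow> bool" where
  "hermitian X \<longleftrightarrow> square_mat X \<and> mat_adjoint X = X"

definition unitary :: "nat \<Rightarrow> complex mat \<Rightarrow> bool" where
  "unitary N U \<longleftrightarrow> U \<in> carrier_mat N N \<and> mat_adjoint U * U = 1\<^sub>m N \<and> U * mat_adjoint U = 1\<^sub>m N"

definition spec :: "complex mat \<Rightarrow> complex multiset" where
  "spec X = proots (char_poly X)"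

definition psd :: "complex mat \<Rightarrow> bool" where
  "psd X \<longleftrightarrow> hermitian X \<and> (\<forall>e\<in>#spec X. Im e = 0 \<and> 0 \<le> Re e)"

definition density :: "nat \<Rightarrow> complex mat \<Rightarrow> bool" where
  "density d X \<longleftrightarrow> X \<in> carrier_mat d d \<and> psd X \<and> mtrace X = 1"

definition entropy :: "complex mat \<Rightarrow> real" where
  "entropy X = - (\<Sum>\<^sub># (image_mset (\<lambda>e. if Re e \<le> 0 then 0 else Re e * log 2 (Re e)) (spec X)))"

definition trace_norm :: "complex mat \<Rightarrow> real" where
  "trace_norm X = \<Sum>\<^sub># (image_mset (\<lambda>e. sqrt (Re e)) (spec (mat_adjoint X * X)))"

definition op_norm :: "complex mat \<Rightarrow> real" where
  "op_norm X = sqrt (Max (insert 0 (Re ` set_mset (spec (mat_adjoint X * X)))))"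

definition kron :: "complex mat \<Rightarrow> complex mat \<Rightarrow> complex mat" where
  "kron A B = mat (dim_row A * dim_row B) (dim_col A * dim_col B)
     (\<lambda>(i, j). A $$ (i div dim_row B, j div dim_col B) * B $$ (i mod dim_row B, j mod dim_col B))"

fun kron_list :: "complex mat list \<Rightarrow> complex mat" where
  "kron_list [] = 1\<^sub>m 1"
| "kron_list (X # Xs) = kron X (kron_list Xs)"

definition prod_state :: "(nat \<Rightarrow> complex mat) \<Rightarrow> nat \<Rightarrow> complex mat" where
  "prod_state \<rho> n = kron_list (map \<rho> [0..<n])"

definition total_charge :: "nat \<Rightarrow> complex mat \<Rightarrow> nat \<Rightarrow> complex mat" where
  "total_charge d A n = foldr (+)
     (map (\<lambda>i. kron (1\<^sub>m (d ^ i)) (kron A (1\<^sub>m (d ^ (n - 1 - i))))) [0..<n])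
     (0\<^sub>m (d ^ n) (d ^ n))"

definition asymptotically_equivalent ::
  "nat \<Rightarrow> nat \<Rightarrow> (nat \<Rightarrow> complex mat) \<Rightarrow> (nat \<Rightarrow> complex mat) \<Rightarrow> (nat \<Rightarrow> complex mat) \<Rightarrow> bool" where
  "asymptotically_equivalent d c A \<rho> \<sigma> \<longleftrightarrow>
     (\<lambda>n. \<bar>entropy (\<rho> n) - entropy (\<sigma> n)\<bar> / real n) \<longlonglongrightarrow> 0 \<and>
     (\<forall>j<c. (\<lambda>n. cmod (mtrace (\<rho> n * total_charge d (A j) n) - mtrace (\<sigma> n * total_charge d (A j) n)) / real n) \<longlonglongrightarrow> 0)"

definition almost_commuting ::
  "nat \<Rightarrow> nat \<Rightarrow> (nat \<Rightarrow> complex mat) \<Rightarrow> (nat \<Rightarrow> nat) \<Rightarrow> (nat \<Rightarrow> nat \<Rightarrow> complex mat)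
   \<Rightarrow> (nat \<Rightarrow> complex mat) \<Rightarrow> bool" where
  "almost_commuting d c A k A' U \<longleftrightarrow>
     (\<forall>j<c. (\<lambda>n. let H = kron (total_charge d (A j) n) (1\<^sub>m (k n)) + kron (1\<^sub>m (d ^ n)) (A' n j)
               in op_norm (U n * H - H * U n) / real n) \<longlonglongrightarrow> 0)"

end

theory Submission
  imports Defs "HOL-Analysis.L2_Norm" "HOL-Real_Asymp.Real_Asymp"
begin

text \<open>
  Sufficiency of the unitaries is continuity: entropy is unitarily invariant and additive, and
  \<open>S(X) \<le> S(Y) + 1 + \<parallel>X - Y\<parallel>\<^sub>1 log (2 dim)\<close> (compare \<open>X\<close> with the mixture of \<open>Y\<close> and the
  maximally mixed state via Gibbs' inequality), while charges move by at most the commutator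
  norm plus \<open>\<parallel>X - Y\<parallel>\<^sub>1\<close> times the norm of the charge.

  Conversely, let \<open>X\<^sub>j\<close> be the total charge shifted by its expectation in \<open>\<rho>\<^sup>n\<close>. The spectral projection
  of the single operator \<open>\<Sum>\<^sub>j X\<^sub>j\<^sup>2\<close> onto eigenvalues at most \<open>\<theta>\<^sup>2 = o(n\<^sup>2)\<close> defines a subspace on which
  every \<open>X\<^sub>j\<close> has norm at most \<open>\<theta>\<close>, so any unitary acting only inside it almost commutes with all charges;
  variances of product states grow linearly, hence both states lie asymptotically in this subspace.
  After removal of atypical eigenvalues and compression to the subspace, both states have rank at most
  \<open>2\<^sup>S\<^sup>+\<^sup>g\<close> and eigenvalues at most \<open>2\<^sup>g\<^sup>-\<^sup>S\<close> with \<open>g = o(n)\<close>. Cutting the sorted spectra \<open>p\<close>, \<open>q\<close> into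
  blocks of length \<open>L = 2\<^sup>S\<^sup>-\<^sup>2\<^sup>g\<close> gives \<open>p \<approx> f \<otimes> u\<^sub>L\<close> and \<open>q \<approx> f' \<otimes> u\<^sub>L\<close> with \<open>u\<^sub>L\<close> uniform and
  \<open>f\<close>, \<open>f'\<close> of size about \<open>2\<^sup>3\<^sup>g\<close>; so \<open>p \<otimes> f'\<close> is nearly a permutation of \<open>q \<otimes> f\<close>,
  and \<open>f'\<close>, \<open>f\<close> are the spectra of the ancilla states.
\<close>

text \<open>The obstacle is that the charges need not commute, so there is no joint spectral measure
  to project on. A sum of squares replaces it: one quadratic form dominates all charges at once, and
  Markov's inequality for its single spectral distribution controls the weight lost. Expectations
  that agree up to o(n) allow one shift, hence one subspace, for both states.

  The block length balances two demands. With eigenvalues at most 2^(g-S), a block of length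
  2^(S-2g) weighs at most 2^(-g), which bounds the flattening error. With rank at most 2^(S+g), the
  spectrum is exhausted after 2^(3g) such blocks, which bounds the ancilla. The ancilla spectra are
  crossed because p \<otimes> f' and q \<otimes> f are both close to a tensor product of f, f' and a
  uniform vector, so that only factors have to be permuted.

  Errors are tracked by the predicates \<open>opbound\<close> and \<open>tbound\<close>. These are
  upper bounds stable under sums, scaling and isometries, and separate lemmas compare them with
  \<open>op_norm\<close> and \<open>trace_norm\<close>, which are defined through
  eigenvalues.\<close>

section \<open>Matrix algebra with dimension equations; adjoints and unitaries\<close>

abbreviation adj :: "complex mat \<Rightarrow> complex mat" ("_\<dagger>" [1000] 1000) where
  "X\<dagger> \<equiv> mat_adjoint X"

lemma dim_adj [simp]: "dim_row (X\<dagger>) = dim_col X" "dim_col (X\<dagger>) = dim_row X"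
  by (simp_all add: mat_adjoint_def)

lemma index_adj [simp]:
  "i < dim_col X \<Longrightarrow> j < dim_row X \<Longrightarrow> X\<dagger> $$ (i, j) = cnj (X $$ (j, i))"
  by (simp add: mat_adjoint_def mat_of_rows_def)

lemma index_mult:
  fixes A :: "'a::semiring_0 mat"
  shows "i < dim_row A \<Longrightarrow> j < dim_col B \<Longrightarrow> dim_col A = dim_row B \<Longrightarrow>
  (A * B) $$ (i, j) = (\<Sum>k<dim_row B. A $$ (i, k) * B $$ (k, j))"
  by (auto simp: scalar_prod_def lessThan_atLeast0 intro!: sum.cong)

text \<open>This law and the next ones have equations between dimensions as premises instead of
  carrier memberships: the simplifier settles them for arbitrary products, with no intermediate
  dimension to guess.\<close>

lemma mat_assoc:
  fixes A :: "'a::semiring_0 mat"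
  shows "dim_col A = dim_row B \<Longrightarrow> dim_col B = dim_row C \<Longrightarrow> (A * B) * C = A * (B * C)"
  by (rule assoc_mult_mat[of A "dim_row A" "dim_row B" B "dim_row C" C "dim_col C"]) auto

lemma mat_add_mult:
  fixes A :: "'a::semiring_0 mat"
  shows "dim_row A = dim_row B \<Longrightarrow> dim_col A = dim_col B \<Longrightarrow> dim_col B = dim_row C \<Longrightarrow>
    (A + B) * C = A * C + B * C"
  by (rule add_mult_distrib_mat[of A "dim_row A" "dim_row C" B C "dim_col C"]) auto

lemma mat_mult_add:
  fixes A :: "'a::semiring_0 mat"
  shows "dim_row B = dim_row C \<Longrightarrow> dim_col B = dim_col C \<Longrightarrow> dim_col A = dim_row C \<Longrightarrow>
    A * (B + C) = A * B + A * C"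
  by (rule mult_add_distrib_mat[of A "dim_row A" "dim_row C" B "dim_col C" C]) auto

lemma mat_diff_mult:
  fixes A :: "'a::ring mat"
  shows "dim_row A = dim_row B \<Longrightarrow> dim_col A = dim_col B \<Longrightarrow> dim_col B = dim_row C \<Longrightarrow>
    (A - B) * C = A * C - B * C"
  by (rule minus_mult_distrib_mat[of A "dim_row A" "dim_row C" B C "dim_col C"]) auto

lemma mat_mult_diff:
  fixes A :: "'a::ring mat"
  shows "dim_row B = dim_row C \<Longrightarrow> dim_col B = dim_col C \<Longrightarrow> dim_col A = dim_row C \<Longrightarrow>
    A * (B - C) = A * B - A * C"
  by (rule mult_minus_distrib_mat[of A "dim_row A" "dim_row C" B "dim_col C" C]) auto

lemma mat_one_mult [simp]:
  fixes A :: "'a::semiring_1 mat"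
  shows "dim_row A = n \<Longrightarrow> 1\<^sub>m n * A = A" "dim_col A = n \<Longrightarrow> A * 1\<^sub>m n = A"
  by (auto intro: left_mult_one_mat[of _ _ "dim_col A"] right_mult_one_mat[of _ "dim_row A"])

lemma adj_adj [simp]: "(X\<dagger>)\<dagger> = X"
  by (rule eq_matI) auto

lemma adj_mult: "dim_col A = dim_row B \<Longrightarrow> (A * B)\<dagger> = B\<dagger> * A\<dagger>"
  by (rule eq_matI) (auto simp del: index_mult_mat(1) simp: index_mult mult.commute intro!: sum.cong)

lemma adj_add: "dim_row A = dim_row B \<Longrightarrow> dim_col A = dim_col B \<Longrightarrow> (A + B)\<dagger> = A\<dagger> + B\<dagger>"
  by (rule eq_matI) auto

lemma adj_diff: "dim_row A = dim_row B \<Longrightarrow> dim_col A = dim_col B \<Longrightarrow> (A - B)\<dagger> = A\<dagger> - B\<dagger>"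
  by (rule eq_matI) auto

lemma adj_one [simp]: "(1\<^sub>m n)\<dagger> = 1\<^sub>m n"
  by (rule eq_matI) auto

lemma adj_zero [simp]: "(0\<^sub>m n k)\<dagger> = 0\<^sub>m k n"
  by (rule eq_matI) auto

lemma adj_smult: "(a \<cdot>\<^sub>m X)\<dagger> = cnj a \<cdot>\<^sub>m X\<dagger>"
  by (rule eq_matI) auto

lemma hermitian_iff: "hermitian X \<longleftrightarrow> dim_row X = dim_col X \<and> X\<dagger> = X"
  by (auto simp: hermitian_def)

lemma hermitian_adj: "hermitian X \<Longrightarrow> X\<dagger> = X"
  by (simp add: hermitian_def)

lemma unitaryD:
  assumes "unitary n U"
  shows "dim_row U = n" "dim_col U = n" "U\<dagger> * U = 1\<^sub>m n" "U * U\<dagger> = 1\<^sub>m n"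
  using assms by (auto simp: unitary_def)

text \<open>Rewriting with \<open>mat_assoc\<close> brackets products to the right, where
  \<open>V\<dagger> * V\<close> is no longer a subterm. Cancelling in front of a third factor is the
  form that applies there.\<close>

lemma isometry_cancel:
  assumes "V\<dagger> * V = 1\<^sub>m n" "dim_row B = n" "dim_col V = n"
  shows "V\<dagger> * (V * B) = B"
proof -
  have "V\<dagger> * (V * B) = (V\<dagger> * V) * B"
    using assms by (subst mat_assoc) auto
  then show ?thesis using assms by simp
qed

lemma unitary_cancel:
  assumes "unitary n U" "dim_row B = n"
  shows "U\<dagger> * (U * B) = B" "U * (U\<dagger> * B) = B"
  using isometry_cancel[of U n B] isometry_cancel[of "U\<dagger>" n B] unitaryD[OF assms(1)] assms(2) by auto

lemma unitary_adj: "unitary n U \<Longrightarrow> unitary n (U\<dagger>)"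
  by (auto simp: unitary_def)

lemma unitary_one: "unitary n (1\<^sub>m n)"
  by (auto simp: unitary_def)

lemma unitary_mult:
  assumes "unitary n U" "unitary n V"
  shows "unitary n (U * V)"
  using unitaryD[OF assms(1)] unitaryD[OF assms(2)] unitary_cancel[OF assms(1), of V]
    unitary_cancel[OF assms(1), of U] unitary_cancel[OF assms(2)] unitary_cancel[OF assms(1)]
  by (auto simp: unitary_def adj_mult mat_assoc)

section \<open>Trace and Frobenius norm\<close>

lemma mtrace_add: "dim_row A = dim_row B \<Longrightarrow> dim_col B = dim_row B \<Longrightarrow> mtrace (A + B) = mtrace A + mtrace B"
  by (auto simp: mtrace_def sum.distrib)

lemma mtrace_diff: "dim_row A = dim_row B \<Longrightarrow> dim_col B = dim_row B \<Longrightarrow> mtrace (A - B) = mtrace A - mtrace B"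
  by (auto simp: mtrace_def sum_subtractf)

lemma mtrace_smult: "dim_col A = dim_row A \<Longrightarrow> mtrace (a \<cdot>\<^sub>m A) = a * mtrace A"
  by (auto simp: mtrace_def sum_distrib_left)

lemma mtrace_mult: "dim_col A = dim_row B \<Longrightarrow> dim_col B = dim_row A \<Longrightarrow>
  mtrace (A * B) = (\<Sum>i<dim_row A. \<Sum>j<dim_row B. A $$ (i, j) * B $$ (j, i))"
  by (auto simp del: index_mult_mat(1) simp: mtrace_def index_mult)

lemma mtrace_comm: "dim_col A = dim_row B \<Longrightarrow> dim_col B = dim_row A \<Longrightarrow> mtrace (A * B) = mtrace (B * A)"
  by (simp add: mtrace_mult mult.commute) (rule sum.swap)

lemma mtrace_adj: "dim_col A = dim_row A \<Longrightarrow> mtrace (A\<dagger>) = cnj (mtrace A)"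
  by (simp add: mtrace_def)

text \<open>The Frobenius (Hilbert-Schmidt) norm. As an \<open>L2_set\<close> over index pairs it
  inherits Minkowski and Cauchy-Schwarz.\<close>

definition fnorm :: "complex mat \<Rightarrow> real" where
  "fnorm X = L2_set (\<lambda>x. cmod (X $$ x)) ({..<dim_row X} \<times> {..<dim_col X})"

lemma fnorm_nonneg [simp]: "0 \<le> fnorm X"
  by (simp add: fnorm_def)

lemma fnorm_sq: "(fnorm X)\<^sup>2 = (\<Sum>i<dim_row X. \<Sum>j<dim_col X. (cmod (X $$ (i, j)))\<^sup>2)"
  by (simp add: fnorm_def L2_set_def sum_nonneg sum.cartesian_product)

lemma cnj_mult_self: "cnj z * z = of_real ((cmod z)\<^sup>2)" "z * cnj z = of_real ((cmod z)\<^sup>2)"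
  using complex_norm_square[of z] by (simp_all add: mult.commute)

lemma mtrace_adj_mult_self: "mtrace (X\<dagger> * X) = of_real ((fnorm X)\<^sup>2)"
  by (simp add: mtrace_mult fnorm_sq cnj_mult_self) (rule sum.swap)

lemma fnorm_adj [simp]: "fnorm (X\<dagger>) = fnorm X"
proof -
  have "(fnorm (X\<dagger>))\<^sup>2 = (fnorm X)\<^sup>2"
    by (simp add: fnorm_sq) (rule sum.swap)
  then show ?thesis by (simp add: power2_eq_iff_nonneg)
qed

lemma fnorm_add:
  assumes "dim_row A = dim_row B" "dim_col A = dim_col B"
  shows "fnorm (A + B) \<le> fnorm A + fnorm B"
proof -
  let ?S = "{..<dim_row B} \<times> {..<dim_col B}"
  have "fnorm (A + B) \<le> L2_set (\<lambda>x. cmod (A $$ x) + cmod (B $$ x)) ?S"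
    unfolding fnorm_def using assms by (auto intro!: L2_set_mono norm_triangle_ineq)
  also have "\<dots> \<le> fnorm A + fnorm B"
    using L2_set_triangle_ineq[of "\<lambda>x. cmod (A $$ x)" "\<lambda>x. cmod (B $$ x)" ?S] assms
    by (simp add: fnorm_def)
  finally show ?thesis .
qed

lemma fnorm_uminus: "fnorm (- B) = fnorm B"
  unfolding fnorm_def by (auto intro!: L2_set_cong)

lemma mtrace_CS:
  assumes "dim_col A = dim_row B" "dim_col B = dim_row A"
  shows "cmod (mtrace (A * B)) \<le> fnorm A * fnorm B"
proof -
  let ?S = "{..<dim_row A} \<times> {..<dim_row B}"
  have "cmod (mtrace (A * B)) \<le> (\<Sum>x\<in>?S. cmod (A $$ x) * cmod (B $$ (snd x, fst x)))"
    using assms by (simp add: mtrace_mult sum.cartesian_product case_prod_beta)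
      (rule order_trans[OF norm_sum], simp add: norm_mult)
  also have "\<dots> \<le> L2_set (\<lambda>x. cmod (A $$ x)) ?S * L2_set (\<lambda>x. cmod (B $$ (snd x, fst x))) ?S"
    using L2_set_mult_ineq[of "\<lambda>x. cmod (A $$ x)" "\<lambda>x. cmod (B $$ (snd x, fst x))" ?S]
    by simp
  also have "L2_set (\<lambda>x. cmod (B $$ (snd x, fst x))) ?S = fnorm (B\<dagger>)"
    using assms by (auto simp: fnorm_def intro!: L2_set_cong)
  also have "\<dots> = fnorm B" by simp
  finally show ?thesis using assms by (simp add: fnorm_def)
qed

lemma fnorm_isometry:
  assumes "V\<dagger> * V = 1\<^sub>m n" "dim_col V = n" "dim_row Y = n"
  shows "fnorm (V * Y) = fnorm Y"
proof -
  have "complex_of_real ((fnorm (V * Y))\<^sup>2) = mtrace (Y\<dagger> * (V\<dagger> * (V * Y)))"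
    unfolding mtrace_adj_mult_self[symmetric] using assms by (simp add: adj_mult mat_assoc)
  also have "\<dots> = of_real ((fnorm Y)\<^sup>2)"
    using assms by (simp add: isometry_cancel mtrace_adj_mult_self)
  finally have "(fnorm (V * Y))\<^sup>2 = (fnorm Y)\<^sup>2"
    using of_real_eq_iff by blast
  then show ?thesis by (simp add: power2_eq_iff_nonneg)
qed

section \<open>Operator bounds\<close>

text \<open>An upper bound on the operator norm. Testing on matrices instead of vectors gives the
  same notion, because the squared Frobenius norm is a sum over columns, and it lets products
  compose by associativity alone.\<close>

definition opbound :: "complex mat \<Rightarrow> real \<Rightarrow> bool" where
  "opbound B t \<longleftrightarrow> 0 \<le> t \<and> (\<forall>Y. dim_row Y = dim_col B \<longrightarrow> fnorm (B * Y) \<le> t * fnorm Y)"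

lemma opboundD: "opbound B t \<Longrightarrow> dim_row Y = dim_col B \<Longrightarrow> fnorm (B * Y) \<le> t * fnorm Y"
  by (simp add: opbound_def)

lemma opbound_nonneg: "opbound B t \<Longrightarrow> 0 \<le> t"
  by (simp add: opbound_def)

lemma opbound_mult:
  assumes "opbound A s" "opbound B t" "dim_col A = dim_row B"
  shows "opbound (A * B) (s * t)"
  unfolding opbound_def
proof (intro conjI allI impI)
  show "0 \<le> s * t" using assms by (simp add: opbound_def)
  fix Y :: "complex mat" assume Y: "dim_row Y = dim_col (A * B)"
  have "fnorm (A * (B * Y)) \<le> s * fnorm (B * Y)"
    using assms Y by (intro opboundD) auto
  also have "\<dots> \<le> s * (t * fnorm Y)"
    using assms Y by (intro mult_left_mono opboundD opbound_nonneg) auto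
  finally show "fnorm (A * B * Y) \<le> s * t * fnorm Y"
    using assms Y by (simp add: mat_assoc mult.assoc)
qed

lemma opbound_add:
  assumes "opbound A s" "opbound B t" "dim_row A = dim_row B" "dim_col A = dim_col B"
  shows "opbound (A + B) (s + t)"
  unfolding opbound_def
proof (intro conjI allI impI)
  show "0 \<le> s + t" using assms by (simp add: opbound_def)
  fix Y :: "complex mat" assume Y: "dim_row Y = dim_col (A + B)"
  have "fnorm ((A + B) * Y) \<le> fnorm (A * Y) + fnorm (B * Y)"
    using assms Y by (simp add: mat_add_mult fnorm_add)
  also have "\<dots> \<le> s * fnorm Y + t * fnorm Y"
    using assms Y by (intro add_mono opboundD) auto
  finally show "fnorm ((A + B) * Y) \<le> (s + t) * fnorm Y" by (simp add: algebra_simps)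
qed

lemma opbound_uminus: "opbound B t \<Longrightarrow> opbound (- B) t"
proof -
  assume B: "opbound B t"
  have "- B * Y = - (B * Y)" if "dim_row Y = dim_col B" for Y
    using that by (intro uminus_mult_left_mat) auto
  then show ?thesis using B by (auto simp: opbound_def fnorm_uminus)
qed

lemma opbound_diff:
  assumes "opbound A s" "opbound B t" "dim_row A = dim_row B" "dim_col A = dim_col B"
  shows "opbound (A - B) (s + t)"
proof -
  have "A - B = A + (- B)"
    using assms by (intro eq_matI) auto
  then show ?thesis using assms opbound_add[of A s "- B" t] opbound_uminus[of B t] by simp
qed

lemma opbound_isometry:
  assumes "V\<dagger> * V = 1\<^sub>m n" "dim_col V = n"
  shows "opbound V 1"
  using assms fnorm_isometry[OF assms] by (auto simp: opbound_def)

lemma opbound_unitary: "unitary n U \<Longrightarrow> opbound U 1"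
  using opbound_isometry[of U n] by (auto simp: unitary_def)

lemma opbound_one: "opbound (1\<^sub>m n) 1"
  by (rule opbound_unitary[OF unitary_one])

text \<open>With Z = B\<dagger> Y, the squared norm of Z is the trace of Y\<dagger> (B Z), at most
  |Y| t |Z| by Cauchy-Schwarz; then divide by |Z|.\<close>

lemma opbound_adj:
  assumes "opbound B t"
  shows "opbound (B\<dagger>) t"
  unfolding opbound_def
proof (intro conjI allI impI)
  show "0 \<le> t" using assms by (rule opbound_nonneg)
  fix Y :: "complex mat" assume Y: "dim_row Y = dim_col (B\<dagger>)"
  let ?Z = "B\<dagger> * Y"
  have "(fnorm ?Z)\<^sup>2 = cmod (mtrace (?Z\<dagger> * ?Z))"
    unfolding mtrace_adj_mult_self norm_of_real by simp
  also have "?Z\<dagger> * ?Z = Y\<dagger> * (B * ?Z)"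
    using Y by (simp add: adj_mult mat_assoc)
  also have "cmod (mtrace \<dots>) \<le> fnorm Y * fnorm (B * ?Z)"
    using mtrace_CS[of "Y\<dagger>" "B * ?Z"] Y by simp
  also have "\<dots> \<le> fnorm Y * (t * fnorm ?Z)"
    using Y by (intro mult_left_mono opboundD[OF assms]) auto
  finally have "fnorm ?Z * fnorm ?Z \<le> (t * fnorm Y) * fnorm ?Z"
    by (simp add: power2_eq_square mult_ac)
  then show "fnorm ?Z \<le> t * fnorm Y"
    using \<open>0 \<le> t\<close> by (cases "fnorm ?Z = 0") (auto simp: less_le mult_le_cancel_right)
qed

lemma opbound_entry:
  assumes "opbound B t" "i < dim_row B" "j < dim_col B"
  shows "cmod (B $$ (i, j)) \<le> t"
proof -
  \<comment> \<open>The basis vector with index \<open>j\<close>, which picks out column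
    \<open>j\<close> of \<open>B\<close>.\<close>
  let ?Y = "mat (dim_col B) 1 (\<lambda>(k, _). if k = j then 1 else 0) :: complex mat"
  have BY: "(B * ?Y) $$ (k, 0) = B $$ (k, j)" if "k < dim_row B" for k
    using that assms by (simp del: index_mult_mat(1) add: index_mult if_distrib cong: if_cong)
  have "(cmod (B $$ (i, j)))\<^sup>2 \<le> (\<Sum>k<dim_row B. (cmod (B $$ (k, j)))\<^sup>2)"
    using assms by (intro member_le_sum) auto
  also have "\<dots> = (fnorm (B * ?Y))\<^sup>2"
    using BY by (simp add: fnorm_sq del: index_mult_mat(1))
  finally have 1: "cmod (B $$ (i, j)) \<le> fnorm (B * ?Y)"
    by (rule power2_le_imp_le) simp
  have "(fnorm ?Y)\<^sup>2 = (\<Sum>k<dim_col B. (cmod (if k = j then 1 else 0))\<^sup>2)"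
    by (auto simp: fnorm_sq intro!: sum.cong)
  also have "\<dots> = (\<Sum>k<dim_col B. if k = j then 1 else 0)"
    by (rule sum.cong) auto
  finally have "(fnorm ?Y)\<^sup>2 = (\<Sum>k<dim_col B. if k = j then 1 else 0)" .
  then have "fnorm ?Y = 1"
    using assms by (simp add: power2_eq_1_iff) (metis fnorm_nonneg neg_0_le_iff_le not_one_le_zero)
  then show ?thesis
    using 1 opboundD[OF assms(1), of ?Y] by simp
qed

text \<open>An upper bound on the trace norm, by duality with the operator norm: the test operators
  are the contractions. In this form the triangle inequality is immediate, without diagonalising a
  sum.\<close>

definition tbound :: "complex mat \<Rightarrow> real \<Rightarrow> bool" where
  "tbound X t \<longleftrightarrow> (\<forall>B. dim_row B = dim_col X \<longrightarrow> dim_col B = dim_row X \<longrightarrow> opbound B 1 \<longrightarrow> cmod (mtrace (X * B)) \<le> t)"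

lemma tboundD:
  "tbound X t \<Longrightarrow> opbound B 1 \<Longrightarrow> dim_row B = dim_col X \<Longrightarrow> dim_col B = dim_row X \<Longrightarrow> cmod (mtrace (X * B)) \<le> t"
  by (simp add: tbound_def)

lemma tbound_mono: "tbound X s \<Longrightarrow> s \<le> t \<Longrightarrow> tbound X t"
  unfolding tbound_def using order_trans by blast

lemma tbound_add:
  assumes "tbound X s" "tbound Y t" "dim_row X = dim_row Y" "dim_col X = dim_col Y"
  shows "tbound (X + Y) (s + t)"
  unfolding tbound_def
proof (intro allI impI)
  fix B :: "complex mat"
  assume B: "dim_row B = dim_col (X + Y)" "dim_col B = dim_row (X + Y)" "opbound B 1"
  have "mtrace ((X + Y) * B) = mtrace (X * B) + mtrace (Y * B)"
    using assms B by (simp add: mat_add_mult mtrace_add)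
  moreover have "cmod (mtrace (X * B)) \<le> s" "cmod (mtrace (Y * B)) \<le> t"
    using assms B by (auto intro: tboundD)
  ultimately show "cmod (mtrace ((X + Y) * B)) \<le> s + t"
    using norm_triangle_mono by metis
qed

lemma tbound_uminus:
  assumes "tbound X t" shows "tbound (- X) t"
  unfolding tbound_def
proof (intro allI impI)
  fix B :: "complex mat"
  assume B: "dim_row B = dim_col (- X)" "dim_col B = dim_row (- X)" "opbound B 1"
  have "- X * B = - (X * B)"
    using B by (intro uminus_mult_left_mat) auto
  then have "mtrace (- X * B) = - mtrace (X * B)"
    using B by (simp add: mtrace_def sum_negf)
  then show "cmod (mtrace (- X * B)) \<le> t"
    using tboundD[OF assms, of B] B by simp
qed

text \<open>Homogeneity: divide \<open>B\<close> by \<open>s\<close> to get a contraction. For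
  \<open>s = 0\<close> the division fails, but then \<open>B\<close> itself vanishes.\<close>

lemma tbound_scaled:
  assumes "tbound X t" "opbound B s" "dim_row B = dim_col X" "dim_col B = dim_row X"
  shows "cmod (mtrace (X * B)) \<le> t * s"
proof -
  have s: "0 \<le> s" using assms by (simp add: opbound_def)
  have key: "cmod (mtrace (X * B)) \<le> t * r" if r: "0 < r" "s \<le> r" for r
  proof -
    let ?C = "complex_of_real (1 / r) \<cdot>\<^sub>m B"
    have "fnorm (?C * Y) \<le> fnorm Y" if Y: "dim_row Y = dim_col B" for Y
    proof -
      have "?C * Y = complex_of_real (1 / r) \<cdot>\<^sub>m (B * Y)"
        using Y by (intro mult_smult_assoc_mat) auto
      moreover have "fnorm (complex_of_real (1 / r) \<cdot>\<^sub>m Z) = fnorm Z / r" for Z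
      proof -
        have "(fnorm (complex_of_real (1 / r) \<cdot>\<^sub>m Z))\<^sup>2 = (fnorm Z / r)\<^sup>2"
          using r by (simp add: fnorm_sq norm_mult norm_divide power_mult_distrib power_divide sum_divide_distrib)
        then show ?thesis using r by (simp add: power2_eq_iff_nonneg)
      qed
      ultimately have "fnorm (?C * Y) = fnorm (B * Y) / r" by simp
      also have "\<dots> \<le> s * fnorm Y / r"
        using r Y assms by (intro divide_right_mono opboundD) auto
      also have "\<dots> \<le> fnorm Y"
        using r mult_right_mono[OF r(2) fnorm_nonneg[of Y]] by (simp add: field_simps)
      finally show ?thesis .
    qed
    then have "opbound ?C 1" by (auto simp: opbound_def)
    then have "cmod (mtrace (X * ?C)) \<le> t"
      using assms by (intro tboundD) auto
    moreover have "X * ?C = complex_of_real (1 / r) \<cdot>\<^sub>m (X * B)"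
      using assms by (intro mult_smult_distrib) auto
    ultimately have "cmod (mtrace (X * B)) / r \<le> t"
      using assms r by (simp add: mtrace_smult norm_mult norm_divide)
    then show ?thesis using r by (simp add: field_simps)
  qed
  show ?thesis
  proof (cases "s = 0")
    case False then show ?thesis using key[of s] s by simp
  next
    case True
    then have "fnorm (B * 1\<^sub>m (dim_col B)) \<le> 0" using opboundD[OF assms(2), of "1\<^sub>m (dim_col B)"] by simp
    then have "fnorm B = 0" using fnorm_nonneg[of B] by simp
    then have "cmod (mtrace (X * B)) \<le> 0" using mtrace_CS[of X B] assms by simp
    then show ?thesis using True by simp
  qed
qed

text \<open>Move \<open>V\<close> around the trace: V\<dagger> B V is again a contraction. As
  \<open>V\<close> is an isometry and possibly not square, the lemma also carries estimates from a
  subspace to the whole space.\<close>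

lemma tbound_conj:
  assumes "tbound X t" "dim_col V = dim_row X" "dim_col X = dim_row X" "V\<dagger> * V = 1\<^sub>m (dim_row X)"
  shows "tbound (V * X * V\<dagger>) t"
  unfolding tbound_def
proof (intro allI impI)
  fix B :: "complex mat"
  assume B: "dim_row B = dim_col (V * X * V\<dagger>)" "dim_col B = dim_row (V * X * V\<dagger>)" "opbound B 1"
  have "mtrace (V * X * V\<dagger> * B) = mtrace (V * (X * (V\<dagger> * B)))"
    using assms B by (simp add: mat_assoc)
  also have "\<dots> = mtrace (X * (V\<dagger> * B) * V)"
    using assms B by (intro mtrace_comm) auto
  also have "\<dots> = mtrace (X * (V\<dagger> * B * V))"
    using assms B by (simp add: mat_assoc)
  finally have eq: "mtrace (V * X * V\<dagger> * B) = mtrace (X * (V\<dagger> * B * V))" .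
  have V: "opbound V 1" using assms by (intro opbound_isometry) auto
  have "opbound (V\<dagger> * B) (1 * 1)"
    using V B assms by (intro opbound_mult opbound_adj) auto
  then have "opbound (V\<dagger> * B * V) (1 * 1 * 1)"
    using V B assms by (intro opbound_mult opbound_adj) auto
  then have "cmod (mtrace (X * (V\<dagger> * B * V))) \<le> t"
    using assms B by (intro tboundD) auto
  then show "cmod (mtrace (V * X * V\<dagger> * B)) \<le> t" unfolding eq .
qed

section \<open>The spectral theorem\<close>

definition diag_of :: "nat \<Rightarrow> (nat \<Rightarrow> real) \<Rightarrow> complex mat" where
  "diag_of N f = mat N N (\<lambda>(i, j). if i = j then of_real (f i) else 0)"

lemma diag_of_dims [simp]: "dim_row (diag_of N f) = N" "dim_col (diag_of N f) = N"
  by (simp_all add: diag_of_def)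

lemma diag_of_index [simp]: "i < N \<Longrightarrow> j < N \<Longrightarrow> diag_of N f $$ (i, j) = (if i = j then of_real (f i) else 0)"
  by (simp add: diag_of_def)

lemma diag_of_cong: "(\<And>i. i < N \<Longrightarrow> f i = g i) \<Longrightarrow> diag_of N f = diag_of N g"
  by (rule eq_matI) auto

lemma diag_of_adj [simp]: "(diag_of N f)\<dagger> = diag_of N f"
  by (rule eq_matI) auto

lemma diag_of_one: "diag_of N (\<lambda>_. 1) = 1\<^sub>m N"
  by (rule eq_matI) auto

lemma diag_of_mult_index:
  "i < N \<Longrightarrow> j < dim_col X \<Longrightarrow> dim_row X = N \<Longrightarrow> (diag_of N f * X) $$ (i, j) = of_real (f i) * X $$ (i, j)"
  by (simp add: index_mult if_distrib[of "\<lambda>x. x * _"] cong: if_cong del: index_mult_mat(1))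

lemma diag_of_mult: "diag_of N f * diag_of N g = diag_of N (\<lambda>i. f i * g i)"
  by (rule eq_matI) (auto simp: diag_of_mult_index simp del: index_mult_mat(1))

lemma diag_of_diff: "diag_of N f - diag_of N g = diag_of N (\<lambda>i. f i - g i)"
  by (rule eq_matI) auto

lemma mtrace_diag_of: "mtrace (diag_of N f) = of_real (\<Sum>i<N. f i)"
  by (simp add: mtrace_def)

lemma mtrace_diag_of_mult:
  "dim_row X = N \<Longrightarrow> dim_col X = N \<Longrightarrow> mtrace (diag_of N f * X) = (\<Sum>i<N. of_real (f i) * X $$ (i, i))"
  by (simp add: mtrace_def diag_of_mult_index del: index_mult_mat(1))

lemma quad_diag_of:
  assumes "dim_row Z = N" "i < dim_col Z" "j < dim_col Z"
  shows "(Z\<dagger> * (diag_of N f * Z)) $$ (i, j) = (\<Sum>k<N. of_real (f k) * (cnj (Z $$ (k, i)) * Z $$ (k, j)))"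
proof -
  have "(Z\<dagger> * (diag_of N f * Z)) $$ (i, j) = (\<Sum>k<N. Z\<dagger> $$ (i, k) * (diag_of N f * Z) $$ (k, j))"
    using assms by (subst index_mult) auto
  also have "\<dots> = (\<Sum>k<N. of_real (f k) * (cnj (Z $$ (k, i)) * Z $$ (k, j)))"
    using assms by (intro sum.cong) (auto simp: diag_of_mult_index simp del: index_mult_mat(1))
  finally show ?thesis .
qed

lemma quad_diag_of_diag:
  assumes "dim_row Z = N" "i < dim_col Z"
  shows "(Z\<dagger> * (diag_of N f * Z)) $$ (i, i) = of_real (\<Sum>k<N. f k * (cmod (Z $$ (k, i)))\<^sup>2)"
  using assms by (simp add: quad_diag_of cnj_mult_self del: index_mult_mat(1))

lemma gram_index:
  assumes "i < dim_col Z"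
  shows "(Z\<dagger> * Z) $$ (i, i) = of_real (\<Sum>k<dim_row Z. (cmod (Z $$ (k, i)))\<^sup>2)"
  using assms by (simp add: index_mult cnj_mult_self del: index_mult_mat(1))

lemma fnorm_diag_of_mult:
  assumes "dim_row Y = N" "\<And>i. i < N \<Longrightarrow> \<bar>f i\<bar> \<le> t" "0 \<le> t"
  shows "fnorm (diag_of N f * Y) \<le> t * fnorm Y"
proof -
  have "(fnorm (diag_of N f * Y))\<^sup>2 = (\<Sum>i<N. \<Sum>j<dim_col Y. (f i)\<^sup>2 * (cmod (Y $$ (i, j)))\<^sup>2)"
    using assms by (simp add: fnorm_sq diag_of_mult_index norm_mult power_mult_distrib del: index_mult_mat(1))
  also have "\<dots> \<le> (\<Sum>i<N. \<Sum>j<dim_col Y. t\<^sup>2 * (cmod (Y $$ (i, j)))\<^sup>2)"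
    using assms by (intro sum_mono mult_right_mono) (auto simp: abs_le_square_iff[symmetric])
  also have "\<dots> = (t * fnorm Y)\<^sup>2"
    using assms by (simp add: fnorm_sq power_mult_distrib sum_distrib_left)
  finally show ?thesis
    by (rule power2_le_imp_le) (use assms in simp)
qed

lemma opbound_diag_of:
  "(\<And>i. i < N \<Longrightarrow> \<bar>f i\<bar> \<le> t) \<Longrightarrow> 0 \<le> t \<Longrightarrow> opbound (diag_of N f) t"
  by (auto simp: opbound_def intro!: fnorm_diag_of_mult)

text \<open>Column \<open>j\<close> is the basis vector with index \<open>s j\<close>. One
  construction covers permutation matrices and the inclusion of a span of selected
  eigenvectors.\<close>

definition sel_mat :: "nat \<Rightarrow> nat \<Rightarrow> (nat \<Rightarrow> nat) \<Rightarrow> complex mat" where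
  "sel_mat N D s = mat N D (\<lambda>(i, j). if i = s j then 1 else 0)"

lemma sel_mat_dims [simp]: "dim_row (sel_mat N D s) = N" "dim_col (sel_mat N D s) = D"
  by (simp_all add: sel_mat_def)

lemma sel_mat_conj:
  assumes "inj_on s {..<D}" "s ` {..<D} \<subseteq> {..<N}"
  shows "(sel_mat N D s)\<dagger> * (diag_of N f * sel_mat N D s) = diag_of D (\<lambda>i. f (s i))"
proof (rule eq_matI)
  fix i j assume "i < dim_row (diag_of D (\<lambda>i. f (s i)))" "j < dim_col (diag_of D (\<lambda>i. f (s i)))"
  then have ij: "i < D" "j < D" by auto
  then have s: "s i < N" "s i = s j \<longleftrightarrow> i = j"
    using assms by (auto simp: inj_on_def)
  have "((sel_mat N D s)\<dagger> * (diag_of N f * sel_mat N D s)) $$ (i, j)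
      = (\<Sum>k<N. of_real (f k) * (cnj (sel_mat N D s $$ (k, i)) * sel_mat N D s $$ (k, j)))"
    using ij by (intro quad_diag_of) auto
  also have "\<dots> = (\<Sum>k<N. if k = s i then (if k = s j then of_real (f k) else 0) else 0)"
    using ij by (intro sum.cong) (auto simp: sel_mat_def)
  also have "\<dots> = diag_of D (\<lambda>i. f (s i)) $$ (i, j)"
    using ij s by simp
  finally show "((sel_mat N D s)\<dagger> * (diag_of N f * sel_mat N D s)) $$ (i, j) = diag_of D (\<lambda>i. f (s i)) $$ (i, j)" .
qed auto

abbreviation perm_mat :: "nat \<Rightarrow> (nat \<Rightarrow> nat) \<Rightarrow> complex mat" where
  "perm_mat N s \<equiv> sel_mat N N s"

lemma perm_mat_conj:
  assumes "bij_betw s {..<N} {..<N}"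
  shows "(perm_mat N s)\<dagger> * (diag_of N f * perm_mat N s) = diag_of N (\<lambda>i. f (s i))"
  using assms by (intro sel_mat_conj) (auto simp: bij_betw_def)

lemma isometry_square_unitary:
  assumes "dim_row U = n" "dim_col U = n" "U\<dagger> * U = 1\<^sub>m n"
  shows "unitary n U"
proof -
  have "U \<in> carrier_mat n n" "U\<dagger> \<in> carrier_mat n n" using assms(1,2) by (intro carrier_matI; simp)+
  then show ?thesis
    unfolding unitary_def using assms(3) mat_mult_left_right_inverse[of "U\<dagger>" n U] by blast
qed

lemma unitary_perm_mat:
  assumes "bij_betw s {..<N} {..<N}"
  shows "unitary N (perm_mat N s)"
  using perm_mat_conj[OF assms, of "\<lambda>_. 1"] by (intro isometry_square_unitary) (auto simp: diag_of_one)

text \<open>Complete \<open>v\<close> to a basis, run Gram-Schmidt and normalise the columns.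
  Gram-Schmidt keeps the first vector, so column 0 stays a multiple of \<open>v\<close>.\<close>

lemma exists_unitary_first_col:
  assumes v: "v \<in> carrier_vec n" "v \<noteq> 0\<^sub>v n"
  shows "\<exists>W c. unitary n W \<and> (\<forall>i<n. W $$ (i, 0) = c * v $ i)"
proof -
  interpret cof_vec_space n "TYPE(complex)" .
  define b where "b = basis_completion v"
  define ws where "ws = gram_schmidt n b"
  from basis_completion[OF v, folded b_def]
  have dist_b: "distinct b" and indep: "\<not> lin_dep (set b)" and b: "set b \<subseteq> carrier_vec n"
    and hdb: "hd b = v" and len_b: "length b = n" by auto
  have n: "n \<noteq> 0"
  proof
    assume "n = 0"
    then have "v = 0\<^sub>v n" using v(1) by (intro eq_vecI) auto
    then show False using v by simp
  qed
  from hdb len_b n obtain vs where bv: "b = v # vs" by (cases b) auto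
  from gram_schmidt_result[OF b dist_b indep refl, folded ws_def]
  have ws: "set ws \<subseteq> carrier_vec n" "corthogonal ws" "length ws = n"
    by (auto simp: len_b)
  from gram_schmidt_hd[OF v(1), of vs, folded bv] have hdws: "ws ! 0 = v"
    unfolding ws_def using ws(3) n by (metis hd_conv_nth length_0_conv ws_def)
  have wsc: "ws ! i \<in> carrier_vec n" if "i < n" for i using ws that by auto
  have dimw: "dim_vec (ws ! i) = n" if "i < n" for i using wsc[OF that] by auto
  have ip: "ws ! j \<bullet>c ws ! i = (\<Sum>k<n. cnj (ws ! i $ k) * ws ! j $ k)" if "i < n" "j < n" for i j
    using dimw[OF that(1)] dimw[OF that(2)] by (auto simp: scalar_prod_def lessThan_atLeast0 mult.commute intro!: sum.cong)
  define q where "q i = (\<Sum>k<n. (cmod (ws ! i $ k))\<^sup>2)" for i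
  have ipq: "ws ! i \<bullet>c ws ! i = of_real (q i)" if "i < n" for i
    unfolding ip[OF that that] q_def by (simp add: cnj_mult_self)
  have q: "q i > 0" if "i < n" for i
  proof -
    have "of_real (q i) \<noteq> (0::complex)"
      using ws(2,3) that ipq[OF that] unfolding corthogonal_def by metis
    moreover have "q i \<ge> 0" unfolding q_def by (intro sum_nonneg) auto
    ultimately show ?thesis by simp
  qed
  define W where "W = mat n n (\<lambda>(i, j). ws ! j $ i / of_real (sqrt (q j)))"
  have "W\<dagger> * W = 1\<^sub>m n"
  proof (rule eq_matI)
    fix i j assume "i < dim_row (1\<^sub>m n :: complex mat)" "j < dim_col (1\<^sub>m n :: complex mat)"
    then have ij: "i < n" "j < n" by auto
    have "(W\<dagger> * W) $$ (i, j) = (\<Sum>k<n. cnj (ws ! i $ k) * ws ! j $ k / of_real (sqrt (q i) * sqrt (q j)))"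
      using ij by (auto simp: index_mult W_def simp del: index_mult_mat(1) intro!: sum.cong)
    also have "\<dots> = (ws ! j \<bullet>c ws ! i) / of_real (sqrt (q i) * sqrt (q j))"
      using ij by (simp add: ip sum_divide_distrib)
    also have "\<dots> = (if i = j then 1 else 0)"
    proof (cases "i = j")
      case True
      then show ?thesis using q[OF ij(1)] ipq[OF ij(1)]
        by (simp flip: of_real_mult)
    next
      case False
      then have "ws ! j \<bullet>c ws ! i = 0"
        using ws(2,3) ij unfolding corthogonal_def by auto
      then show ?thesis using False by simp
    qed
    finally show "(W\<dagger> * W) $$ (i, j) = 1\<^sub>m n $$ (i, j)" using ij by simp
  qed (auto simp: W_def)
  then have "unitary n W" by (intro isometry_square_unitary) (auto simp: W_def)
  moreover have "\<forall>i<n. W $$ (i, 0) = (1 / of_real (sqrt (q 0))) * v $ i"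
    using n hdws by (simp add: W_def)
  ultimately show ?thesis by blast
qed

lemma diag_of_Suc:
  "diag_of (Suc n) f = four_block_mat (diag_of 1 (\<lambda>_. f 0)) (0\<^sub>m 1 n) (0\<^sub>m n 1) (diag_of n (\<lambda>i. f (Suc i)))"
  by (rule eq_matI) auto

lemma unitary_diag_hermitian:
  assumes "unitary N V"
  shows "hermitian (V * diag_of N l * V\<dagger>)"
  using unitaryD[OF assms] by (simp add: hermitian_iff adj_mult mat_assoc)

lemma four_block_diag_mult:
  fixes A1 :: "'a::comm_ring_1 mat"
  assumes "A1 \<in> carrier_mat k k" "A2 \<in> carrier_mat k k" "D1 \<in> carrier_mat n n" "D2 \<in> carrier_mat n n"
  shows "four_block_mat A1 (0\<^sub>m k n) (0\<^sub>m n k) D1 * four_block_mat A2 (0\<^sub>m k n) (0\<^sub>m n k) D2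
    = four_block_mat (A1 * A2) (0\<^sub>m k n) (0\<^sub>m n k) (D1 * D2)"
proof -
  have [simp]: "A1 * A2 \<in> carrier_mat k k" "D1 * D2 \<in> carrier_mat n n"
    using mult_carrier_mat[OF assms(1,2)] mult_carrier_mat[OF assms(3,4)] .
  show ?thesis
    using mult_four_block_mat[OF assms(1) zero_carrier_mat zero_carrier_mat assms(3) assms(2) zero_carrier_mat zero_carrier_mat assms(4)]
    by (simp add: right_mult_zero_mat[OF assms(1)] right_mult_zero_mat[OF assms(3)]
        left_mult_zero_mat[OF assms(2)] left_mult_zero_mat[OF assms(4)])
qed

text \<open>Deflation: in an orthonormal basis that begins with an eigenvector, column 0 vanishes
  below the corner. The matrix stays Hermitian, so row 0 vanishes as well and the corner is real;
  the induction hypothesis applies to the remaining block.\<close>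

lemma spectral_unsorted:
  assumes "hermitian A" "dim_row A = n"
  shows "\<exists>V l. unitary n V \<and> A = V * diag_of n l * V\<dagger>"
  using assms
proof (induction n arbitrary: A)
  case 0
  then have "A = 1\<^sub>m 0 * diag_of 0 (\<lambda>_. 0) * (1\<^sub>m 0)\<dagger>"
    by (intro eq_matI) (auto simp: hermitian_iff)
  then show ?case using unitary_one[of 0] by blast
next
  case (Suc n)
  let ?N = "Suc n"
  have dimA: "dim_row A = ?N" "dim_col A = ?N" and hA: "A\<dagger> = A" using Suc.prems by (auto simp: hermitian_iff)
  then have cA: "A \<in> carrier_mat ?N ?N" by auto
  \<comment> \<open>The characteristic polynomial splits over the complex numbers into
    \<open>Suc n\<close> linear factors, so there is an eigenvalue.\<close>
  obtain es where es: "char_poly A = (\<Prod>a\<leftarrow>es. [:- a, 1:])" "length es = ?N"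
    using char_poly_factorized[OF cA] by blast
  then obtain e es' where "es = e # es'" by (cases es) auto
  then have "eigenvalue A e" unfolding eigenvalue_root_char_poly[OF cA] es by simp
  then obtain v where v: "v \<in> carrier_vec ?N" "v \<noteq> 0\<^sub>v ?N" "A *\<^sub>v v = e \<cdot>\<^sub>v v"
    using dimA by (auto simp: eigenvalue_def eigenvector_def)
  obtain W c where W: "unitary ?N W" "\<forall>i<?N. W $$ (i, 0) = c * v $ i"
    using exists_unitary_first_col[OF v(1,2)] by blast
  note dW = unitaryD[OF W(1)]
  have Av: "(\<Sum>k<?N. A $$ (i, k) * v $ k) = e * v $ i" if "i < ?N" for i
  proof -
    have "(A *\<^sub>v v) $ i = (\<Sum>k<?N. A $$ (i, k) * v $ k)"
      using that dimA v(1) by (simp add: scalar_prod_def lessThan_atLeast0)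
    then show ?thesis using v that by simp
  qed
  have AW: "(A * W) $$ (i, 0) = e * W $$ (i, 0)" if "i < ?N" for i
  proof -
    have "(A * W) $$ (i, 0) = (\<Sum>k<?N. A $$ (i, k) * W $$ (k, 0))"
      using that dimA dW by (simp add: index_mult del: index_mult_mat(1) sum.lessThan_Suc)
    also have "\<dots> = c * (\<Sum>k<?N. A $$ (i, k) * v $ k)"
      unfolding sum_distrib_left using W(2) by (intro sum.cong) auto
    finally show ?thesis using Av[OF that] W(2) that by simp
  qed
  define C where "C = W\<dagger> * (A * W)"
  have dC: "dim_row C = ?N" "dim_col C = ?N" using dW dimA by (auto simp: C_def)
  have hC: "C\<dagger> = C" using dW dimA hA by (simp add: C_def adj_mult mat_assoc)
  have C0: "C $$ (i, 0) = (if i = 0 then e else 0)" if "i < ?N" for i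
  proof -
    have "C $$ (i, 0) = (\<Sum>k<?N. W\<dagger> $$ (i, k) * (e * W $$ (k, 0)))"
      unfolding C_def using that dimA dW
      by (subst index_mult) (auto simp: AW simp del: index_mult_mat(1) sum.lessThan_Suc intro!: sum.cong)
    also have "\<dots> = e * (W\<dagger> * W) $$ (i, 0)"
      using that dW by (subst index_mult) (auto simp: sum_distrib_left algebra_simps simp del: sum.lessThan_Suc intro!: sum.cong)
    finally show ?thesis using that dW by simp
  qed
  have Csym: "C $$ (i, j) = cnj (C $$ (j, i))" if "i < ?N" "j < ?N" for i j
    using index_adj[of i C j] that dC hC by simp
  define r where "r = Re e"
  have e: "e = of_real r"
    using Csym[of 0 0] C0[of 0] by (simp add: complex_eq_iff r_def)
  define C3 where "C3 = mat n n (\<lambda>(i, j). C $$ (Suc i, Suc j))"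
  have "hermitian C3"
    unfolding hermitian_iff by (auto simp: C3_def intro!: eq_matI) (rule Csym[symmetric], auto)
  from Suc.IH[OF this] obtain V l where V: "unitary n V" "C3 = V * diag_of n l * V\<dagger>"
    by (auto simp: C3_def)
  note dV = unitaryD[OF V(1)]
  \<comment> \<open>The new eigenvalue takes index 0 and the others move up by one, as in
    \<open>diag_of_Suc\<close>.\<close>
  let ?l = "case_nat r l"
  define E where "E = four_block_mat (1\<^sub>m 1) (0\<^sub>m 1 n) (0\<^sub>m n 1) V"
  have Ea: "E\<dagger> = four_block_mat (1\<^sub>m 1) (0\<^sub>m 1 n) (0\<^sub>m n 1) (V\<dagger>)"
    unfolding E_def using dV by (intro eq_matI) auto
  have dE: "dim_row E = ?N" "dim_col E = ?N" using dV by (auto simp: E_def)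
  have cV: "V \<in> carrier_mat n n" "V\<dagger> \<in> carrier_mat n n" "V * diag_of n l \<in> carrier_mat n n"
    "diag_of n l \<in> carrier_mat n n" "diag_of 1 f \<in> carrier_mat 1 1" for f using dV by auto
  have "E\<dagger> * E = four_block_mat (1\<^sub>m 1 * 1\<^sub>m 1) (0\<^sub>m 1 n) (0\<^sub>m n 1) (V\<dagger> * V)"
    unfolding Ea unfolding E_def by (intro four_block_diag_mult cV one_carrier_mat)
  also have "\<dots> = 1\<^sub>m ?N" using dV by (intro eq_matI) auto
  finally have "E\<dagger> * E = 1\<^sub>m ?N" .
  then have uE: "unitary ?N E" using dE by (intro isometry_square_unitary)
  have C_eq: "C = four_block_mat (diag_of 1 (\<lambda>_. r)) (0\<^sub>m 1 n) (0\<^sub>m n 1) C3"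
  proof (rule eq_matI)
    fix i j
    assume "i < dim_row (four_block_mat (diag_of 1 (\<lambda>_. r)) (0\<^sub>m 1 n) (0\<^sub>m n 1) C3)"
      "j < dim_col (four_block_mat (diag_of 1 (\<lambda>_. r)) (0\<^sub>m 1 n) (0\<^sub>m n 1) C3)"
    then have ij: "i < ?N" "j < ?N" by (auto simp: C3_def)
    then show "C $$ (i, j) = four_block_mat (diag_of 1 (\<lambda>_. r)) (0\<^sub>m 1 n) (0\<^sub>m n 1) C3 $$ (i, j)"
      using C0[of i] C0[of j] Csym[of 0 j] e by (cases i; cases j) (auto simp: C3_def)
  qed (use dC in \<open>auto simp: C3_def\<close>)
  have "diag_of ?N ?l = four_block_mat (diag_of 1 (\<lambda>_. r)) (0\<^sub>m 1 n) (0\<^sub>m n 1) (diag_of n l)"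
    by (subst diag_of_Suc) simp
  then have "E * diag_of ?N ?l = four_block_mat (1\<^sub>m 1 * diag_of 1 (\<lambda>_. r)) (0\<^sub>m 1 n) (0\<^sub>m n 1) (V * diag_of n l)"
    unfolding E_def by (simp only:) (intro four_block_diag_mult cV one_carrier_mat)
  then have "E * diag_of ?N ?l * E\<dagger> = four_block_mat (diag_of 1 (\<lambda>_. r) * 1\<^sub>m 1) (0\<^sub>m 1 n) (0\<^sub>m n 1) (V * diag_of n l * V\<dagger>)"
    unfolding Ea by (simp only: mat_one_mult diag_of_dims) (subst four_block_diag_mult, auto intro: cV)
  then have "E * diag_of ?N ?l * E\<dagger> = C"
    unfolding C_eq V(2) by simp
  then have EC: "C = E * diag_of ?N ?l * E\<dagger>" ..
  have "A = W * C * W\<dagger>"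
    unfolding C_def using dW dimA by (simp add: mat_assoc unitary_cancel[OF W(1)])
  also have "\<dots> = W * E * diag_of ?N ?l * (W * E)\<dagger>"
    unfolding EC using dW(1,2) dE by (simp add: adj_mult mat_assoc)
  finally show ?case using unitary_mult[OF W(1) uE] by (intro exI conjI)
qed

lemma exists_sorting_permutation:
  fixes l :: "nat \<Rightarrow> real"
  shows "\<exists>s. bij_betw s {..<N} {..<N} \<and> (\<forall>i j. i \<le> j \<longrightarrow> j < N \<longrightarrow> l (s j) \<le> l (s i))"
proof -
  define xs where "xs = sort_key (\<lambda>i. - l i) [0..<N]"
  have xs: "distinct xs" "set xs = {..<N}" "length xs = N" "sorted (map (\<lambda>i. - l i) xs)"
    by (auto simp: xs_def)
  have "bij_betw ((!) xs) {..<N} {..<N}"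
    by (rule bij_betw_nth[OF xs(1)]) (simp_all only: xs)
  moreover have "l (xs ! j) \<le> l (xs ! i)" if "i \<le> j" "j < N" for i j
    using sorted_nth_mono[OF xs(4), of i j] xs(3) that by simp
  ultimately show ?thesis by blast
qed

text \<open>Diagonalise, then absorb a sorting permutation into \<open>V\<close>. The decreasing
  order is what later allows cutting a spectrum into consecutive blocks whose spreads
  telescope.\<close>

theorem spectral:
  assumes "hermitian A" "dim_row A = n"
  shows "\<exists>V l. unitary n V \<and> A = V * diag_of n l * V\<dagger> \<and> (\<forall>i j. i \<le> j \<longrightarrow> j < n \<longrightarrow> l j \<le> l i)"
proof -
  obtain V l where V: "unitary n V" "A = V * diag_of n l * V\<dagger>"
    using spectral_unsorted[OF assms] by blast
  obtain s where s: "bij_betw s {..<n} {..<n}" "\<forall>i j. i \<le> j \<longrightarrow> j < n \<longrightarrow> l (s j) \<le> l (s i)"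
    using exists_sorting_permutation[of n l] by blast
  let ?P = "perm_mat n s"
  note uP = unitary_perm_mat[OF s(1)]
  note dV = unitaryD[OF V(1)]
  have "(V * ?P) * diag_of n (\<lambda>i. l (s i)) * (V * ?P)\<dagger> = V * (?P * (?P\<dagger> * (diag_of n l * (?P * (?P\<dagger> * V\<dagger>)))))"
    unfolding perm_mat_conj[OF s(1), of l, symmetric] using dV by (simp add: adj_mult mat_assoc)
  also have "\<dots> = A"
    using dV V(2) by (simp add: unitary_cancel[OF uP] mat_assoc)
  finally have "A = (V * ?P) * diag_of n (\<lambda>i. l (s i)) * (V * ?P)\<dagger>" ..
  then show ?thesis using s(2) unitary_mult[OF V(1) uP] by (intro exI conjI)
qed

text \<open>The bridge from roots of the characteristic polynomial, on which entropy, positivity and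
  both norms are based, to an explicit diagonalisation. Any diagonalisation may be used, so later
  proofs can take one in product form.\<close>

lemma spec_unitary_diag:
  assumes V: "unitary N V"
  shows "spec (V * diag_of N l * V\<dagger>) = mset (map (\<lambda>i. complex_of_real (l i)) [0..<N])"
proof -
  let ?X = "V * diag_of N l * V\<dagger>"
  note dV = unitaryD[OF V]
  have "similar_mat_wit ?X (diag_of N l) V (V\<dagger>)"
    using dV by (intro similar_mat_witI[of _ _ N]) auto
  then have "char_poly ?X = char_poly (diag_of N l)"
    by (intro char_poly_similar) (auto simp: similar_mat_def)
  also have "\<dots> = (\<Prod>a\<leftarrow>diag_mat (diag_of N l). [:- a, 1:])"
    by (rule char_poly_upper_triangular[of _ N]) (auto simp: diag_of_def)
  also have "diag_mat (diag_of N l) = map (\<lambda>i. complex_of_real (l i)) [0..<N]"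
    by (auto simp: diag_mat_def)
  finally have "spec ?X = proots (\<Prod>a\<leftarrow>map (\<lambda>i. complex_of_real (l i)) [0..<N]. [:- a, 1:])"
    by (simp add: spec_def)
  also have "\<dots> = mset (map (\<lambda>i. complex_of_real (l i)) [0..<N])"
  proof -
    have "proots (\<Prod>a\<leftarrow>xs. [:- a, 1:]) = mset xs" for xs :: "complex list"
    proof (induction xs)
      case (Cons a xs)
      have "(\<Prod>a\<leftarrow>xs. [:- a, 1:]) \<noteq> 0" by (auto simp: prod_list_zero_iff)
      then show ?case using Cons by (simp add: proots_mult del: mult_pCons_left)
    qed simp
    then show ?thesis .
  qed
  finally show ?thesis .
qed

lemma sum_mset_spec:
  assumes "unitary N V"
  shows "\<Sum>\<^sub># (image_mset f (spec (V * diag_of N l * V\<dagger>))) = (\<Sum>i<N. f (complex_of_real (l i)))"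
proof -
  have "sum_list (map g [0..<N]) = sum g {..<N}" for g :: "nat \<Rightarrow> 'a"
    by (induction N) auto
  then show ?thesis
    unfolding spec_unitary_diag[OF assms] mset_map[symmetric] sum_mset_sum_list map_map comp_def .
qed

lemma entropy_unitary_diag:
  assumes "unitary N V"
  shows "entropy (V * diag_of N l * V\<dagger>) = - (\<Sum>i<N. if l i \<le> 0 then 0 else l i * log 2 (l i))"
  unfolding entropy_def sum_mset_spec[OF assms] Re_complex_of_real ..

lemma psd_unitary_diag:
  assumes "unitary N V"
  shows "psd (V * diag_of N l * V\<dagger>) \<longleftrightarrow> (\<forall>i<N. 0 \<le> l i)"
proof -
  have "psd (V * diag_of N l * V\<dagger>) \<longleftrightarrow> (\<forall>e\<in>#spec (V * diag_of N l * V\<dagger>). Im e = 0 \<and> 0 \<le> Re e)"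
    unfolding psd_def using unitary_diag_hermitian[OF assms, of l] by blast
  then show ?thesis unfolding spec_unitary_diag[OF assms] by auto
qed

lemma mtrace_unitary_diag:
  assumes "unitary N V"
  shows "mtrace (V * diag_of N l * V\<dagger>) = of_real (\<Sum>i<N. l i)"
proof -
  note dV = unitaryD[OF assms]
  have "mtrace (V * (diag_of N l * V\<dagger>)) = mtrace ((diag_of N l * V\<dagger>) * V)"
    using dV by (intro mtrace_comm) auto
  then show ?thesis using dV by (simp add: mat_assoc mtrace_diag_of)
qed

lemma density_unitary_diag:
  assumes "unitary N V"
  shows "density N (V * diag_of N l * V\<dagger>) \<longleftrightarrow> (\<forall>i<N. 0 \<le> l i) \<and> (\<Sum>i<N. l i) = 1"
proof -
  have "V * diag_of N l * V\<dagger> \<in> carrier_mat N N"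
    using unitaryD(1)[OF assms] by (intro carrier_matI) simp_all
  then show ?thesis
    unfolding density_def psd_unitary_diag[OF assms] mtrace_unitary_diag[OF assms] of_real_eq_1_iff by blast
qed

lemma density_diag_of: "density N (diag_of N l) \<longleftrightarrow> (\<forall>i<N. 0 \<le> l i) \<and> (\<Sum>i<N. l i) = 1"
proof -
  have "1\<^sub>m N * diag_of N l * (1\<^sub>m N)\<dagger> = diag_of N l" by simp
  then show ?thesis using density_unitary_diag[OF unitary_one, of N l] by simp
qed

lemma density_spectral:
  assumes "density N X"
  obtains V l where "unitary N V" "X = V * diag_of N l * V\<dagger>" "\<forall>i<N. 0 \<le> l i" "(\<Sum>i<N. l i) = 1"
proof -
  have "hermitian X" "dim_row X = N" using assms by (auto simp: density_def psd_def)
  from spectral[OF this] obtain V l where V: "unitary N V" and X: "X = V * diag_of N l * V\<dagger>" by blast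
  have "(\<forall>i<N. 0 \<le> l i) \<and> (\<Sum>i<N. l i) = 1"
    using assms unfolding X density_unitary_diag[OF V] .
  then show ?thesis using that[OF V X] by blast
qed

lemma densityD:
  assumes "density N X"
  shows "dim_row X = N" "dim_col X = N" "X\<dagger> = X" "mtrace X = 1" "hermitian X"
  using assms unfolding density_def psd_def hermitian_def by (blast intro: carrier_matD)+

section \<open>Trace norm and operator norm in terms of spectra\<close>

lemma tbound_unitary_diag:
  assumes "unitary N V"
  shows "tbound (V * diag_of N l * V\<dagger>) (\<Sum>i<N. \<bar>l i\<bar>)"
proof -
  note dV = unitaryD[OF assms]
  have "tbound (diag_of N l) (\<Sum>i<N. \<bar>l i\<bar>)"
    unfolding tbound_def
  proof (intro allI impI)
    fix B :: "complex mat"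
    assume B: "dim_row B = dim_col (diag_of N l)" "dim_col B = dim_row (diag_of N l)" "opbound B 1"
    have "cmod (mtrace (diag_of N l * B)) \<le> (\<Sum>i<N. cmod (of_real (l i) * B $$ (i, i)))"
      using B by (simp add: mtrace_diag_of_mult norm_sum)
    also have "\<dots> \<le> (\<Sum>i<N. \<bar>l i\<bar>)"
      using opbound_entry[OF B(3)] B by (intro sum_mono) (auto simp: norm_mult mult_left_le)
    finally show "cmod (mtrace (diag_of N l * B)) \<le> (\<Sum>i<N. \<bar>l i\<bar>)" .
  qed
  then show ?thesis using dV by (intro tbound_conj) auto
qed

lemma tbound_density:
  assumes "density N X"
  shows "tbound X 1"
proof -
  obtain V l where V: "unitary N V" "X = V * diag_of N l * V\<dagger>" "\<forall>i<N. 0 \<le> l i" "(\<Sum>i<N. l i) = 1"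
    using density_spectral[OF assms] by blast
  have "(\<Sum>i<N. \<bar>l i\<bar>) = 1" using V(3,4) by simp
  then show ?thesis unfolding V(2) using tbound_unitary_diag[OF V(1), of l] by simp
qed

lemma trace_norm_unitary_diag:
  assumes "unitary N V"
  shows "trace_norm (V * diag_of N l * V\<dagger>) = (\<Sum>i<N. \<bar>l i\<bar>)"
proof -
  note dV = unitaryD[OF assms]
  have "(V * diag_of N l * V\<dagger>)\<dagger> * (V * diag_of N l * V\<dagger>) = V * (diag_of N l * (V\<dagger> * (V * (diag_of N l * V\<dagger>))))"
    using dV by (simp add: adj_mult mat_assoc)
  also have "\<dots> = V * (diag_of N l * (diag_of N l * V\<dagger>))"
    using dV by (simp add: unitary_cancel[OF assms])
  also have "\<dots> = V * (diag_of N l * diag_of N l) * V\<dagger>"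
    using dV by (simp add: mat_assoc)
  finally show ?thesis
    unfolding trace_norm_def diag_of_mult by (simp add: sum_mset_spec[OF assms] power2_eq_square[symmetric])
qed

text \<open>The sign of the matrix, with eigenvalues \<open>sgn (l i)\<close> in the same
  eigenbasis, is the contraction at which the duality behind \<open>tbound\<close> is
  attained.\<close>

lemma trace_norm_attained:
  assumes "unitary N V"
  shows "\<exists>B. dim_row B = N \<and> dim_col B = N \<and> opbound B 1 \<and> mtrace (V * diag_of N l * V\<dagger> * B) = of_real (\<Sum>i<N. \<bar>l i\<bar>)"
proof -
  note dV = unitaryD[OF assms]
  let ?B = "V * diag_of N (\<lambda>i. sgn (l i)) * V\<dagger>"
  have "opbound ?B (1 * 1 * 1)"
    using dV by (intro opbound_mult opbound_unitary[OF assms] opbound_adj opbound_diag_of) (auto simp: sgn_if)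
  moreover have "V * diag_of N l * V\<dagger> * ?B = V * (diag_of N l * diag_of N (\<lambda>i. sgn (l i))) * V\<dagger>"
    using dV by (simp add: mat_assoc unitary_cancel[OF assms])
  then have "mtrace (V * diag_of N l * V\<dagger> * ?B) = of_real (\<Sum>i<N. l i * sgn (l i))"
    by (simp add: diag_of_mult mtrace_unitary_diag[OF assms])
  then have "mtrace (V * diag_of N l * V\<dagger> * ?B) = of_real (\<Sum>i<N. \<bar>l i\<bar>)"
    by (simp add: linordered_idom_class.abs_sgn)
  ultimately show ?thesis using dV by (intro exI[of _ ?B]) auto
qed

lemma trace_norm_le:
  assumes "hermitian X" "tbound X t"
  shows "trace_norm X \<le> t"
proof -
  define n where "n = dim_row X"
  have n: "dim_row X = n" "dim_col X = n" using assms(1) by (auto simp: n_def hermitian_iff)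
  obtain V l where V: "unitary n V" and X: "X = V * diag_of n l * V\<dagger>"
    using spectral[OF assms(1) n(1)] by blast
  have eq: "trace_norm X = (\<Sum>i<n. \<bar>l i\<bar>)"
    unfolding X by (rule trace_norm_unitary_diag[OF V])
  obtain B where B: "dim_row B = n" "dim_col B = n" "opbound B 1"
    "mtrace (X * B) = of_real (\<Sum>i<n. \<bar>l i\<bar>)"
    using trace_norm_attained[OF V, of l] unfolding X by blast
  have "cmod (mtrace (X * B)) \<le> t"
    using B n by (intro tboundD[OF assms(2)]) auto
  then show ?thesis unfolding B(4) eq norm_of_real by linarith
qed

lemma tbound_trace_norm:
  assumes "hermitian X"
  shows "tbound X (trace_norm X)"
proof -
  define n where "n = dim_row X"
  obtain V l where V: "unitary n V" and X: "X = V * diag_of n l * V\<dagger>"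
    using spectral[OF assms n_def[symmetric]] by blast
  show ?thesis
    unfolding X trace_norm_unitary_diag[OF V] by (rule tbound_unitary_diag[OF V])
qed

text \<open>An interface to \<open>op_norm\<close>: \<open>e\<close> lists the eigenvalues of the
  Gram matrix, each being the squared length of the image of a unit eigenvector. The two
  inequalities for \<open>op_norm\<close> hide the maximum in its definition, whose inserted 0
  covers dimension zero.\<close>

lemma op_norm_spectral:
  obtains V e where "unitary (dim_col X) V" "X\<dagger> * X = V * diag_of (dim_col X) e * V\<dagger>"
    "\<And>i. i < dim_col X \<Longrightarrow> 0 \<le> e i"
    "\<And>i. i < dim_col X \<Longrightarrow> sqrt (e i) \<le> op_norm X"
    "\<And>t. 0 \<le> t \<Longrightarrow> (\<And>i. i < dim_col X \<Longrightarrow> e i \<le> t\<^sup>2) \<Longrightarrow> op_norm X \<le> t"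
    "\<And>i. i < dim_col X \<Longrightarrow> e i = (fnorm (X * mat (dim_col X) 1 (\<lambda>(k, _). V $$ (k, i))))\<^sup>2"
proof -
  let ?n = "dim_col X"
  have "hermitian (X\<dagger> * X)" "dim_row (X\<dagger> * X) = ?n" by (simp_all add: hermitian_iff adj_mult)
  from spectral[OF this] obtain V e where V: "unitary ?n V" and X: "X\<dagger> * X = V * diag_of ?n e * V\<dagger>"
    by blast
  note dV = unitaryD[OF V]
  have "V\<dagger> * (X\<dagger> * X) * V = diag_of ?n e"
    unfolding X using dV by (simp add: mat_assoc unitary_cancel[OF V])
  then have XV: "(X * V)\<dagger> * (X * V) = diag_of ?n e"
    using dV by (simp add: adj_mult mat_assoc)
  have e: "e i = (\<Sum>k<dim_row X. (cmod ((X * V) $$ (k, i)))\<^sup>2)" if "i < ?n" for i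
  proof -
    have "complex_of_real (e i) = ((X * V)\<dagger> * (X * V)) $$ (i, i)" using that by (simp add: XV del: index_mult_mat(1))
    also have "\<dots> = of_real (\<Sum>k<dim_row (X * V). (cmod ((X * V) $$ (k, i)))\<^sup>2)"
      using that dV by (intro gram_index) simp
    finally show ?thesis unfolding of_real_eq_iff by simp
  qed
  have e': "e i = (fnorm (X * mat ?n 1 (\<lambda>(k, _). V $$ (k, i))))\<^sup>2" if "i < ?n" for i
    using that dV by (simp add: e fnorm_sq index_mult del: index_mult_mat(1))
  have e0: "0 \<le> e i" if "i < ?n" for i unfolding e[OF that] by (intro sum_nonneg) auto
  let ?S = "insert 0 (Re ` set_mset (spec (X\<dagger> * X)))"
  have S: "?S = insert 0 (e ` {..<?n})"
    unfolding X spec_unitary_diag[OF V] by (auto simp: image_image)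
  have op: "op_norm X = sqrt (Max (insert 0 (e ` {..<?n})))" unfolding op_norm_def S ..
  show ?thesis
  proof (rule that[OF V X])
    show "sqrt (e i) \<le> op_norm X" if "i < ?n" for i
      unfolding op using that by (intro real_sqrt_le_mono Max_ge) auto
    show "op_norm X \<le> t" if "0 \<le> t" "\<And>i. i < ?n \<Longrightarrow> e i \<le> t\<^sup>2" for t
      unfolding op using that by (intro real_le_lsqrt) auto
  qed (use e0 e' in auto)
qed

lemma op_norm_le:
  assumes "opbound X t"
  shows "op_norm X \<le> t"
proof -
  obtain V e where V: "unitary (dim_col X) V"
    and le: "\<And>t. 0 \<le> t \<Longrightarrow> (\<And>i. i < dim_col X \<Longrightarrow> e i \<le> t\<^sup>2) \<Longrightarrow> op_norm X \<le> t"
    and e: "\<And>i. i < dim_col X \<Longrightarrow> e i = (fnorm (X * mat (dim_col X) 1 (\<lambda>(k, _). V $$ (k, i))))\<^sup>2"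
    by (rule op_norm_spectral[of X]) blast
  note dV = unitaryD[OF V]
  show ?thesis
  proof (rule le)
    show t: "0 \<le> t" using assms by (rule opbound_nonneg)
    fix i assume i: "i < dim_col X"
    let ?Y = "mat (dim_col X) 1 (\<lambda>(k, _). V $$ (k, i))"
    have "complex_of_real ((fnorm ?Y)\<^sup>2) = (V\<dagger> * V) $$ (i, i)"
      using i dV(1,2) gram_index[of i V] by (simp add: fnorm_sq del: index_mult_mat(1))
    also have "\<dots> = 1" using i dV by simp
    finally have "(fnorm ?Y)\<^sup>2 = 1" using of_real_eq_1_iff by blast
    then have "fnorm ?Y = 1" by (metis fnorm_nonneg one_power2 power2_eq_iff_nonneg zero_le_one)
    then have "fnorm (X * ?Y) \<le> t" using opboundD[OF assms, of ?Y] by simp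
    then show "e i \<le> t\<^sup>2" unfolding e[OF i] by (intro power_mono) auto
  qed
qed

text \<open>In the eigenbasis of the Gram matrix, the squared norm of \<open>X * Y\<close> is a sum
  of squares with weights \<open>e i\<close>. The diagonalisation is a premise so that Kronecker
  products can supply their own in product form.\<close>

lemma opbound_gram:
  assumes V: "unitary (dim_col X) V" and X: "X\<dagger> * X = V * diag_of (dim_col X) e * V\<dagger>"
    and e0: "\<And>i. i < dim_col X \<Longrightarrow> 0 \<le> e i" and ge: "\<And>i. i < dim_col X \<Longrightarrow> sqrt (e i) \<le> t"
    and nn: "0 \<le> t"
  shows "opbound X t"
proof -
  note dV = unitaryD[OF V]
  have "fnorm (X * Y) \<le> t * fnorm Y" if Y: "dim_row Y = dim_col X" for Y
  proof -
    let ?Z = "V\<dagger> * Y"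
    let ?D = "diag_of (dim_col X) (\<lambda>i. sqrt (e i))"
    have "(X * Y)\<dagger> * (X * Y) = Y\<dagger> * ((X\<dagger> * X) * Y)" using Y by (simp add: adj_mult mat_assoc)
    also have "\<dots> = ?Z\<dagger> * (diag_of (dim_col X) e * ?Z)"
      unfolding X using Y dV by (simp add: adj_mult mat_assoc)
    also have "diag_of (dim_col X) e = ?D * ?D"
      unfolding diag_of_mult using e0 by (intro diag_of_cong) simp
    also have "?Z\<dagger> * (?D * ?D * ?Z) = (?D * ?Z)\<dagger> * (?D * ?Z)" using Y dV by (simp add: adj_mult mat_assoc)
    finally have "mtrace ((X * Y)\<dagger> * (X * Y)) = mtrace ((?D * ?Z)\<dagger> * (?D * ?Z))" by simp
    then have "(fnorm (X * Y))\<^sup>2 = (fnorm (?D * ?Z))\<^sup>2"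
      unfolding mtrace_adj_mult_self using of_real_eq_iff by blast
    then have "fnorm (X * Y) = fnorm (?D * ?Z)" by (simp add: power2_eq_iff_nonneg)
    also have "\<dots> \<le> t * fnorm ?Z"
      using ge e0 nn Y dV by (intro fnorm_diag_of_mult) auto
    also have "fnorm ?Z = fnorm Y"
      using fnorm_isometry[of "V\<dagger>" "dim_col X" Y] dV Y by simp
    finally show ?thesis .
  qed
  then show ?thesis using nn by (auto simp: opbound_def)
qed

lemma opbound_op_norm: "opbound X (op_norm X)"
proof -
  obtain V e where V: "unitary (dim_col X) V" and X: "X\<dagger> * X = V * diag_of (dim_col X) e * V\<dagger>"
    and e0: "\<And>i. i < dim_col X \<Longrightarrow> 0 \<le> e i" and ge: "\<And>i. i < dim_col X \<Longrightarrow> sqrt (e i) \<le> op_norm X"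
    by (rule op_norm_spectral[of X]) blast
  have "0 \<le> op_norm X" by (auto simp: op_norm_def)
  then show ?thesis using e0 ge by (intro opbound_gram[OF V X]) auto
qed

section \<open>Kronecker products\<close>

lemma kron_dims [simp]: "dim_row (kron A B) = dim_row A * dim_row B" "dim_col (kron A B) = dim_col A * dim_col B"
  by (simp_all add: kron_def)

lemma kron_index:
  "x < dim_row A * dim_row B \<Longrightarrow> y < dim_col A * dim_col B \<Longrightarrow>
   kron A B $$ (x, y) = A $$ (x div dim_row B, y div dim_col B) * B $$ (x mod dim_row B, y mod dim_col B)"
  by (simp add: kron_def)

lemma div_mod_less:
  fixes x a b :: nat
  assumes "x < a * b"
  shows "x div b < a" "x mod b < b"
proof -
  have "0 < b" using assms by (cases b) auto
  then show "x div b < a" "x mod b < b" using assms by (auto simp: less_mult_imp_div_less)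
qed

text \<open>A Kronecker index encodes the pair \<open>(i, j)\<close> as \<open>i * b + j\<close>;
  this is the matching change of summation variables.\<close>

lemma sum_div_mod:
  fixes f :: "nat \<Rightarrow> nat \<Rightarrow> 'a::comm_monoid_add"
  shows "(\<Sum>x<a * b. f (x div b) (x mod b)) = (\<Sum>i<a. \<Sum>j<b. f i j)"
proof -
  have "(\<Sum>x<a * b. f (x div b) (x mod b)) = (\<Sum>i<a. \<Sum>x=i * b..<i * b + b. f (x div b) (x mod b))"
    by (rule sum.nat_group[symmetric])
  also have "\<dots> = (\<Sum>i<a. \<Sum>j<b. f i j)"
  proof (rule sum.cong[OF refl])
    fix i
    have "(\<Sum>x=i * b..<i * b + b. f (x div b) (x mod b)) = (\<Sum>j=0..<b. f ((j + i * b) div b) ((j + i * b) mod b))"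
      using sum.shift_bounds_nat_ivl[of "\<lambda>x. f (x div b) (x mod b)" 0 "i * b" b] by (simp add: add.commute)
    also have "\<dots> = (\<Sum>j<b. f i j)"
      unfolding lessThan_atLeast0 by (intro sum.cong) auto
    finally show "(\<Sum>x=i * b..<i * b + b. f (x div b) (x mod b)) = (\<Sum>j<b. f i j)" .
  qed
  finally show ?thesis .
qed

lemma kron_mult:
  assumes "dim_col A = dim_row C" "dim_col B = dim_row D"
  shows "kron A B * kron C D = kron (A * C) (B * D)"
proof (rule eq_matI)
  fix x y assume "x < dim_row (kron (A * C) (B * D))" "y < dim_col (kron (A * C) (B * D))"
  then have x: "x < dim_row A * dim_row B" and y: "y < dim_col C * dim_col D" by auto
  note xs = div_mod_less[OF x] and ys = div_mod_less[OF y]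
  have "(kron A B * kron C D) $$ (x, y) = (\<Sum>z<dim_row C * dim_row D.
      (A $$ (x div dim_row B, z div dim_row D) * C $$ (z div dim_row D, y div dim_col D))
      * (B $$ (x mod dim_row B, z mod dim_row D) * D $$ (z mod dim_row D, y mod dim_col D)))"
    using x y assms by (subst index_mult) (auto simp: kron_index mult_ac intro!: sum.cong)
  also have "\<dots> = (\<Sum>i<dim_row C. \<Sum>j<dim_row D.
      (A $$ (x div dim_row B, i) * C $$ (i, y div dim_col D))
      * (B $$ (x mod dim_row B, j) * D $$ (j, y mod dim_col D)))"
    by (rule sum_div_mod)
  also have "\<dots> = kron (A * C) (B * D) $$ (x, y)"
    using x y xs ys assms by (simp add: kron_index index_mult sum_product del: index_mult_mat(1))
  finally show "(kron A B * kron C D) $$ (x, y) = kron (A * C) (B * D) $$ (x, y)" .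
qed auto

lemma kron_adj: "(kron A B)\<dagger> = kron (A\<dagger>) (B\<dagger>)"
  by (rule eq_matI) (auto simp: kron_index div_mod_less)

lemma kron_add_right:
  "dim_row A = dim_row B \<Longrightarrow> dim_col A = dim_col B \<Longrightarrow> kron C (A + B) = kron C A + kron C B"
  by (rule eq_matI) (auto simp: kron_index div_mod_less distrib_left)

lemma kron_diff_left:
  "dim_row A = dim_row B \<Longrightarrow> dim_col A = dim_col B \<Longrightarrow> kron (A - B) C = kron A C - kron B C"
  by (rule eq_matI) (auto simp: kron_index div_mod_less algebra_simps)

lemma kron_zero_right: "kron A (0\<^sub>m r s) = 0\<^sub>m (dim_row A * r) (dim_col A * s)"
  by (rule eq_matI) (auto simp: kron_index div_mod_less)

lemma kron_diag_of: "kron (diag_of a f) (diag_of b g) = diag_of (a * b) (\<lambda>x. f (x div b) * g (x mod b))"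
proof (rule eq_matI)
  fix x y assume "x < dim_row (diag_of (a * b) (\<lambda>x. f (x div b) * g (x mod b)))"
    "y < dim_col (diag_of (a * b) (\<lambda>x. f (x div b) * g (x mod b)))"
  then have xy: "x < a * b" "y < a * b" by auto
  have "x = y" if "x div b = y div b" "x mod b = y mod b"
    using that div_mult_mod_eq by metis
  then show "kron (diag_of a f) (diag_of b g) $$ (x, y) = diag_of (a * b) (\<lambda>x. f (x div b) * g (x mod b)) $$ (x, y)"
    using xy div_mod_less[OF xy(1)] div_mod_less[OF xy(2)] by (auto simp: kron_index)
qed auto

lemma kron_one: "kron (1\<^sub>m a) (1\<^sub>m b) = 1\<^sub>m (a * b)"
  using kron_diag_of[of a "\<lambda>_. 1" b "\<lambda>_. 1"] by (simp add: diag_of_one)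

lemma kron_one_left: "kron (1\<^sub>m 1) A = A"
  by (rule eq_matI) (auto simp: kron_index)

lemma kron_assoc: "kron (kron A B) C = kron A (kron B C)"
proof (rule eq_matI)
  fix x y assume "x < dim_row (kron A (kron B C))" "y < dim_col (kron A (kron B C))"
  then have xy: "x < dim_row A * (dim_row B * dim_row C)" "y < dim_col A * (dim_col B * dim_col C)" by auto
  then have xy': "x < dim_row A * dim_row B * dim_row C" "y < dim_col A * dim_col B * dim_col C" by (auto simp: mult.assoc)
  \<comment> \<open>The two bracketings decode one index by different divisions; these identities
    make the results agree.\<close>
  have eq: "z div (b * c) = z div c div b" "z mod (b * c) div c = z div c mod b" "z mod (b * c) mod c = z mod c"
    if "0 < c" for z b c :: nat
    using that by (auto simp: div_mult2_eq[of z c b, symmetric] mult.commute[of b c] mod_mult2_eq[of z c b])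
  have pos: "0 < dim_row C" "0 < dim_col C" using xy by (auto intro!: Nat.gr0I)
  show "kron (kron A B) C $$ (x, y) = kron A (kron B C) $$ (x, y)"
    using xy xy' div_mod_less[OF xy(1)] div_mod_less[OF xy(2)] div_mod_less[OF xy'(1)] div_mod_less[OF xy'(2)] pos
    by (simp add: kron_index eq)
qed (auto simp: mult.assoc)

lemma mtrace_kron:
  assumes "dim_col A = dim_row A" "dim_col B = dim_row B"
  shows "mtrace (kron A B) = mtrace A * mtrace B"
proof -
  have "mtrace (kron A B) = (\<Sum>x<dim_row A * dim_row B. A $$ (x div dim_row B, x div dim_row B) * B $$ (x mod dim_row B, x mod dim_row B))"
    using assms by (auto simp: mtrace_def kron_index intro!: sum.cong)
  also have "\<dots> = (\<Sum>i<dim_row A. \<Sum>j<dim_row B. A $$ (i, i) * B $$ (j, j))"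
    by (rule sum_div_mod)
  finally show ?thesis by (simp add: mtrace_def sum_product)
qed

lemma kron_isometry:
  assumes "V\<dagger> * V = 1\<^sub>m a" "W\<dagger> * W = 1\<^sub>m b"
  shows "(kron V W)\<dagger> * kron V W = 1\<^sub>m (a * b)"
  using assms by (simp add: kron_adj kron_mult kron_one)

lemma unitary_kron: "unitary a V \<Longrightarrow> unitary b W \<Longrightarrow> unitary (a * b) (kron V W)"
  by (intro isometry_square_unitary kron_isometry) (auto dest: unitaryD)

text \<open>The spectrum of a tensor product consists of the pairwise products, with an eigenbasis
  in product form. Positivity, entropy and trace norm of tensor products reduce to double sums
  through it.\<close>

lemma kron_unitary_diag:
  assumes "dim_col V = a" "dim_col W = b"
  shows "kron (V * diag_of a p * V\<dagger>) (W * diag_of b q * W\<dagger>)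
    = kron V W * diag_of (a * b) (\<lambda>x. p (x div b) * q (x mod b)) * (kron V W)\<dagger>"
  using assms by (simp add: kron_adj kron_mult flip: kron_diag_of)

lemma sum_product_div_mod:
  fixes p q :: "nat \<Rightarrow> real"
  shows "(\<Sum>x<a * b. p (x div b) * q (x mod b)) = (\<Sum>i<a. p i) * (\<Sum>j<b. q j)"
  using sum_div_mod[where f = "\<lambda>i j. p i * q j" and a = a and b = b] by (simp add: sum_product)

lemma density_kron:
  assumes "density a X" "density b Y"
  shows "density (a * b) (kron X Y)"
proof -
  obtain V p where V: "unitary a V" "X = V * diag_of a p * V\<dagger>" "\<forall>i<a. 0 \<le> p i" "(\<Sum>i<a. p i) = 1"
    using density_spectral[OF assms(1)] by blast
  obtain W q where W: "unitary b W" "Y = W * diag_of b q * W\<dagger>" "\<forall>i<b. 0 \<le> q i" "(\<Sum>i<b. q i) = 1"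
    using density_spectral[OF assms(2)] by blast
  have "kron X Y = kron V W * diag_of (a * b) (\<lambda>x. p (x div b) * q (x mod b)) * (kron V W)\<dagger>"
    unfolding V(2) W(2) using unitaryD[OF V(1)] unitaryD[OF W(1)] by (intro kron_unitary_diag) auto
  then show ?thesis
    using density_unitary_diag[OF unitary_kron[OF V(1) W(1)]] V(3,4) W(3,4)
    by (auto simp: sum_product_div_mod div_mod_less)
qed

lemma entropy_kron:
  assumes "density a X" "density b Y"
  shows "entropy (kron X Y) = entropy X + entropy Y"
proof -
  obtain V p where V: "unitary a V" "X = V * diag_of a p * V\<dagger>" "\<forall>i<a. 0 \<le> p i" "(\<Sum>i<a. p i) = 1"
    using density_spectral[OF assms(1)] by blast
  obtain W q where W: "unitary b W" "Y = W * diag_of b q * W\<dagger>" "\<forall>i<b. 0 \<le> q i" "(\<Sum>i<b. q i) = 1"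
    using density_spectral[OF assms(2)] by blast
  have XY: "kron X Y = kron V W * diag_of (a * b) (\<lambda>x. p (x div b) * q (x mod b)) * (kron V W)\<dagger>"
    unfolding V(2) W(2) using unitaryD[OF V(1)] unitaryD[OF W(1)] by (intro kron_unitary_diag) auto
  define h where "h x = (if x \<le> 0 then 0 else x * log 2 x)" for x :: real
  have h: "h (x * y) = h x * y + x * h y" if "0 \<le> x" "0 \<le> y" for x y
  proof (cases "x = 0 \<or> y = 0")
    case False
    then have "0 < x" "0 < y" using that by auto
    moreover from this have "h (x * y) = x * y * log 2 (x * y)"
      unfolding h_def by (subst if_not_P) (auto simp: not_le)
    ultimately show ?thesis by (simp add: h_def log_mult not_le distrib_left mult_ac)
  qed (auto simp: h_def)
  have "entropy (kron X Y) = - (\<Sum>x<a * b. h (p (x div b) * q (x mod b)))"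
    unfolding XY entropy_unitary_diag[OF unitary_kron[OF V(1) W(1)]] h_def ..
  also have "\<dots> = - (\<Sum>i<a. \<Sum>j<b. h (p i * q j))"
    using sum_div_mod[of "\<lambda>i j. h (p i * q j)"] by simp
  also have "(\<Sum>i<a. \<Sum>j<b. h (p i * q j)) = (\<Sum>i<a. \<Sum>j<b. h (p i) * q j + p i * h (q j))"
    using V(3) W(3) by (intro sum.cong) (auto simp: h)
  also have "\<dots> = (\<Sum>i<a. h (p i)) + (\<Sum>j<b. h (q j))"
    using V(4) W(4) by (simp add: sum.distrib flip: sum_product)
  finally show ?thesis
    unfolding V(2) W(2) entropy_unitary_diag[OF V(1)] entropy_unitary_diag[OF W(1)] h_def by simp
qed

text \<open>The Gram matrix is that of \<open>A\<close> with each eigenvalue repeated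
  \<open>k\<close> times, so the eigenvalue bound is inherited.\<close>

lemma opbound_kron_one:
  assumes "opbound A t"
  shows "opbound (kron A (1\<^sub>m k)) t"
proof -
  let ?n = "dim_col A"
  obtain V e where V: "unitary ?n V" and A: "A\<dagger> * A = V * diag_of ?n e * V\<dagger>"
    and e0: "\<And>i. i < ?n \<Longrightarrow> 0 \<le> e i" and ge: "\<And>i. i < ?n \<Longrightarrow> sqrt (e i) \<le> op_norm A"
    by (rule op_norm_spectral[of A]) blast
  have le: "op_norm A \<le> t" using assms by (rule op_norm_le)
  have "(kron A (1\<^sub>m k))\<dagger> * kron A (1\<^sub>m k) = kron (V * diag_of ?n e * V\<dagger>) (1\<^sub>m k * diag_of k (\<lambda>_. 1) * (1\<^sub>m k)\<dagger>)"
    by (simp add: kron_adj kron_mult A diag_of_one)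
  also have "\<dots> = kron V (1\<^sub>m k) * diag_of (?n * k) (\<lambda>x. e (x div k) * 1) * (kron V (1\<^sub>m k))\<dagger>"
    using unitaryD[OF V] by (intro kron_unitary_diag) auto
  finally show ?thesis
    using unitary_kron[OF V unitary_one[of k]] e0 order_trans[OF ge le] opbound_nonneg[OF assms]
    by (intro opbound_gram[where e = "\<lambda>x. e (x div k)" and V = "kron V (1\<^sub>m k)"]) (auto simp: div_mod_less)
qed

lemma opbound_one_kron:
  assumes "opbound A t"
  shows "opbound (kron (1\<^sub>m k) A) t"
proof -
  let ?n = "dim_col A"
  obtain V e where V: "unitary ?n V" and A: "A\<dagger> * A = V * diag_of ?n e * V\<dagger>"
    and e0: "\<And>i. i < ?n \<Longrightarrow> 0 \<le> e i" and ge: "\<And>i. i < ?n \<Longrightarrow> sqrt (e i) \<le> op_norm A"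
    by (rule op_norm_spectral[of A]) blast
  have le: "op_norm A \<le> t" using assms by (rule op_norm_le)
  have "(kron (1\<^sub>m k) A)\<dagger> * kron (1\<^sub>m k) A = kron (1\<^sub>m k * diag_of k (\<lambda>_. 1) * (1\<^sub>m k)\<dagger>) (V * diag_of ?n e * V\<dagger>)"
    by (simp add: kron_adj kron_mult A diag_of_one)
  also have "\<dots> = kron (1\<^sub>m k) V * diag_of (k * ?n) (\<lambda>x. 1 * e (x mod ?n)) * (kron (1\<^sub>m k) V)\<dagger>"
    using unitaryD[OF V] by (intro kron_unitary_diag) auto
  finally show ?thesis
    using unitary_kron[OF unitary_one[of k] V] e0 order_trans[OF ge le] opbound_nonneg[OF assms]
    by (intro opbound_gram[where e = "\<lambda>x. e (x mod ?n)" and V = "kron (1\<^sub>m k) V"]) (auto simp: div_mod_less)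
qed

text \<open>The trace norm is multiplicative on tensor products and a state has trace norm one; both
  facts are read off the product spectrum.\<close>

lemma tbound_kron_density:
  assumes "hermitian X" "tbound X t" "density k Y"
  shows "tbound (kron X Y) t"
proof -
  define n where "n = dim_row X"
  obtain V l where V: "unitary n V" and X: "X = V * diag_of n l * V\<dagger>"
    using spectral[OF assms(1) n_def[symmetric]] by blast
  obtain W q where W: "unitary k W" "Y = W * diag_of k q * W\<dagger>" "\<forall>i<k. 0 \<le> q i" "(\<Sum>i<k. q i) = 1"
    using density_spectral[OF assms(3)] by blast
  have XY: "kron X Y = kron V W * diag_of (n * k) (\<lambda>x. l (x div k) * q (x mod k)) * (kron V W)\<dagger>"
    using kron_unitary_diag[of V n W k l q] unitaryD[OF V] unitaryD[OF W(1)] X W(2) by simp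
  have "(\<Sum>x<n * k. \<bar>l (x div k) * q (x mod k)\<bar>) = (\<Sum>x<n * k. \<bar>l (x div k)\<bar> * q (x mod k))"
    using W(3) by (intro sum.cong) (auto simp: abs_mult div_mod_less)
  also have "\<dots> = (\<Sum>i<n. \<bar>l i\<bar>)"
    using W(4) sum_product_div_mod[where p = "\<lambda>i. \<bar>l i\<bar>" and q = q and a = n and b = k] by simp
  also have "\<dots> = trace_norm X"
    unfolding X by (rule trace_norm_unitary_diag[OF V, symmetric])
  also have "\<dots> \<le> t" by (rule trace_norm_le[OF assms(1,2)])
  finally show ?thesis
    unfolding XY using tbound_mono tbound_unitary_diag[OF unitary_kron[OF V W(1)]] by blast
qed

section \<open>Product states and total charges\<close>

lemma prod_state_0: "prod_state \<rho> 0 = 1\<^sub>m 1"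
  by (simp add: prod_state_def)

lemma prod_state_Suc: "prod_state \<rho> (Suc n) = kron (\<rho> 0) (prod_state (\<lambda>i. \<rho> (Suc i)) n)"
  unfolding prod_state_def map_upt_Suc by simp

lemma density_one: "density 1 (1\<^sub>m 1)"
  using density_diag_of[of 1 "\<lambda>_. 1"] by (simp add: diag_of_one)

lemma density_prod_state:
  assumes "\<And>i. density d (\<rho> i)"
  shows "density (d ^ n) (prod_state \<rho> n)"
  using assms
proof (induction n arbitrary: \<rho>)
  case 0
  then show ?case using density_one by (simp add: prod_state_0)
next
  case (Suc n)
  then show ?case using density_kron[of d "\<rho> 0" "d ^ n"] by (simp add: prod_state_Suc)
qed

lemma foldr_add_dims:
  assumes "\<forall>M\<in>set Ms. dim_row M = r \<and> dim_col M = s" "dim_row Z = r" "dim_col Z = s"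
  shows "dim_row (foldr (+) Ms Z) = r" "dim_col (foldr (+) Ms Z) = s"
  using assms by (induction Ms) auto

lemma kron_foldr_add:
  assumes "\<forall>M\<in>set Ms. dim_row M = r \<and> dim_col M = s" "dim_row Z = r" "dim_col Z = s"
  shows "kron C (foldr (+) Ms Z) = foldr (+) (map (kron C) Ms) (kron C Z)"
  using assms
proof (induction Ms)
  case (Cons M Ms)
  then show ?case
    using foldr_add_dims[of Ms r s Z] by (simp add: kron_add_right)
qed simp

lemma total_charge_0: "total_charge d A 0 = 0\<^sub>m 1 1"
  by (simp add: total_charge_def)

text \<open>Peels off the first site, in step with \<open>prod_state_Suc\<close>, so that moments of
  the charge in a product state can be found by induction.\<close>

lemma total_charge_Suc:
  assumes "dim_row A = d" "dim_col A = d"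
  shows "total_charge d A (Suc n) = kron A (1\<^sub>m (d ^ n)) + kron (1\<^sub>m d) (total_charge d A n)"
proof -
  let ?f = "\<lambda>n i. kron (1\<^sub>m (d ^ i)) (kron A (1\<^sub>m (d ^ (n - 1 - i))))"
  have pw: "d ^ i * (d * d ^ (n - Suc i)) = d ^ n" if "i < n" for i
  proof -
    have "n = i + Suc (n - Suc i)" using that by simp
    then show ?thesis by (metis power_Suc power_add)
  qed
  have step: "?f (Suc n) (Suc i) = kron (1\<^sub>m d) (?f n i)" if "i < n" for i
    by (simp add: kron_assoc[symmetric] kron_one)
  have f0: "?f (Suc n) 0 = kron A (1\<^sub>m (d ^ n))"
    using kron_one_left by simp
  have "map (?f (Suc n)) [0..<Suc n] = ?f (Suc n) 0 # map (\<lambda>i. ?f (Suc n) (Suc i)) [0..<n]"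
    by (rule map_upt_Suc)
  also have "map (\<lambda>i. ?f (Suc n) (Suc i)) [0..<n] = map (kron (1\<^sub>m d)) (map (?f n) [0..<n])"
    unfolding map_map comp_def by (intro map_cong refl step) simp
  finally have "total_charge d A (Suc n) = kron A (1\<^sub>m (d ^ n))
      + foldr (+) (map (kron (1\<^sub>m d)) (map (?f n) [0..<n])) (0\<^sub>m (d ^ Suc n) (d ^ Suc n))"
    unfolding total_charge_def f0 by simp
  also have "(0\<^sub>m (d ^ Suc n) (d ^ Suc n) :: complex mat) = kron (1\<^sub>m d) (0\<^sub>m (d ^ n) (d ^ n))"
    by (simp add: kron_zero_right)
  also have "foldr (+) (map (kron (1\<^sub>m d)) (map (?f n) [0..<n])) (kron (1\<^sub>m d) (0\<^sub>m (d ^ n) (d ^ n)))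
      = kron (1\<^sub>m d) (total_charge d A n)"
    unfolding total_charge_def
    by (intro kron_foldr_add[symmetric, of _ "d ^ n" "d ^ n"]) (auto simp: pw assms)
  finally show ?thesis .
qed

lemma total_charge_basic:
  assumes "dim_row A = d" "dim_col A = d" "hermitian A" "opbound A a"
  shows "dim_row (total_charge d A n) = d ^ n" "dim_col (total_charge d A n) = d ^ n"
    "(total_charge d A n)\<dagger> = total_charge d A n" "opbound (total_charge d A n) (real n * a)"
proof -
  have "dim_row (total_charge d A n) = d ^ n \<and> dim_col (total_charge d A n) = d ^ n
    \<and> (total_charge d A n)\<dagger> = total_charge d A n \<and> opbound (total_charge d A n) (real n * a)"
  proof (induction n)
    case 0
    have "(0\<^sub>m 1 1 :: complex mat) = diag_of 1 (\<lambda>_. 0)" by (rule eq_matI) auto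
    then have "opbound (0\<^sub>m 1 1) 0" by (simp add: opbound_diag_of)
    then show ?case by (simp add: total_charge_0)
  next
    case (Suc n)
    have "opbound (kron A (1\<^sub>m (d ^ n)) + kron (1\<^sub>m d) (total_charge d A n)) (a + real n * a)"
      using Suc assms by (intro opbound_add opbound_kron_one opbound_one_kron) auto
    then show ?case
      using Suc assms hermitian_adj[OF assms(3)]
      by (simp add: total_charge_Suc adj_add kron_adj distrib_right del: One_nat_def)
  qed
  then show "dim_row (total_charge d A n) = d ^ n" "dim_col (total_charge d A n) = d ^ n"
    "(total_charge d A n)\<dagger> = total_charge d A n" "opbound (total_charge d A n) (real n * a)" by auto
qed

text \<open>The square of A \<otimes> 1 + 1 \<otimes> T has twice A \<otimes> T as its cross term,
  and the expectation of that term in a product state factorises.\<close>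

lemma mtrace_total_charge_Suc:
  assumes A: "dim_row A = d" "dim_col A = d" "hermitian A"
    and R: "density d R" "density (d ^ n) R'"
  shows "mtrace (kron R R' * total_charge d A (Suc n)) = mtrace (R * A) + mtrace (R' * total_charge d A n)"
    and "mtrace (kron R R' * (total_charge d A (Suc n) * total_charge d A (Suc n)))
      = mtrace (R * (A * A)) + 2 * (mtrace (R * A) * mtrace (R' * total_charge d A n))
        + mtrace (R' * (total_charge d A n * total_charge d A n))"
proof -
  let ?T = "total_charge d A n"
  note dR = densityD[OF R(1)] densityD[OF R(2)]
  have T: "dim_row ?T = d ^ n" "dim_col ?T = d ^ n"
    using total_charge_basic[OF A opbound_op_norm] by auto
  note S = total_charge_Suc[OF A(1,2), of n]
  have tr1: "mtrace (kron R R' * kron X Y) = mtrace (R * X) * mtrace (R' * Y)"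
    if "dim_row X = d" "dim_col X = d" "dim_row Y = d ^ n" "dim_col Y = d ^ n" for X Y
    using that dR by (subst kron_mult) (auto intro!: mtrace_kron)
  show "mtrace (kron R R' * total_charge d A (Suc n)) = mtrace (R * A) + mtrace (R' * ?T)"
    unfolding S using A T dR by (simp add: mat_mult_add mtrace_add tr1)
  have "total_charge d A (Suc n) * total_charge d A (Suc n)
    = (kron (A * A) (1\<^sub>m (d ^ n)) + kron A ?T) + (kron A ?T + kron (1\<^sub>m d) (?T * ?T))"
    unfolding S using A T by (simp add: mat_mult_add mat_add_mult kron_mult)
  then show "mtrace (kron R R' * (total_charge d A (Suc n) * total_charge d A (Suc n)))
      = mtrace (R * (A * A)) + 2 * (mtrace (R * A) * mtrace (R' * ?T)) + mtrace (R' * (?T * ?T))"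
    using A T dR by (simp add: mat_mult_add mtrace_add tr1)
qed

text \<open>Different sites are uncorrelated, so cross terms cancel and variances add. One site
  contributes at most a^2 from the second moment and a^2 from the squared mean. Linear growth,
  compared with the scale n^2, is what makes product states concentrate.\<close>

lemma variance_total_charge:
  assumes A: "dim_row A = d" "dim_col A = d" "hermitian A" "opbound A a"
    and "\<And>i. density d (\<rho> i)"
  shows "cmod (mtrace (prod_state \<rho> n * (total_charge d A n * total_charge d A n))
     - (mtrace (prod_state \<rho> n * total_charge d A n))\<^sup>2) \<le> real n * (2 * a\<^sup>2)"
  using assms(5)
proof (induction n arbitrary: \<rho>)
  case 0
  have "(0\<^sub>m 1 1 * 0\<^sub>m 1 1 :: complex mat) = 0\<^sub>m 1 1" by (rule eq_matI) auto
  then show ?case by (simp add: prod_state_0 total_charge_0 mtrace_def)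
next
  case (Suc n)
  let ?R = "\<rho> 0" and ?R' = "prod_state (\<lambda>i. \<rho> (Suc i)) n" and ?T = "total_charge d A n"
  have R: "density d ?R" "density (d ^ n) ?R'" using Suc.prems by (auto intro: density_prod_state)
  note dR = densityD[OF R(1)]
  have b1: "cmod (mtrace (?R * A)) \<le> 1 * a"
    using A dR by (intro tbound_scaled tbound_density[OF R(1)]) auto
  have b2: "cmod (mtrace (?R * (A * A))) \<le> 1 * (a * a)"
    using A dR by (intro tbound_scaled tbound_density[OF R(1)] opbound_mult) auto
  let ?e = "mtrace (?R * A)" and ?e' = "mtrace (?R' * ?T)"
  have "mtrace (prod_state \<rho> (Suc n) * (total_charge d A (Suc n) * total_charge d A (Suc n)))
     - (mtrace (prod_state \<rho> (Suc n) * total_charge d A (Suc n)))\<^sup>2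
     = (mtrace (?R * (A * A)) - ?e\<^sup>2) + (mtrace (?R' * (?T * ?T)) - ?e'\<^sup>2)"
    unfolding prod_state_Suc mtrace_total_charge_Suc[OF A(1-3) R] by (simp add: power2_eq_square algebra_simps)
  moreover have "cmod (mtrace (?R * (A * A)) - ?e\<^sup>2) \<le> a\<^sup>2 + a\<^sup>2"
  proof (rule order_trans[OF norm_triangle_ineq4 add_mono])
    show "cmod (mtrace (?R * (A * A))) \<le> a\<^sup>2" using b2 by (simp add: power2_eq_square)
    show "cmod (?e\<^sup>2) \<le> a\<^sup>2" using b1 by (simp add: norm_power power_mono)
  qed
  moreover have "cmod (mtrace (?R' * (?T * ?T)) - ?e'\<^sup>2) \<le> real n * (2 * a\<^sup>2)"
    using Suc by simp
  ultimately have "cmod (mtrace (prod_state \<rho> (Suc n) * (total_charge d A (Suc n) * total_charge d A (Suc n)))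
     - (mtrace (prod_state \<rho> (Suc n) * total_charge d A (Suc n)))\<^sup>2) \<le> (a\<^sup>2 + a\<^sup>2) + real n * (2 * a\<^sup>2)"
    using norm_triangle_mono by metis
  then show ?case by (simp add: algebra_simps)
qed

section \<open>Information variance and typical eigenvalues\<close>

definition plog :: "real \<Rightarrow> real" where
  "plog x = (if x \<le> 0 then 0 else x * log 2 x)"

text \<open>Summand of the second moment of the information: for a spectrum \<open>p\<close>, the
  sum of \<open>plog2\<close> minus the squared sum of \<open>plog\<close> is the variance of
  \<open>log 2 (p i)\<close> under \<open>p\<close>. The value at 0 is the limit.\<close>

definition plog2 :: "real \<Rightarrow> real" where
  "plog2 x = (if x \<le> 0 then 0 else x * (log 2 x)\<^sup>2)"

text \<open>Product rules from additivity of the logarithm. If a factor is zero, all terms vanish by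
  the convention at 0.\<close>

lemma plog_mult:
  assumes "0 \<le> x" "0 \<le> y"
  shows "plog (x * y) = plog x * y + x * plog y"
    "plog2 (x * y) = plog2 x * y + 2 * (plog x * plog y) + x * plog2 y"
proof -
  have *: "plog (x * y) = plog x * y + x * plog y \<and> plog2 (x * y) = plog2 x * y + 2 * (plog x * plog y) + x * plog2 y"
  proof (cases "x = 0 \<or> y = 0")
    case False
    then have xy: "0 < x" "0 < y" using assms by auto
    have "\<not> x * y \<le> 0" using mult_pos_pos[OF xy] by (subst not_le)
    then have "plog (x * y) = x * y * log 2 (x * y)" "plog2 (x * y) = x * y * (log 2 (x * y))\<^sup>2"
      by (simp_all only: plog_def plog2_def if_False)
    moreover have "plog x = x * log 2 x" "plog y = y * log 2 y" "plog2 x = x * (log 2 x)\<^sup>2" "plog2 y = y * (log 2 y)\<^sup>2"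
      using xy by (simp_all add: plog_def plog2_def)
    moreover have "log 2 (x * y) = log 2 x + log 2 y" using xy by (simp add: log_mult)
    ultimately show ?thesis by (simp add: power2_eq_square algebra_simps)
  qed (auto simp: plog_def plog2_def)
  then show "plog (x * y) = plog x * y + x * plog y"
    "plog2 (x * y) = plog2 x * y + 2 * (plog x * plog y) + x * plog2 y" by auto
qed

text \<open>Applying ln y \<le> y - 1 at y = 1 / sqrt x gives - ln x \<le> 2 / sqrt x, hence x (ln
  x)^2 \<le> 4. Uniformity in \<open>x\<close> lets the state vary freely from site to site.\<close>

lemma plog2_le:
  assumes "x \<le> 1"
  shows "plog2 x \<le> 4 / (ln 2)\<^sup>2"
proof (cases "x \<le> 0")
  case False
  then have x: "0 < x" by simp
  have "ln (sqrt (1 / x)) \<le> sqrt (1 / x) - 1" using x by (intro ln_le_minus_one) simp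
  moreover have "ln (sqrt (1 / x)) = ln (1 / x) / 2" using x by (intro ln_sqrt) simp
  moreover have "ln (1 / x) = - ln x" using x by (simp add: ln_div)
  ultimately have "- ln x \<le> 2 * sqrt (1 / x)" by simp
  moreover have "0 \<le> - ln x" using x assms by simp
  ultimately have "(- ln x)\<^sup>2 \<le> (2 * sqrt (1 / x))\<^sup>2" by (intro power_mono)
  then have "(ln x)\<^sup>2 \<le> 4 / x" using x by (simp add: power_mult_distrib)
  then have "x * (ln x)\<^sup>2 \<le> 4" using x by (simp add: field_simps)
  then show ?thesis using x by (simp add: plog2_def log_def power_divide divide_right_mono)
qed (simp add: plog2_def)

lemma entropy_plog: "unitary N V \<Longrightarrow> entropy (V * diag_of N p * V\<dagger>) = - (\<Sum>i<N. plog (p i))"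
  by (simp only: entropy_unitary_diag plog_def)

text \<open>The logarithm of an eigenvalue of a product state is a sum of independent single-site
  terms, so variances add; a site gives at most \<open>d\<close> times the bound of
  \<open>plog2_le\<close>. The diagonalisation is built inside the induction because each step
  relies on its product form.\<close>

lemma information_variance:
  assumes "\<And>i. density d (\<rho> i)"
  shows "\<exists>V p. unitary (d ^ n) V \<and> prod_state \<rho> n = V * diag_of (d ^ n) p * V\<dagger> \<and> (\<forall>i<d ^ n. 0 \<le> p i)
    \<and> (\<Sum>i<d ^ n. p i) = 1 \<and> (\<Sum>i<d ^ n. plog2 (p i)) - (\<Sum>i<d ^ n. plog (p i))\<^sup>2 \<le> real n * (real d * (4 / (ln 2)\<^sup>2))"
  using assms
proof (induction n arbitrary: \<rho>)
  case 0
  have "prod_state \<rho> 0 = 1\<^sub>m 1 * diag_of 1 (\<lambda>_. 1) * (1\<^sub>m 1)\<dagger>"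
    by (simp add: prod_state_0 diag_of_one)
  then show ?case
    using unitary_one[of 1] by (intro exI[of _ "1\<^sub>m 1"] exI[of _ "\<lambda>_. 1"]) (auto simp: plog_def plog2_def)
next
  case (Suc n)
  obtain W q where W: "unitary (d ^ n) W" "prod_state (\<lambda>i. \<rho> (Suc i)) n = W * diag_of (d ^ n) q * W\<dagger>"
    and q: "\<forall>i<d ^ n. 0 \<le> q i" "(\<Sum>i<d ^ n. q i) = 1"
    and qv: "(\<Sum>i<d ^ n. plog2 (q i)) - (\<Sum>i<d ^ n. plog (q i))\<^sup>2 \<le> real n * (real d * (4 / (ln 2)\<^sup>2))"
    using Suc.IH[of "\<lambda>i. \<rho> (Suc i)"] Suc.prems by blast
  obtain V p where V: "unitary d V" "\<rho> 0 = V * diag_of d p * V\<dagger>" and p: "\<forall>i<d. 0 \<le> p i" "(\<Sum>i<d. p i) = 1"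
    using density_spectral[OF Suc.prems[of 0]] by blast
  let ?r = "\<lambda>x. p (x div d ^ n) * q (x mod d ^ n)"
  have eq: "prod_state \<rho> (Suc n) = kron V W * diag_of (d * d ^ n) ?r * (kron V W)\<dagger>"
    unfolding prod_state_Suc V(2) W(2) using unitaryD[OF V(1)] unitaryD[OF W(1)] by (intro kron_unitary_diag) auto
  have p1: "p i \<le> 1" if "i < d" for i
    using member_le_sum[of i "{..<d}" p] p that by auto
  have r0: "\<forall>i<d * d ^ n. 0 \<le> ?r i" using p q by (auto simp: div_mod_less)
  have r1: "(\<Sum>i<d * d ^ n. ?r i) = 1"
    using sum_product_div_mod[where p = p and q = q and a = d and b = "d ^ n"] p q by simp
  have s1: "(\<Sum>i<d * d ^ n. plog (?r i)) = (\<Sum>i<d. plog (p i)) + (\<Sum>i<d ^ n. plog (q i))"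
  proof -
    have "(\<Sum>x<d * d ^ n. plog (?r x)) = (\<Sum>i<d. \<Sum>j<d ^ n. plog (p i * q j))"
      using sum_div_mod[where f = "\<lambda>i j. plog (p i * q j)"] by simp
    also have "\<dots> = (\<Sum>i<d. \<Sum>j<d ^ n. plog (p i) * q j + p i * plog (q j))"
      using p q by (intro sum.cong) (auto simp: plog_mult)
    finally show ?thesis using p q by (simp add: sum.distrib flip: sum_product)
  qed
  have s2: "(\<Sum>i<d * d ^ n. plog2 (?r i)) = (\<Sum>i<d. plog2 (p i))
      + 2 * ((\<Sum>i<d. plog (p i)) * (\<Sum>i<d ^ n. plog (q i))) + (\<Sum>i<d ^ n. plog2 (q i))"
  proof -
    have "(\<Sum>x<d * d ^ n. plog2 (?r x)) = (\<Sum>i<d. \<Sum>j<d ^ n. plog2 (p i * q j))"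
      using sum_div_mod[where f = "\<lambda>i j. plog2 (p i * q j)"] by simp
    also have "\<dots> = (\<Sum>i<d. \<Sum>j<d ^ n. plog2 (p i) * q j + 2 * (plog (p i) * plog (q j)) + p i * plog2 (q j))"
      using p q by (intro sum.cong) (auto simp: plog_mult)
    also have "\<dots> = (\<Sum>i<d. plog2 (p i)) * (\<Sum>i<d ^ n. q i)
      + 2 * ((\<Sum>i<d. plog (p i)) * (\<Sum>i<d ^ n. plog (q i))) + (\<Sum>i<d. p i) * (\<Sum>i<d ^ n. plog2 (q i))"
      unfolding sum_product sum.distrib by (simp add: sum_distrib_left)
    finally show ?thesis using p q by simp
  qed
  have "(\<Sum>i<d. plog2 (p i)) \<le> (\<Sum>i<d. 4 / (ln 2)\<^sup>2)"
    using p1 by (intro sum_mono plog2_le) auto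
  then have "(\<Sum>i<d. plog2 (p i)) - (\<Sum>i<d. plog (p i))\<^sup>2 \<le> real d * (4 / (ln 2)\<^sup>2)"
    using zero_le_power2[of "\<Sum>i<d. plog (p i)"] unfolding sum_constant card_lessThan by linarith
  then have "(\<Sum>i<d * d ^ n. plog2 (?r i)) - (\<Sum>i<d * d ^ n. plog (?r i))\<^sup>2 \<le> real (Suc n) * (real d * (4 / (ln 2)\<^sup>2))"
    using qv unfolding s1 s2 power2_sum of_nat_Suc distrib_right[of 1] by simp
  then show ?case
    using eq r0 r1 unitary_kron[OF V(1) W(1)] unfolding power_Suc by blast
qed

text \<open>Chebyshev's inequality for the information, whose mean is the entropy \<open>S\<close>:
  \<open>r\<close> keeps the eigenvalues within a factor \<open>2 powr t\<close> of
  \<open>2 powr (- S)\<close>. Those kept are at least \<open>2 powr (- S - t)\<close> and sum to at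
  most one, which bounds their number.\<close>

lemma typical_part:
  assumes "\<And>i. density d (\<rho> i)" "0 < t"
  shows "\<exists>V p r. unitary (d ^ n) V \<and> prod_state \<rho> n = V * diag_of (d ^ n) p * V\<dagger>
    \<and> (\<forall>x<d ^ n. 0 \<le> r x \<and> r x \<le> p x \<and> r x \<le> 2 powr (t - entropy (prod_state \<rho> n)))
    \<and> (\<Sum>x<d ^ n. p x) = 1
    \<and> real (card {x. x < d ^ n \<and> r x \<noteq> 0}) \<le> 2 powr (entropy (prod_state \<rho> n) + t)
    \<and> (\<Sum>x<d ^ n. p x - r x) \<le> real n * (real d * (4 / (ln 2)\<^sup>2)) / t\<^sup>2"
proof -
  define N where "N = d ^ n"
  obtain V p where V: "unitary N V" "prod_state \<rho> n = V * diag_of N p * V\<dagger>" and p: "\<forall>i<N. 0 \<le> p i" "(\<Sum>i<N. p i) = 1"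
    and var: "(\<Sum>i<N. plog2 (p i)) - (\<Sum>i<N. plog (p i))\<^sup>2 \<le> real n * (real d * (4 / (ln 2)\<^sup>2))"
    using information_variance[of d \<rho> n, OF assms(1)] unfolding N_def by blast
  define S where "S = entropy (prod_state \<rho> n)"
  have S: "S = - (\<Sum>i<N. plog (p i))" unfolding S_def V(2) by (rule entropy_plog[OF V(1)])
  define T where "T = {x. x < N \<and> 0 < p x \<and> \<bar>log 2 (p x) + S\<bar> \<le> t}"
  define r where "r x = (if x \<in> T then p x else 0)" for x
  have fT: "finite T" unfolding T_def by simp
  have up: "p x \<le> 2 powr (t - S)" "2 powr (- S - t) \<le> p x" if "x \<in> T" for x
  proof -
    have "0 < p x" "log 2 (p x) \<le> t - S" "- S - t \<le> log 2 (p x)" using that by (auto simp: T_def)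
    then show "p x \<le> 2 powr (t - S)" "2 powr (- S - t) \<le> p x"
      by (simp_all add: log_le_iff le_log_iff)
  qed
  have Tset: "{x. x < N \<and> r x \<noteq> 0} = T" by (auto simp: r_def T_def)
  have "real (card T) * 2 powr (- S - t) \<le> (\<Sum>x\<in>T. p x)"
    using up(2) sum_mono[of T "\<lambda>_. 2 powr (- S - t)" p] by simp
  also have "\<dots> \<le> (\<Sum>x<N. p x)" using p(1) by (intro sum_mono2) (auto simp: T_def)
  finally have "real (card T) * 2 powr (- S - t) \<le> 1" using p(2) by simp
  then have "real (card T) * 2 powr (- S - t) * 2 powr (S + t) \<le> 1 * 2 powr (S + t)"
    by (intro mult_right_mono) auto
  then have cT: "real (card T) \<le> 2 powr (S + t)" by (simp add: mult.assoc flip: powr_add)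
  \<comment> \<open>The right-hand side is the expanded sum of
    \<open>p x * (log 2 (p x) + S)\<^sup>2\<close>; where \<open>r\<close> drops a positive
    eigenvalue, the square is at least \<open>t\<^sup>2\<close>.\<close>
  have "t\<^sup>2 * (\<Sum>x<N. p x - r x) \<le> (\<Sum>x<N. plog2 (p x) + 2 * S * plog (p x) + S\<^sup>2 * p x)"
    unfolding sum_distrib_left
  proof (rule sum_mono)
    fix x assume "x \<in> {..<N}"
    then have x: "x < N" "0 \<le> p x" using p by auto
    show "t\<^sup>2 * (p x - r x) \<le> plog2 (p x) + 2 * S * plog (p x) + S\<^sup>2 * p x"
    proof (cases "p x = 0")
      case True
      then show ?thesis by (simp add: r_def plog_def plog2_def)
    next
      case False
      then have px: "0 < p x" using x by simp
      have eq: "plog2 (p x) + 2 * S * plog (p x) + S\<^sup>2 * p x = p x * (log 2 (p x) + S)\<^sup>2"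
        using px by (simp add: plog_def plog2_def power2_eq_square algebra_simps)
      show ?thesis
      proof (cases "x \<in> T")
        case True
        then show ?thesis unfolding eq using px by (simp add: r_def)
      next
        case False
        then have "t \<le> \<bar>log 2 (p x) + S\<bar>" using x px by (simp add: T_def)
        then have "t\<^sup>2 \<le> \<bar>log 2 (p x) + S\<bar>\<^sup>2" using assms(2) by (intro power_mono) auto
        then have "t\<^sup>2 \<le> (log 2 (p x) + S)\<^sup>2" by simp
        from mult_left_mono[OF this x(2)] show ?thesis unfolding eq using False by (simp add: r_def mult.commute)
      qed
    qed
  qed
  also have "\<dots> = (\<Sum>x<N. plog2 (p x)) - (\<Sum>i<N. plog (p i))\<^sup>2"
    unfolding sum.distrib sum_distrib_left[symmetric] p(2) using S by (simp add: power2_eq_square)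
  also note var
  finally have "(\<Sum>x<N. p x - r x) \<le> real n * (real d * (4 / (ln 2)\<^sup>2)) / t\<^sup>2"
    using assms(2) by (simp add: field_simps)
  moreover have "\<forall>x<N. 0 \<le> r x \<and> r x \<le> p x \<and> r x \<le> 2 powr (t - S)"
    using p up by (auto simp: r_def)
  ultimately show ?thesis
    using V p(2) cT unfolding N_def[symmetric] S_def[symmetric] Tset[symmetric] by blast
qed

section \<open>Continuity of the entropy\<close>

text \<open>The diagonal of an operator in another orthonormal basis averages its eigenvalues with
  weights |<w_k, v_i>|^2, which \<open>unitary_sums\<close> shows to be doubly stochastic.\<close>

lemma unitary_conj_index:
  assumes V: "unitary N V" and W: "unitary N W" and i: "i < N"
  shows "(V\<dagger> * (W * diag_of N x * W\<dagger>) * V) $$ (i, i) = of_real (\<Sum>k<N. x k * (cmod ((W\<dagger> * V) $$ (k, i)))\<^sup>2)"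
proof -
  let ?G = "W\<dagger> * V"
  note d = unitaryD[OF V] unitaryD[OF W]
  have "V\<dagger> * (W * diag_of N x * W\<dagger>) * V = ?G\<dagger> * (diag_of N x * ?G)"
    using d by (simp add: adj_mult mat_assoc)
  then show ?thesis using quad_diag_of_diag[of ?G N i x] i d by (simp del: index_mult_mat(1))
qed

lemma unitary_sums:
  assumes G: "unitary N G"
  shows "i < N \<Longrightarrow> (\<Sum>k<N. (cmod (G $$ (k, i)))\<^sup>2) = 1" "i < N \<Longrightarrow> (\<Sum>k<N. (cmod (G $$ (i, k)))\<^sup>2) = 1"
proof -
  note d = unitaryD[OF G]
  show "(\<Sum>k<N. (cmod (G $$ (k, i)))\<^sup>2) = 1" if "i < N"
  proof -
    have "complex_of_real (\<Sum>k<N. (cmod (G $$ (k, i)))\<^sup>2) = 1"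
      using gram_index[of i G] d that by (simp del: index_mult_mat(1) of_real_sum)
    then show ?thesis by (simp only: of_real_eq_1_iff)
  qed
  show "(\<Sum>k<N. (cmod (G $$ (i, k)))\<^sup>2) = 1" if "i < N"
  proof -
    have "complex_of_real (\<Sum>k<N. (cmod (G\<dagger> $$ (k, i)))\<^sup>2) = 1"
      using gram_index[of i "G\<dagger>"] d that by (simp del: index_mult_mat(1) of_real_sum index_adj)
    then have "(\<Sum>k<N. (cmod (G\<dagger> $$ (k, i)))\<^sup>2) = 1" by (simp only: of_real_eq_1_iff)
    then show ?thesis using that d by simp
  qed
qed

lemma mtrace_unitary_diag_mult:
  assumes V: "unitary N V" and X: "dim_row X = N" "dim_col X = N"
  shows "mtrace (X * (V * diag_of N l * V\<dagger>)) = (\<Sum>i<N. of_real (l i) * (V\<dagger> * X * V) $$ (i, i))"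
proof -
  note d = unitaryD[OF V]
  have "mtrace (X * (V * diag_of N l * V\<dagger>)) = mtrace ((X * V) * (diag_of N l * V\<dagger>))"
    using d X by (simp add: mat_assoc)
  also have "\<dots> = mtrace ((diag_of N l * V\<dagger>) * (X * V))"
    using d X by (intro mtrace_comm) auto
  also have "\<dots> = mtrace (diag_of N l * (V\<dagger> * X * V))"
    using d X by (simp add: mat_assoc)
  also have "\<dots> = (\<Sum>i<N. of_real (l i) * (V\<dagger> * X * V) $$ (i, i))"
    using d by (intro mtrace_diag_of_mult) auto
  finally show ?thesis .
qed

text \<open>Gibbs' (Klein's) inequality. \<open>X\<close> and the comparison operator may have
  different eigenbases: pass to the squared overlaps \<open>a k i\<close>, apply ln y \<le> y - 1 to
  \<open>r i / x k\<close> for each pair, and sum up.\<close>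

lemma entropy_le_cross_entropy:
  assumes X: "density N X" and V: "unitary N V" and r: "\<And>i. i < N \<Longrightarrow> 0 < r i" "(\<Sum>i<N. r i) \<le> 1"
  shows "entropy X \<le> - Re (mtrace (X * (V * diag_of N (\<lambda>i. log 2 (r i)) * V\<dagger>)))"
proof -
  obtain W x where W: "unitary N W" "X = W * diag_of N x * W\<dagger>" and x: "\<forall>i<N. 0 \<le> x i" "(\<Sum>i<N. x i) = 1"
    using density_spectral[OF X] by blast
  define a where "a k i = (cmod ((W\<dagger> * V) $$ (k, i)))\<^sup>2" for k i
  note G = unitary_sums[OF unitary_mult[OF unitary_adj[OF W(1)] V], folded a_def]
  have a0: "0 \<le> a k i" for k i by (simp add: a_def)
  have "mtrace (X * (V * diag_of N (\<lambda>i. log 2 (r i)) * V\<dagger>))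
    = (\<Sum>i<N. of_real (log 2 (r i)) * (V\<dagger> * X * V) $$ (i, i))"
    using densityD[OF X] by (intro mtrace_unitary_diag_mult[OF V]) auto
  also have "\<dots> = (\<Sum>i<N. of_real (log 2 (r i) * (\<Sum>k<N. x k * a k i)))"
    unfolding W(2) a_def of_real_mult by (intro sum.cong refl arg_cong2[where f = "(*)"] unitary_conj_index[OF V W(1)]) simp
  finally have "Re (mtrace (X * (V * diag_of N (\<lambda>i. log 2 (r i)) * V\<dagger>))) = (\<Sum>i<N. log 2 (r i) * (\<Sum>k<N. x k * a k i))"
    unfolding of_real_sum[symmetric] by simp
  also have "\<dots> = (\<Sum>i<N. \<Sum>k<N. a k i * (x k * log 2 (r i)))"
    by (simp add: sum_distrib_left mult_ac)
  also have "\<dots> \<le> (\<Sum>i<N. \<Sum>k<N. a k i * (plog (x k) + (r i - x k) / ln 2))"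
  proof (intro sum_mono mult_left_mono a0)
    fix i k assume "i \<in> {..<N}" "k \<in> {..<N}"
    then have ri: "0 < r i" and xk: "0 \<le> x k" using r x by auto
    show "x k * log 2 (r i) \<le> plog (x k) + (r i - x k) / ln 2"
    proof (cases "x k = 0")
      case True then show ?thesis using ri by (simp add: plog_def)
    next
      case False
      then have xk: "0 < x k" using xk by simp
      have "ln (r i / x k) \<le> r i / x k - 1" using ri xk by (intro ln_le_minus_one) simp
      then have "x k * ln (r i / x k) \<le> x k * (r i / x k - 1)" using xk by (intro mult_left_mono) auto
      also have "\<dots> = r i - x k" using xk by (simp add: field_simps)
      also have "ln (r i / x k) = ln (r i) - ln (x k)" using ri xk by (simp add: ln_div)
      finally have "(x k * (ln (r i) - ln (x k))) / ln 2 \<le> (r i - x k) / ln 2" by (intro divide_right_mono) auto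
      then show ?thesis using xk by (simp add: plog_def log_def right_diff_distrib diff_divide_distrib)
    qed
  qed
  also have "\<dots> = (\<Sum>k<N. plog (x k) * (\<Sum>i<N. a k i)) + (\<Sum>i<N. r i * (\<Sum>k<N. a k i)) / ln 2 - (\<Sum>k<N. x k * (\<Sum>i<N. a k i)) / ln 2"
  proof -
    have "(\<Sum>i<N. \<Sum>k<N. a k i * (plog (x k) + (r i - x k) / ln 2))
      = (\<Sum>i<N. \<Sum>k<N. plog (x k) * a k i) + (\<Sum>i<N. \<Sum>k<N. r i * a k i / ln 2) - (\<Sum>i<N. \<Sum>k<N. x k * a k i / ln 2)"
      unfolding sum.distrib[symmetric] sum_subtractf[symmetric]
      by (intro sum.cong refl) (simp add: field_simps)
    also have "(\<Sum>i<N. \<Sum>k<N. plog (x k) * a k i) = (\<Sum>k<N. \<Sum>i<N. plog (x k) * a k i)" by (rule sum.swap)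
    also have "(\<Sum>i<N. \<Sum>k<N. x k * a k i / ln 2) = (\<Sum>k<N. \<Sum>i<N. x k * a k i / ln 2)" by (rule sum.swap)
    finally show ?thesis by (simp add: sum_distrib_left sum_divide_distrib)
  qed
  \<comment> \<open>All row and column sums of \<open>a\<close> are one, so the corrections add up
    to the total weight of \<open>r\<close> minus one, up to the factor \<open>ln 2\<close>, and
    this is at most zero.\<close>
  also have "\<dots> = (\<Sum>k<N. plog (x k)) + ((\<Sum>i<N. r i) - 1) / ln 2"
    using x(2) by (simp add: G diff_divide_distrib)
  also have "\<dots> \<le> (\<Sum>k<N. plog (x k))"
    using r(2) by (simp add: divide_nonpos_pos)
  finally show ?thesis unfolding W(2) entropy_plog[OF W(1)] by simp
qed

lemma density_dim_pos: "density N X \<Longrightarrow> 0 < N"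
  using densityD(1,4)[of N X] by (cases "N = 0") (auto simp: mtrace_def)

lemma entropy_bounds:
  assumes "density N X"
  shows "0 \<le> entropy X" "entropy X \<le> log 2 (real N)"
proof -
  obtain W x where W: "unitary N W" "X = W * diag_of N x * W\<dagger>" and x: "\<forall>i<N. 0 \<le> x i" "(\<Sum>i<N. x i) = 1"
    using density_spectral[OF assms] by blast
  have "plog (x i) \<le> 0" if "i < N" for i
    using member_le_sum[of i "{..<N}" x] x that by (auto simp: plog_def mult_nonneg_nonpos)
  then have "(\<Sum>i<N. plog (x i)) \<le> 0" by (intro sum_nonpos) auto
  then show "0 \<le> entropy X" unfolding W(2) entropy_plog[OF W(1)] by simp
  have N: "0 < N" using assms by (rule density_dim_pos)
  \<comment> \<open>Comparison with the maximally mixed state, whose logarithm is a multiple of the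
    identity.\<close>
  have "entropy X \<le> - Re (mtrace (X * (1\<^sub>m N * diag_of N (\<lambda>i. log 2 (1 / real N)) * (1\<^sub>m N)\<dagger>)))"
    using N by (intro entropy_le_cross_entropy[OF assms unitary_one]) auto
  also have "mtrace (X * (1\<^sub>m N * diag_of N (\<lambda>i. log 2 (1 / real N)) * (1\<^sub>m N)\<dagger>)) = of_real (log 2 (1 / real N)) * mtrace X"
  proof -
    have X1: "(1\<^sub>m N)\<dagger> * X * 1\<^sub>m N = X" using densityD[OF assms] by simp
    have X2: "mtrace X = (\<Sum>i<N. X $$ (i, i))" using densityD(1)[OF assms] by (simp add: mtrace_def)
    show ?thesis
      unfolding mtrace_unitary_diag_mult[OF unitary_one densityD(1,2)[OF assms]] X1 X2 sum_distrib_left ..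
  qed
  finally have "entropy X \<le> - log 2 (1 / real N)"
    unfolding densityD(4)[OF assms] by simp
  then show "entropy X \<le> log 2 (real N)"
    using N by (simp add: log_divide)
qed

lemma entropy_continuity:
  assumes X: "density N X" and Y: "density N Y" and e: "tbound (X - Y) e"
  shows "entropy X \<le> entropy Y + 1 + e * log 2 (2 * real N)"
proof -
  obtain V q where V: "unitary N V" "Y = V * diag_of N q * V\<dagger>" and q: "\<forall>i<N. 0 \<le> q i" "(\<Sum>i<N. q i) = 1"
    using density_spectral[OF Y] by blast
  have N: "0 < N" using X by (rule density_dim_pos)
  \<comment> \<open>Mixing keeps all logarithms within \<open>log 2 (2 * real N)\<close>, so the
    cross entropy is Lipschitz in the state. It costs one bit because \<open>r i\<close> is at least
    half of \<open>q i\<close>.\<close>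
  define r where "r i = (q i + 1 / real N) / 2" for i
  let ?B = "V * diag_of N (\<lambda>i. log 2 (r i)) * V\<dagger>"
  note dV = unitaryD[OF V(1)] densityD[OF X] densityD[OF Y]
  have q1: "q i \<le> 1" if "i < N" for i using member_le_sum[of i "{..<N}" q] q that by auto
  have r0: "0 < r i" "1 / (2 * real N) \<le> r i" "r i \<le> 1" "q i / 2 \<le> r i" if "i < N" for i
  proof -
    define u where "u = 1 / real N"
    have "0 < u" "u \<le> 1" using N by (auto simp: u_def)
    moreover have u: "1 / (2 * real N) = u / 2" by (simp add: u_def)
    moreover have "0 \<le> q i" "q i \<le> 1" using q1[OF that] q(1) that by auto
    ultimately have "0 < r i \<and> 1 / (2 * real N) \<le> r i \<and> r i \<le> 1 \<and> q i / 2 \<le> r i"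
      unfolding r_def u u_def[symmetric] by (intro conjI) (simp_all add: add_nonneg_pos)
    then show "0 < r i" "1 / (2 * real N) \<le> r i" "r i \<le> 1" "q i / 2 \<le> r i" by blast+
  qed
  have "(\<Sum>i<N. r i) = ((\<Sum>i<N. q i) + (\<Sum>i<N. 1 / real N)) / 2"
    unfolding r_def sum_divide_distrib[symmetric] sum.distrib ..
  then have r1: "(\<Sum>i<N. r i) \<le> 1" using N q(2) by simp
  have "\<bar>log 2 (r i)\<bar> \<le> log 2 (2 * real N)" if "i < N" for i
  proof -
    have "log 2 (1 / (2 * real N)) \<le> log 2 (r i)" using r0[OF that] N by (intro log_mono) auto
    moreover have "log 2 (1 / (2 * real N)) = - log 2 (2 * real N)" using N by (subst log_divide) auto
    moreover have "log 2 (r i) \<le> 0" using r0[OF that] by simp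
    ultimately show ?thesis by linarith
  qed
  then have "opbound (diag_of N (\<lambda>i. log 2 (r i))) (log 2 (2 * real N))"
    using N by (intro opbound_diag_of) auto
  then have "opbound ?B (1 * log 2 (2 * real N) * 1)"
    using dV by (intro opbound_mult opbound_adj opbound_unitary[OF V(1)]) auto
  then have B: "opbound ?B (log 2 (2 * real N))" by simp
  have "cmod (mtrace ((X - Y) * ?B)) \<le> e * log 2 (2 * real N)"
    using dV by (intro tbound_scaled[OF e B]) auto
  moreover have "mtrace ((X - Y) * ?B) = mtrace (X * ?B) - mtrace (Y * ?B)"
    using dV by (simp add: mat_diff_mult mtrace_diff)
  ultimately have 1: "- Re (mtrace (X * ?B)) \<le> - Re (mtrace (Y * ?B)) + e * log 2 (2 * real N)"
    using abs_Re_le_cmod[of "mtrace (X * ?B) - mtrace (Y * ?B)"] by simp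
  have "Y * ?B = V * (diag_of N q * diag_of N (\<lambda>i. log 2 (r i))) * V\<dagger>"
    unfolding V(2) using dV by (simp add: mat_assoc unitary_cancel[OF V(1)])
  then have "mtrace (Y * ?B) = of_real (\<Sum>i<N. q i * log 2 (r i))"
    by (simp only: diag_of_mult mtrace_unitary_diag[OF V(1)])
  then have "- Re (mtrace (Y * ?B)) = (\<Sum>i<N. - (q i * log 2 (r i)))" by (simp add: sum_negf)
  also have "\<dots> \<le> (\<Sum>i<N. q i - plog (q i))"
  proof (rule sum_mono)
    fix i assume "i \<in> {..<N}"
    then have i: "i < N" by simp
    show "- (q i * log 2 (r i)) \<le> q i - plog (q i)"
    proof (cases "q i = 0")
      case False
      then have qi: "0 < q i" using q i by (simp add: less_le)
      have "log 2 (q i / 2) \<le> log 2 (r i)" using qi r0[OF i] by (intro log_mono) auto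
      then have "q i * (log 2 (q i) - 1) \<le> q i * log 2 (r i)"
        using qi by (intro mult_left_mono) (auto simp: log_divide)
      then show ?thesis using qi by (simp add: plog_def algebra_simps)
    qed (simp add: plog_def)
  qed
  also have "\<dots> = 1 + entropy Y"
    unfolding V(2) entropy_plog[OF V(1)] using q(2) by (simp add: sum_subtractf)
  finally have 2: "- Re (mtrace (Y * ?B)) \<le> 1 + entropy Y" .
  have "entropy X \<le> - Re (mtrace (X * ?B))"
    by (rule entropy_le_cross_entropy[OF X V(1) r0(1) r1])
  then show ?thesis using 1 2 by linarith
qed

lemma entropy_unitary_conj:
  assumes "density N R" "unitary N U"
  shows "density N (U * R * U\<dagger>)" "entropy (U * R * U\<dagger>) = entropy R"
proof -
  obtain W x where W: "unitary N W" "R = W * diag_of N x * W\<dagger>" and x: "\<forall>i<N. 0 \<le> x i" "(\<Sum>i<N. x i) = 1"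
    using density_spectral[OF assms(1)] by blast
  have eq: "U * R * U\<dagger> = (U * W) * diag_of N x * (U * W)\<dagger>"
    unfolding W(2) using unitaryD[OF assms(2)] unitaryD[OF W(1)] by (simp add: adj_mult mat_assoc)
  note UW = unitary_mult[OF assms(2) W(1)]
  show "density N (U * R * U\<dagger>)" unfolding eq density_unitary_diag[OF UW] using x by blast
  show "entropy (U * R * U\<dagger>) = entropy R"
    unfolding eq entropy_unitary_diag[OF UW] unfolding W(2) entropy_unitary_diag[OF W(1)] ..
qed

lemma hermitian_density_diff: "density N X \<Longrightarrow> density N Y \<Longrightarrow> hermitian (X - Y)"
  using densityD[of N X] densityD[of N Y] by (simp add: hermitian_iff adj_diff)

lemma tbound_minus_commute:
  assumes "dim_row X = dim_row Y" "dim_col X = dim_col Y" "tbound (X - Y) t"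
  shows "tbound (Y - X) t"
proof -
  have "Y - X = - (X - Y)" using assms by (intro eq_matI) auto
  then show ?thesis using tbound_uminus[OF assms(3)] by simp
qed

text \<open>Continuity is applied in both directions. The ancilla entropies may differ, but both lie
  between 0 and \<open>log 2 (real k)\<close>, which is the last summand.\<close>

lemma entropy_difference_bound:
  assumes "density N \<rho>" "density N \<sigma>" "density k \<omega>" "density k \<omega>'" "unitary (N * k) U"
  shows "\<bar>entropy \<rho> - entropy \<sigma>\<bar> \<le> 1 + trace_norm (U * kron \<rho> \<omega>' * U\<dagger> - kron \<sigma> \<omega>) * log 2 (2 * real (N * k)) + log 2 (real k)"
proof -
  let ?X = "U * kron \<rho> \<omega>' * U\<dagger>" and ?Y = "kron \<sigma> \<omega>"
  note R = density_kron[OF assms(1,4)]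
  note X = entropy_unitary_conj[OF R assms(5)]
  note Y = density_kron[OF assms(2,3)]
  have t: "tbound (?X - ?Y) (trace_norm (?X - ?Y))"
    by (rule tbound_trace_norm[OF hermitian_density_diff[OF X(1) Y]])
  have t': "tbound (?Y - ?X) (trace_norm (?X - ?Y))"
    using densityD[OF X(1)] densityD[OF Y] by (intro tbound_minus_commute[OF _ _ t]) auto
  show ?thesis
    using entropy_continuity[OF X(1) Y t] entropy_continuity[OF Y X(1) t']
      entropy_bounds[OF assms(3)] entropy_bounds[OF assms(4)]
    unfolding X(2) entropy_kron[OF assms(1,4)] entropy_kron[OF assms(2,3)] by linarith
qed

text \<open>Two replacements. Passing from \<open>H\<close> to U\<dagger> H U costs the commutator
  norm, since U\<dagger> (U H - H U) = H - U\<dagger> H U. Passing from the rotated state to the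
  target costs their trace distance times the bound on the charge. As \<open>H\<close> is trivial on
  the ancilla, the ancilla states drop out of both expectations.\<close>

lemma charge_difference_bound:
  assumes "density N \<rho>" "density N \<sigma>" "density k \<omega>" "density k \<omega>'" "unitary (N * k) U"
    and T: "dim_row T = N" "dim_col T = N" "opbound T a"
  defines "H \<equiv> kron T (1\<^sub>m k)"
  shows "cmod (mtrace (\<rho> * T) - mtrace (\<sigma> * T)) \<le> op_norm (U * H - H * U)
    + trace_norm (U * kron \<rho> \<omega>' * U\<dagger> - kron \<sigma> \<omega>) * a"
proof -
  let ?R = "kron \<rho> \<omega>'" and ?Y = "kron \<sigma> \<omega>"
  let ?X = "U * ?R * U\<dagger>"
  note R = density_kron[OF assms(1,4)]
  note X = entropy_unitary_conj[OF R assms(5)]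
  note Y = density_kron[OF assms(2,3)]
  note dU = unitaryD[OF assms(5)]
  note d = densityD[OF assms(1)] densityD[OF assms(2)] densityD[OF assms(3)] densityD[OF assms(4)]
  have t: "tbound (?X - ?Y) (trace_norm (?X - ?Y))"
    by (rule tbound_trace_norm[OF hermitian_density_diff[OF X(1) Y]])
  have H: "opbound H a" "dim_row H = N * k" "dim_col H = N * k"
    unfolding H_def using T by (auto intro: opbound_kron_one)
  have trR: "mtrace (?R * H) = mtrace (\<rho> * T)"
    unfolding H_def using T d by (simp add: kron_mult mtrace_kron)
  have trY: "mtrace (?Y * H) = mtrace (\<sigma> * T)"
    unfolding H_def using T d by (simp add: kron_mult mtrace_kron)
  have XH: "mtrace (?X * H) = mtrace (?R * (U\<dagger> * (H * U)))"
  proof -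
    have "mtrace (?X * H) = mtrace (U * (?R * (U\<dagger> * H)))" using dU d H by (simp add: mat_assoc)
    also have "\<dots> = mtrace ((?R * (U\<dagger> * H)) * U)" using dU d H by (intro mtrace_comm) auto
    finally show ?thesis using dU d H by (simp add: mat_assoc)
  qed
  have "U\<dagger> * (U * H - H * U) = H - U\<dagger> * (H * U)"
    using dU H by (simp add: mat_mult_diff unitary_cancel[OF assms(5)])
  then have "mtrace (?R * (U\<dagger> * (U * H - H * U))) = mtrace (?R * H) - mtrace (?X * H)"
    unfolding XH using dU d H by (simp add: mat_mult_diff mtrace_diff)
  moreover have "cmod (mtrace (?R * (U\<dagger> * (U * H - H * U)))) \<le> 1 * (1 * op_norm (U * H - H * U))"
    using dU d H densityD[OF R]
    by (intro tbound_scaled[OF tbound_density[OF R]] opbound_mult opbound_adj opbound_unitary[OF assms(5)] opbound_op_norm) auto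
  ultimately have 1: "cmod (mtrace (?R * H) - mtrace (?X * H)) \<le> op_norm (U * H - H * U)" by simp
  have "cmod (mtrace ((?X - ?Y) * H)) \<le> trace_norm (?X - ?Y) * a"
    using dU d H by (intro tbound_scaled[OF t H(1)]) auto
  moreover have "mtrace ((?X - ?Y) * H) = mtrace (?X * H) - mtrace (?Y * H)"
    using dU d H by (simp add: mat_diff_mult mtrace_diff)
  ultimately have 2: "cmod (mtrace (?X * H) - mtrace (?Y * H)) \<le> trace_norm (?X - ?Y) * a" by simp
  have "mtrace (\<rho> * T) - mtrace (\<sigma> * T) = (mtrace (?R * H) - mtrace (?X * H)) + (mtrace (?X * H) - mtrace (?Y * H))"
    unfolding trR trY by simp
  then show ?thesis using norm_triangle_mono[OF 1 2] by simp
qed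

lemma total_charge_kron_trivial:
  assumes "dim_row T = N" "dim_col T = N"
  shows "kron T (1\<^sub>m k) + kron (1\<^sub>m N) (0\<^sub>m k k) = kron T (1\<^sub>m k)"
  using assms by (intro eq_matI) (auto simp: kron_zero_right)

section \<open>From unitaries to asymptotic equivalence\<close>

lemma asymptotically_equivalent_if_unitaries:
  assumes charges: "\<forall>j<c. A j \<in> carrier_mat d d \<and> hermitian (A j)"
    and rho: "\<forall>i. density d (\<rho> i)" and sigma: "\<forall>i. density d (\<sigma> i)"
    and k: "\<forall>n. 0 < k n" "(\<lambda>n. log 2 (real (k n))) \<in> o(\<lambda>n. real n)"
    and om: "\<forall>n. density (k n) (\<omega> n) \<and> density (k n) (\<omega>' n)"
    and U: "\<forall>n. unitary (d ^ n * k n) (U n)"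
    and ac: "almost_commuting d c A k (\<lambda>n j. 0\<^sub>m (k n) (k n)) U"
    and lim: "(\<lambda>n. trace_norm (U n * kron (prod_state \<rho> n) (\<omega>' n) * mat_adjoint (U n)
                         - kron (prod_state \<sigma> n) (\<omega> n))) \<longlonglongrightarrow> 0"
  shows "asymptotically_equivalent d c A (prod_state \<rho>) (prod_state \<sigma>)"
proof -
  define e where "e n = trace_norm (U n * kron (prod_state \<rho> n) (\<omega>' n) * mat_adjoint (U n)
                         - kron (prod_state \<sigma> n) (\<omega> n))" for n
  have e: "e \<longlonglongrightarrow> 0" using lim unfolding e_def .
  have R: "density (d ^ n) (prod_state \<rho> n)" "density (d ^ n) (prod_state \<sigma> n)" for n
    using rho sigma by (auto intro: density_prod_state)
  have d: "0 < d" using rho density_dim_pos by blast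
  have lk: "(\<lambda>n. log 2 (real (k n)) / real n) \<longlonglongrightarrow> 0"
    by (rule smalloD_tendsto[OF k(2)])
  have "(\<lambda>n. \<bar>entropy (prod_state \<rho> n) - entropy (prod_state \<sigma> n)\<bar> / real n) \<longlonglongrightarrow> 0"
  proof (rule tendsto_sandwich[OF _ _ tendsto_const])
    \<comment> \<open>The total dimension has a logarithm of order \<open>n\<close>. After division
      by \<open>n\<close> the continuity bound is therefore \<open>e n\<close> times a convergent
      sequence, plus vanishing terms.\<close>
    let ?b = "\<lambda>n. (1 / real n + e n * (1 / real n)) + (e n * log 2 (real d) + e n * (log 2 (real (k n)) / real n)) + log 2 (real (k n)) / real n"
    have "?b \<longlonglongrightarrow> (0 + 0 * 0) + (0 * log 2 (real d) + 0 * 0) + 0"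
      by (intro tendsto_add tendsto_mult e lk lim_1_over_n tendsto_const)
    then show "?b \<longlonglongrightarrow> 0" by simp
    show "\<forall>\<^sub>F n in sequentially. 0 \<le> \<bar>entropy (prod_state \<rho> n) - entropy (prod_state \<sigma> n)\<bar> / real n" by simp
    show "\<forall>\<^sub>F n in sequentially. \<bar>entropy (prod_state \<rho> n) - entropy (prod_state \<sigma> n)\<bar> / real n \<le> ?b n"
      using eventually_gt_at_top[of 0]
    proof eventually_elim
      case (elim n)
      have "\<bar>entropy (prod_state \<rho> n) - entropy (prod_state \<sigma> n)\<bar>
        \<le> 1 + e n * log 2 (2 * real (d ^ n * k n)) + log 2 (real (k n))"
        unfolding e_def using R[of n] om U by (intro entropy_difference_bound) auto
      also have "log 2 (2 * real (d ^ n * k n)) = 1 + real n * log 2 (real d) + log 2 (real (k n))"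
        using d k(1) by (simp add: log_mult log_nat_power)
      finally have "\<bar>entropy (prod_state \<rho> n) - entropy (prod_state \<sigma> n)\<bar> / real n
        \<le> (1 + e n * (1 + real n * log 2 (real d) + log 2 (real (k n))) + log 2 (real (k n))) / real n"
        by (intro divide_right_mono) auto
      also have "\<dots> = ?b n" using elim by (simp add: field_simps)
      finally show ?case .
    qed
  qed
  moreover have "(\<lambda>n. cmod (mtrace (prod_state \<rho> n * total_charge d (A j) n) - mtrace (prod_state \<sigma> n * total_charge d (A j) n)) / real n) \<longlonglongrightarrow> 0"
    if j: "j < c" for j
  proof (rule tendsto_sandwich[OF _ _ tendsto_const])
    have A: "dim_row (A j) = d" "dim_col (A j) = d" "hermitian (A j)" using charges j by auto
    let ?H = "\<lambda>n. kron (total_charge d (A j) n) (1\<^sub>m (k n))"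
    let ?a = "op_norm (A j)"
    note T = total_charge_basic[OF A opbound_op_norm]
    have o: "(\<lambda>n. op_norm (U n * ?H n - ?H n * U n) / real n) \<longlonglongrightarrow> 0"
      using ac[unfolded almost_commuting_def, rule_format, OF j]
      unfolding Let_def total_charge_kron_trivial[OF T(1,2)] .
    let ?b = "\<lambda>n. op_norm (U n * ?H n - ?H n * U n) / real n + e n * ?a"
    have "?b \<longlonglongrightarrow> 0 + 0 * ?a" by (intro tendsto_add tendsto_mult e o tendsto_const)
    then show "?b \<longlonglongrightarrow> 0" by simp
    show "\<forall>\<^sub>F n in sequentially. 0 \<le> cmod (mtrace (prod_state \<rho> n * total_charge d (A j) n) - mtrace (prod_state \<sigma> n * total_charge d (A j) n)) / real n"
      by simp
    show "\<forall>\<^sub>F n in sequentially. cmod (mtrace (prod_state \<rho> n * total_charge d (A j) n) - mtrace (prod_state \<sigma> n * total_charge d (A j) n)) / real n \<le> ?b n"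
      using eventually_gt_at_top[of 0]
    proof eventually_elim
      case (elim n)
      have "cmod (mtrace (prod_state \<rho> n * total_charge d (A j) n) - mtrace (prod_state \<sigma> n * total_charge d (A j) n))
        \<le> op_norm (U n * ?H n - ?H n * U n) + e n * (real n * ?a)"
        unfolding e_def using om U by (intro charge_difference_bound[OF R] T) auto
      then have "cmod (mtrace (prod_state \<rho> n * total_charge d (A j) n) - mtrace (prod_state \<sigma> n * total_charge d (A j) n)) / real n
        \<le> (op_norm (U n * ?H n - ?H n * U n) + e n * (real n * ?a)) / real n"
        by (intro divide_right_mono) auto
      also have "\<dots> = ?b n" using elim by (simp add: field_simps)
      finally show ?case .
    qed
  qed
  ultimately show ?thesis unfolding asymptotically_equivalent_def by blast
qed

lemma sel_mat_isometry:
  assumes "inj_on s {..<D}" "s ` {..<D} \<subseteq> {..<N}"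
  shows "(sel_mat N D s)\<dagger> * sel_mat N D s = 1\<^sub>m D"
  using sel_mat_conj[OF assms, of "\<lambda>_. 1"] by (simp add: diag_of_one)

text \<open>Ties two descriptions of a spectral subspace: the isometry, used for compressing, and
  the projection with eigenvalues 0 and 1, used for the weight of a state in it.\<close>

lemma sel_mat_range:
  assumes "bij_betw s {..<D} {i. i < N \<and> Q i}"
  shows "sel_mat N D s * (sel_mat N D s)\<dagger> = diag_of N (\<lambda>i. if Q i then 1 else 0)"
proof (rule eq_matI)
  fix i k assume "i < dim_row (diag_of N (\<lambda>i. if Q i then 1 else 0))" "k < dim_col (diag_of N (\<lambda>i. if Q i then 1 else 0))"
  then have ik: "i < N" "k < N" by auto
  have "(sel_mat N D s * (sel_mat N D s)\<dagger>) $$ (i, k) = (\<Sum>j<D. sel_mat N D s $$ (i, j) * (sel_mat N D s)\<dagger> $$ (j, k))"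
    using ik by (subst index_mult) auto
  also have "\<dots> = (\<Sum>j<D. if i = s j \<and> k = s j then 1 else 0)"
    using ik by (intro sum.cong) (auto simp: sel_mat_def)
  also have "\<dots> = (if i = k \<and> Q i then 1 else 0)"
  proof (cases "i = k \<and> Q i")
    case True
    then obtain j where j: "j < D" "s j = i"
      using assms ik unfolding bij_betw_def by (metis (mono_tags, lifting) imageE lessThan_iff mem_Collect_eq)
    have "(i = s j' \<and> k = s j') \<longleftrightarrow> j' = j" if "j' < D" for j'
      using assms True j that unfolding bij_betw_def inj_on_def by auto
    then have "(\<Sum>j<D. if i = s j \<and> k = s j then 1 else 0) = (\<Sum>j'<D. if j' = j then 1 else (0::complex))"
      by (intro sum.cong) auto
    then show ?thesis using True j(1) by auto
  next
    case False
    have "\<not> (i = s j \<and> k = s j)" if "j < D" for j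
      using assms False that unfolding bij_betw_def by auto
    then have "(\<Sum>j<D. if i = s j \<and> k = s j then 1 else 0) = (\<Sum>j<D. (0::complex))"
      by (intro sum.cong) auto
    then show ?thesis using False by simp
  qed
  finally show "(sel_mat N D s * (sel_mat N D s)\<dagger>) $$ (i, k) = diag_of N (\<lambda>i. if Q i then 1 else 0) $$ (i, k)"
    using ik by simp
qed auto

section \<open>The approximate microcanonical subspace\<close>

text \<open>The sum is characterised by its traces against all operators, which determine it and
  avoid handling an iterated sum of matrices.\<close>

lemma exists_sum_of_squares:
  fixes X :: "nat \<Rightarrow> complex mat"
  assumes "\<And>j. j < c \<Longrightarrow> dim_row (X j) = N \<and> dim_col (X j) = N \<and> (X j)\<dagger> = X j"
  shows "\<exists>M. dim_row M = N \<and> dim_col M = N \<and> M\<dagger> = M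
    \<and> (\<forall>R. dim_row R = N \<longrightarrow> dim_col R = N \<longrightarrow> mtrace (R * M) = (\<Sum>j<c. mtrace (R * (X j * X j))))"
  using assms
proof (induction c)
  case 0
  have "mtrace (R * 0\<^sub>m N N) = 0" if "dim_row R = N" "dim_col R = N" for R
    using that by (simp add: mtrace_def)
  then show ?case by (intro exI[of _ "0\<^sub>m N N"]) auto
next
  case (Suc c)
  have "\<exists>M. dim_row M = N \<and> dim_col M = N \<and> M\<dagger> = M
    \<and> (\<forall>R. dim_row R = N \<longrightarrow> dim_col R = N \<longrightarrow> mtrace (R * M) = (\<Sum>j<c. mtrace (R * (X j * X j))))"
    by (rule Suc.IH) (simp add: Suc.prems)
  then obtain M where M: "dim_row M = N" "dim_col M = N" "M\<dagger> = M"
    "\<And>R. dim_row R = N \<Longrightarrow> dim_col R = N \<Longrightarrow> mtrace (R * M) = (\<Sum>j<c. mtrace (R * (X j * X j)))"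
    by blast
  have X: "dim_row (X c) = N" "dim_col (X c) = N" "(X c)\<dagger> = X c" using Suc.prems[of c] by auto
  show ?case
    using M X by (intro exI[of _ "M + X c * X c"]) (auto simp: adj_add adj_mult mat_mult_add mtrace_add)
qed

lemma mtrace_sandwich:
  assumes "dim_row X = N" "dim_col X = N" "X\<dagger> = X" "dim_row Z = N"
  shows "mtrace (Z * Z\<dagger> * (X * X)) = of_real ((fnorm (X * Z))\<^sup>2)"
proof -
  have "mtrace (Z * Z\<dagger> * (X * X)) = mtrace (Z * (Z\<dagger> * (X * X)))" using assms by (simp add: mat_assoc)
  also have "\<dots> = mtrace ((Z\<dagger> * (X * X)) * Z)" using assms by (intro mtrace_comm) auto
  also have "\<dots> = mtrace ((X * Z)\<dagger> * (X * Z))" using assms by (simp add: mat_assoc adj_mult)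
  finally show ?thesis by (simp add: mtrace_adj_mult_self)
qed

lemma approximate_microcanonical_subspace:
  fixes X :: "nat \<Rightarrow> complex mat"
  assumes X: "\<And>j. j < c \<Longrightarrow> dim_row (X j) = N \<and> dim_col (X j) = N \<and> (X j)\<dagger> = X j" and \<theta>: "0 < \<theta>"
  shows "\<exists>D F. dim_row F = N \<and> dim_col F = D \<and> F\<dagger> * F = 1\<^sub>m D
    \<and> (\<forall>j<c. opbound (X j * F) \<theta>)
    \<and> (\<forall>R. density N R \<longrightarrow> 1 - Re (mtrace (F\<dagger> * R * F)) \<le> Re (\<Sum>j<c. mtrace (R * (X j * X j))) / \<theta>\<^sup>2)"
proof -
  have "\<exists>M. dim_row M = N \<and> dim_col M = N \<and> M\<dagger> = M
    \<and> (\<forall>R. dim_row R = N \<longrightarrow> dim_col R = N \<longrightarrow> mtrace (R * M) = (\<Sum>j<c. mtrace (R * (X j * X j))))"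
    by (rule exists_sum_of_squares) (rule X)
  then obtain M where M: "dim_row M = N" "dim_col M = N" "M\<dagger> = M"
    and trM: "\<And>R. dim_row R = N \<Longrightarrow> dim_col R = N \<Longrightarrow> mtrace (R * M) = (\<Sum>j<c. mtrace (R * (X j * X j)))"
    by blast
  have "hermitian M" using M by (simp add: hermitian_iff)
  from spectral[OF this M(1)] obtain E \<mu> where E: "unitary N E" and ME: "M = E * diag_of N \<mu> * E\<dagger>" by blast
  note dE = unitaryD[OF E]
  have quad: "mtrace (Z\<dagger> * (M * Z)) = of_real (\<Sum>j<c. (fnorm (X j * Z))\<^sup>2)" if Z: "dim_row Z = N" for Z
  proof -
    have "mtrace (Z\<dagger> * (M * Z)) = mtrace ((Z\<dagger> * M) * Z)" using M Z by (simp add: mat_assoc)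
    also have "\<dots> = mtrace (Z * (Z\<dagger> * M))" using M Z by (intro mtrace_comm) auto
    also have "\<dots> = mtrace (Z * Z\<dagger> * M)" using M Z by (simp add: mat_assoc)
    also have "\<dots> = (\<Sum>j<c. mtrace (Z * Z\<dagger> * (X j * X j)))" using Z by (intro trM) auto
    also have "\<dots> = (\<Sum>j<c. of_real ((fnorm (X j * Z))\<^sup>2))"
      using X Z by (intro sum.cong refl mtrace_sandwich[of _ N]) auto
    finally show ?thesis by simp
  qed
  \<comment> \<open>Positivity of \<open>M\<close> is tested on its own eigenvectors:
    \<open>?Z\<close> is the \<open>i\<close>-th one, padded with zero columns to a square
    matrix.\<close>
  have \<mu>0: "0 \<le> \<mu> i" if "i < N" for i
  proof -
    let ?\<delta> = "\<lambda>k. if k = i then 1 else 0 :: real"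
    let ?Z = "E * diag_of N ?\<delta>"
    have "?Z\<dagger> * (M * ?Z) = diag_of N ?\<delta> * (diag_of N \<mu> * diag_of N ?\<delta>)"
      unfolding ME using dE by (simp add: adj_mult mat_assoc unitary_cancel[OF E])
    also have "\<dots> = diag_of N (\<lambda>k. if k = i then \<mu> i else 0)"
      unfolding diag_of_mult by (intro diag_of_cong) auto
    finally have "of_real (\<mu> i) = complex_of_real (\<Sum>j<c. (fnorm (X j * ?Z))\<^sup>2)"
      using quad[of ?Z] dE that by (simp add: mtrace_diag_of)
    then have "\<mu> i = (\<Sum>j<c. (fnorm (X j * ?Z))\<^sup>2)" by (simp only: of_real_eq_iff)
    then show ?thesis by (simp add: sum_nonneg)
  qed
  let ?Q = "\<lambda>i. \<mu> i \<le> \<theta>\<^sup>2"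
  define D where "D = card {i. i < N \<and> ?Q i}"
  obtain s where s: "bij_betw s {..<D} {i. i < N \<and> ?Q i}"
    using ex_bij_betw_nat_finite[of "{i. i < N \<and> ?Q i}"] unfolding D_def lessThan_atLeast0 by auto
  then have s': "inj_on s {..<D}" "s ` {..<D} \<subseteq> {..<N}" and s\<theta>: "\<And>i. i < D \<Longrightarrow> \<mu> (s i) \<le> \<theta>\<^sup>2"
    unfolding bij_betw_def by auto
  let ?P = "sel_mat N D s"
  define F where "F = E * ?P"
  have dF: "dim_row F = N" "dim_col F = D" using dE by (auto simp: F_def)
  have iso: "F\<dagger> * F = 1\<^sub>m D"
    unfolding F_def using dE sel_mat_isometry[OF s'] by (simp add: adj_mult mat_assoc unitary_cancel[OF E])
  have FMF: "F\<dagger> * (M * F) = diag_of D (\<lambda>i. \<mu> (s i))"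
    unfolding F_def ME sel_mat_conj[OF s', of \<mu>, symmetric] using dE
    by (simp add: adj_mult mat_assoc unitary_cancel[OF E])
  have "opbound (X j * F) \<theta>" if j: "j < c" for j
    unfolding opbound_def
  proof (intro conjI allI impI)
    show "0 \<le> \<theta>" using \<theta> by simp
    fix Y :: "complex mat" assume "dim_row Y = dim_col (X j * F)"
    then have Y: "dim_row Y = D" using dF by simp
    \<comment> \<open>One charge is dominated by the sum over all charges, which is the quadratic
      form of \<open>M\<close>; on the subspace this form is at most \<theta>^2.\<close>
    have "(fnorm (X j * (F * Y)))\<^sup>2 \<le> (\<Sum>j<c. (fnorm (X j * (F * Y)))\<^sup>2)"
      using j by (intro member_le_sum) auto
    also have "\<dots> = Re (mtrace ((F * Y)\<dagger> * (M * (F * Y))))"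
      using quad[of "F * Y"] dF by simp
    also have "(F * Y)\<dagger> * (M * (F * Y)) = Y\<dagger> * (F\<dagger> * (M * F) * Y)"
      using dF M Y by (simp add: adj_mult mat_assoc)
    also have "\<dots> = Y\<dagger> * (diag_of D (\<lambda>i. \<mu> (s i)) * Y)" unfolding FMF ..
    also have "mtrace \<dots> = (\<Sum>i<dim_col Y. of_real (\<Sum>k<D. \<mu> (s k) * (cmod (Y $$ (k, i)))\<^sup>2))"
      using Y by (simp only: mtrace_def index_mult_mat(2) dim_adj) (intro sum.cong refl quad_diag_of_diag, auto)
    also have "Re \<dots> = (\<Sum>i<dim_col Y. \<Sum>k<D. \<mu> (s k) * (cmod (Y $$ (k, i)))\<^sup>2)" by simp
    also have "\<dots> \<le> (\<Sum>i<dim_col Y. \<Sum>k<D. \<theta>\<^sup>2 * (cmod (Y $$ (k, i)))\<^sup>2)"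
      by (intro sum_mono mult_right_mono s\<theta>) auto
    also have "\<dots> = (\<theta> * fnorm Y)\<^sup>2"
      unfolding power_mult_distrib fnorm_sq Y sum_distrib_left by (rule sum.swap)
    finally have "fnorm (X j * (F * Y)) \<le> \<theta> * fnorm Y"
      by (rule power2_le_imp_le) (use \<theta> in auto)
    then show "fnorm (X j * F * Y) \<le> \<theta> * fnorm Y"
      using X[OF j] dF Y by (simp add: mat_assoc)
  qed
  moreover have "1 - Re (mtrace (F\<dagger> * R * F)) \<le> Re (\<Sum>j<c. mtrace (R * (X j * X j))) / \<theta>\<^sup>2" if R: "density N R" for R
  proof -
    note dR = densityD[OF R]
    obtain W x where W: "unitary N W" "R = W * diag_of N x * W\<dagger>" and x: "\<forall>i<N. 0 \<le> x i" "(\<Sum>i<N. x i) = 1"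
      using density_spectral[OF R] by blast
    \<comment> \<open>The spectral distribution of \<open>M\<close> in the state \<open>R\<close>:
      \<open>y i\<close> is the probability attached to \<open>\<mu> i\<close>.\<close>
    define y where "y i = (\<Sum>k<N. x k * (cmod ((W\<dagger> * E) $$ (k, i)))\<^sup>2)" for i
    have y: "(E\<dagger> * R * E) $$ (i, i) = of_real (y i)" if "i < N" for i
      unfolding W(2) y_def by (rule unitary_conj_index[OF E W(1) that])
    have y0: "0 \<le> y i" for i unfolding y_def using x by (intro sum_nonneg mult_nonneg_nonneg) auto
    have tr: "mtrace (R * (E * diag_of N f * E\<dagger>)) = of_real (\<Sum>i<N. f i * y i)" for f
      using mtrace_unitary_diag_mult[OF E dR(1,2)] by (simp add: y)
    have "E * diag_of N (\<lambda>_. 1) * E\<dagger> = 1\<^sub>m N" using dE by (simp add: diag_of_one)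
    then have sy: "(\<Sum>i<N. y i) = 1"
      using tr[of "\<lambda>_. 1"] dR by (metis (no_types, lifting) mat_one_mult(2) mult_1 of_real_eq_1_iff sum.cong)
    have "mtrace (F\<dagger> * R * F) = mtrace (F\<dagger> * (R * F))" using dF dR by (simp add: mat_assoc)
    also have "\<dots> = mtrace ((R * F) * F\<dagger>)" using dF dR by (intro mtrace_comm) auto
    also have "(R * F) * F\<dagger> = R * (E * (?P * ?P\<dagger>) * E\<dagger>)"
      unfolding F_def using dE dR by (simp add: mat_assoc adj_mult)
    also have "mtrace \<dots> = of_real (\<Sum>i<N. (if ?Q i then 1 else 0) * y i)"
      unfolding sel_mat_range[OF s] by (rule tr)
    finally have "1 - Re (mtrace (F\<dagger> * R * F)) = (\<Sum>i<N. y i - (if ?Q i then 1 else 0) * y i)"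
      using sy by (simp add: sum_subtractf)
    \<comment> \<open>Markov's inequality: the indicator of \<mu> > \<theta>^2 is at most \<mu> /
      \<theta>^2.\<close>
    also have "\<dots> \<le> (\<Sum>i<N. \<mu> i / \<theta>\<^sup>2 * y i)"
    proof (rule sum_mono)
      fix i assume "i \<in> {..<N}"
      then have i: "i < N" by simp
      show "y i - (if ?Q i then 1 else 0) * y i \<le> \<mu> i / \<theta>\<^sup>2 * y i"
      proof (cases "?Q i")
        case True
        then show ?thesis using \<mu>0[OF i] y0[of i] by simp
      next
        case False
        then have "1 \<le> \<mu> i / \<theta>\<^sup>2" using \<theta> by simp
        from mult_right_mono[OF this y0[of i]] show ?thesis using False by simp
      qed
    qed
    also have "\<dots> = (\<Sum>i<N. \<mu> i * y i) / \<theta>\<^sup>2" by (simp add: sum_divide_distrib)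
    also have "\<dots> = Re (mtrace (R * M)) / \<theta>\<^sup>2" unfolding ME tr by simp
    also have "\<dots> = Re (\<Sum>j<c. mtrace (R * (X j * X j))) / \<theta>\<^sup>2" using dR by (simp add: trM)
    finally show ?thesis .
  qed
  ultimately show ?thesis using dF iso by blast
qed

section \<open>Compressing a state to a subspace\<close>

text \<open>\<open>G\<close> is the square root of \<tau> up to a unitary factor, and
  \<open>Q\<close> projects onto the complement of the range of \<open>F\<close>. The trace lost by
  compression is that of Q \<tau>, which is a squared norm because Q is a projection.\<close>

lemma compression_defect:
  assumes V: "unitary N V" and r: "\<forall>i<N. 0 \<le> r i" and F: "dim_row F = N" "dim_col F = D" "F\<dagger> * F = 1\<^sub>m D"
  defines "G \<equiv> V * diag_of N (\<lambda>i. sqrt (r i))" and "Q \<equiv> 1\<^sub>m N - F * F\<dagger>" and "\<tau> \<equiv> V * diag_of N r * V\<dagger>"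
  shows "mtrace \<tau> - mtrace (F\<dagger> * \<tau> * F) = of_real ((fnorm (Q * G))\<^sup>2)" "\<tau> = G * G\<dagger>"
    "(fnorm G)\<^sup>2 = (\<Sum>i<N. r i)"
proof -
  note dV = unitaryD[OF V]
  have rr: "diag_of N r = diag_of N (\<lambda>i. sqrt (r i)) * diag_of N (\<lambda>i. sqrt (r i))"
    unfolding diag_of_mult using r by (intro diag_of_cong) simp
  show \<tau>G: "\<tau> = G * G\<dagger>"
    unfolding \<tau>_def G_def rr using dV by (simp add: mat_assoc adj_mult)
  have dG: "dim_row G = N" "dim_col G = N" using dV by (auto simp: G_def)
  have dQ: "dim_row Q = N" "dim_col Q = N" using F by (auto simp: Q_def)
  have Qa: "Q\<dagger> = Q" using F by (simp add: Q_def adj_diff adj_mult)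
  have FQ: "F\<dagger> * Q = 0\<^sub>m D N"
    unfolding Q_def using F isometry_cancel[OF F(3), of "F\<dagger>"] by (simp add: mat_mult_diff) (intro eq_matI, auto)
  have QQ: "Q * Q = Q"
  proof -
    have "Q * Q = Q - F * (F\<dagger> * Q)"
      using F dQ by (subst (1) Q_def) (simp add: mat_diff_mult mat_assoc)
    also have "\<dots> = Q" unfolding FQ using F dQ by (intro eq_matI) (auto simp: right_mult_zero_mat[of F N D])
    finally show ?thesis .
  qed
  have "complex_of_real ((fnorm (Q * G))\<^sup>2) = mtrace (G\<dagger> * (Q * Q * G))"
    unfolding mtrace_adj_mult_self[symmetric] using dQ dG Qa by (simp add: adj_mult mat_assoc)
  also have "\<dots> = mtrace ((Q * G) * G\<dagger>)" unfolding QQ using dQ dG by (intro mtrace_comm) auto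
  also have "(Q * G) * G\<dagger> = \<tau> - F * (F\<dagger> * \<tau>)"
    unfolding \<tau>G Q_def using dG F by (simp add: mat_assoc mat_diff_mult)
  also have "mtrace \<dots> = mtrace \<tau> - mtrace (F * (F\<dagger> * \<tau>))" using dG F by (intro mtrace_diff) (auto simp: \<tau>G)
  also have "mtrace (F * (F\<dagger> * \<tau>)) = mtrace (F\<dagger> * \<tau> * F)" using dG F by (intro mtrace_comm) (auto simp: \<tau>G)
  finally show "mtrace \<tau> - mtrace (F\<dagger> * \<tau> * F) = of_real ((fnorm (Q * G))\<^sup>2)" ..
  have "complex_of_real ((fnorm G)\<^sup>2) = mtrace (G * G\<dagger>)"
    unfolding mtrace_adj_mult_self[symmetric] using dG by (intro mtrace_comm) auto
  also have "\<dots> = of_real (\<Sum>i<N. r i)" unfolding \<tau>G[symmetric] \<tau>_def by (rule mtrace_unitary_diag[OF V])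
  finally show "(fnorm G)\<^sup>2 = (\<Sum>i<N. r i)" by (simp only: of_real_eq_iff)
qed

text \<open>The gentle measurement lemma. With P + Q = 1 and \<tau> = G G\<dagger> the difference is
  Q G G\<dagger> + P G (Q G)\<dagger>. Each term has a factor Q G, whose norm is the square root of
  the lost trace, and a factor of norm at most one; Cauchy-Schwarz for both gives the 2.\<close>

lemma gentle_compression:
  assumes V: "unitary N V" and r: "\<forall>i<N. 0 \<le> r i" "(\<Sum>i<N. r i) \<le> 1"
    and F: "dim_row F = N" "dim_col F = D" "F\<dagger> * F = 1\<^sub>m D"
  defines "\<tau> \<equiv> V * diag_of N r * V\<dagger>"
  shows "tbound (\<tau> - F * (F\<dagger> * \<tau> * F) * F\<dagger>) (2 * sqrt (Re (mtrace \<tau>) - Re (mtrace (F\<dagger> * \<tau> * F))))"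
proof -
  define G where "G = V * diag_of N (\<lambda>i. sqrt (r i))"
  define Q where "Q = 1\<^sub>m N - F * F\<dagger>"
  define P where "P = F * F\<dagger>"
  note cd = compression_defect[OF V r(1) F, folded G_def Q_def \<tau>_def]
  note dV = unitaryD[OF V]
  have dG: "dim_row G = N" "dim_col G = N" using dV by (auto simp: G_def)
  have dQ: "dim_row Q = N" "dim_col Q = N" "Q\<dagger> = Q" "dim_row P = N" "dim_col P = N"
    using F by (auto simp: Q_def P_def adj_diff adj_mult)
  have P: "opbound P (1 * 1)" unfolding P_def
    using F opbound_isometry[OF F(3,2)] by (intro opbound_mult opbound_adj) auto
  have sq: "sqrt (Re (mtrace \<tau>) - Re (mtrace (F\<dagger> * \<tau> * F))) = fnorm (Q * G)"
    using arg_cong[OF cd(1), of Re] by (simp del: of_real_power)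
  have "(fnorm G)\<^sup>2 \<le> 1\<^sup>2" using cd(3) r(2) by simp
  then have G1: "fnorm G \<le> 1" by (rule power2_le_imp_le) simp
  have split: "\<tau> - F * (F\<dagger> * \<tau> * F) * F\<dagger> = (Q * G) * G\<dagger> + (P * G) * (Q * G)\<dagger>"
  proof -
    have "F * (F\<dagger> * \<tau> * F) * F\<dagger> = (P * G) * (G\<dagger> * P)"
      unfolding cd(2) P_def using dG F by (simp add: mat_assoc)
    moreover have "(Q * G) * G\<dagger> = \<tau> - (P * G) * G\<dagger>"
      unfolding cd(2) Q_def P_def[symmetric] using dG dQ by (simp add: mat_diff_mult mat_assoc)
    moreover have "(P * G) * (Q * G)\<dagger> = (P * G) * G\<dagger> - (P * G) * (G\<dagger> * P)"
      using dG dQ unfolding adj_mult[of Q G, unfolded dQ(2) dG(1), OF refl] dQ(3)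
      unfolding Q_def P_def[symmetric] by (simp add: mat_mult_diff mat_assoc)
    ultimately show ?thesis using dG dQ by (simp only:) (intro eq_matI, auto simp: cd(2) simp del: index_mult_mat(1))
  qed
  show ?thesis
    unfolding tbound_def sq
  proof (intro allI impI)
    fix B :: "complex mat"
    assume "dim_row B = dim_col (\<tau> - F * (F\<dagger> * \<tau> * F) * F\<dagger>)" "dim_col B = dim_row (\<tau> - F * (F\<dagger> * \<tau> * F) * F\<dagger>)" and B: "opbound B 1"
    then have dB: "dim_row B = N" "dim_col B = N" using F by auto
    have B': "fnorm (Z\<dagger> * B) \<le> fnorm Z" if "dim_row Z = N" for Z
    proof -
      have "fnorm (Z\<dagger> * B) = fnorm ((B\<dagger> * Z)\<dagger>)" using that dB by (simp add: adj_mult)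
      also have "\<dots> \<le> 1 * fnorm Z" unfolding fnorm_adj using that dB by (intro opboundD[OF opbound_adj[OF B]]) auto
      finally show ?thesis by simp
    qed
    have "mtrace ((Q * G * G\<dagger> + P * G * (Q * G)\<dagger>) * B) = mtrace ((Q * G) * (G\<dagger> * B)) + mtrace ((P * G) * ((Q * G)\<dagger> * B))"
      using dG dQ dB by (simp add: mat_add_mult mtrace_add mat_assoc)
    moreover have "cmod (mtrace ((Q * G) * (G\<dagger> * B))) \<le> fnorm (Q * G) * 1"
    proof (rule order_trans[OF mtrace_CS])
      show "fnorm (Q * G) * fnorm (G\<dagger> * B) \<le> fnorm (Q * G) * 1"
        using B'[of G] G1 dG by (intro mult_left_mono) auto
    qed (use dG dQ dB in auto)
    moreover have "cmod (mtrace ((P * G) * ((Q * G)\<dagger> * B))) \<le> 1 * fnorm (Q * G)"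
    proof (rule order_trans[OF mtrace_CS])
      have "fnorm (P * G) \<le> 1 * fnorm G" using opboundD[OF P, of G] dG dQ by simp
      then show "fnorm (P * G) * fnorm ((Q * G)\<dagger> * B) \<le> 1 * fnorm (Q * G)"
        using B'[of "Q * G"] G1 dQ by (intro mult_mono) auto
    qed (use dG dQ dB in auto)
    ultimately show "cmod (mtrace ((\<tau> - F * (F\<dagger> * \<tau> * F) * F\<dagger>) * B)) \<le> 2 * fnorm (Q * G)"
      unfolding split by (smt (verit) norm_triangle_ineq)
  qed
qed

text \<open>Compression cannot raise the rank. If \<open>q 0\<close> up to \<open>q i\<close> were
  positive, the columns of \<open>Y\<close> would be \<open>i + 1\<close> orthonormal vectors
  supported on the rows with \<open>r x \<noteq> 0\<close>. The diagonal entries of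
  \<open>Y * Y\<dagger>\<close> are at most one and vanish off this support, yet they would sum to
  \<open>i + 1\<close>.\<close>

lemma rank_bound:
  assumes Z: "dim_row Z = N" "dim_col Z = D" and eq: "Z\<dagger> * (diag_of N r * Z) = diag_of D q"
    and r: "\<forall>x<N. 0 \<le> r x" and anti: "\<forall>i j. i \<le> j \<longrightarrow> j < D \<longrightarrow> q j \<le> q i"
    and card: "card {x. x < N \<and> r x \<noteq> 0} \<le> i" and i: "i < D"
  shows "q i \<le> 0"
proof (rule ccontr)
  assume "\<not> q i \<le> 0"
  then have qpos: "0 < q j" if "j < Suc i" for j
    using anti that i by (meson less_Suc_eq_le less_le_trans not_le)
  define Y where "Y = mat N (Suc i) (\<lambda>(x, j). of_real (sqrt (r x) / sqrt (q j)) * Z $$ (x, j))"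
  have dY: "dim_row Y = N" "dim_col Y = Suc i" by (auto simp: Y_def)
  have iso: "Y\<dagger> * Y = 1\<^sub>m (Suc i)"
  proof (rule eq_matI)
    fix j k assume "j < dim_row (1\<^sub>m (Suc i) :: complex mat)" "k < dim_col (1\<^sub>m (Suc i) :: complex mat)"
    then have jk: "j < Suc i" "k < Suc i" by auto
    have jkD: "j < D" "k < D" using jk i by auto
    have "(Y\<dagger> * Y) $$ (j, k) = (\<Sum>x<N. Y\<dagger> $$ (j, x) * Y $$ (x, k))"
      using dY jk by (subst index_mult) auto
    also have "\<dots> = (\<Sum>x<N. of_real (r x) * (cnj (Z $$ (x, j)) * Z $$ (x, k)) / of_real (sqrt (q j) * sqrt (q k)))"
    proof (rule sum.cong[OF refl])
      fix x assume "x \<in> {..<N}"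
      then have x: "x < N" by simp
      have "complex_of_real (r x) = of_real (sqrt (r x)) * of_real (sqrt (r x))"
        using r x by (simp flip: of_real_mult)
      then show "Y\<dagger> $$ (j, x) * Y $$ (x, k) = of_real (r x) * (cnj (Z $$ (x, j)) * Z $$ (x, k)) / of_real (sqrt (q j) * sqrt (q k))"
        using x jk dY by (simp add: Y_def)
    qed
    also have "\<dots> = (Z\<dagger> * (diag_of N r * Z)) $$ (j, k) / of_real (sqrt (q j) * sqrt (q k))"
      using Z jkD by (subst quad_diag_of[of _ N]) (auto simp: sum_divide_distrib)
    also have "\<dots> = 1\<^sub>m (Suc i) $$ (j, k)"
      unfolding eq using jk jkD qpos[of j] by (auto simp flip: of_real_mult)
    finally show "(Y\<dagger> * Y) $$ (j, k) = 1\<^sub>m (Suc i) $$ (j, k)" .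
  qed (use dY in auto)
  note Y1 = opbound_isometry[OF iso dY(2)]
  have "opbound (Y * Y\<dagger>) (1 * 1)" using Y1 by (intro opbound_mult opbound_adj) auto
  then have YY1: "cmod ((Y * Y\<dagger>) $$ (x, x)) \<le> 1" if "x < N" for x
    using opbound_entry[of "Y * Y\<dagger>" 1 x x] dY that by simp
  have YY0: "(Y * Y\<dagger>) $$ (x, x) = 0" if "x < N" "r x = 0" for x
    using that dY by (subst index_mult) (auto simp: Y_def)
  have "real (Suc i) = cmod (mtrace (Y\<dagger> * Y))"
    unfolding iso by (simp add: mtrace_def del: of_nat_Suc)
  also have "mtrace (Y\<dagger> * Y) = mtrace (Y * Y\<dagger>)" by (intro mtrace_comm) auto
  also have "cmod \<dots> \<le> (\<Sum>x<N. cmod ((Y * Y\<dagger>) $$ (x, x)))"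
    unfolding mtrace_def using dY by (simp add: norm_sum del: index_mult_mat(1))
  also have "\<dots> \<le> (\<Sum>x<N. if r x \<noteq> 0 then 1 else 0)"
    using YY1 YY0 by (intro sum_mono) (auto simp del: index_mult_mat(1))
  also have "\<dots> = real (card {x. x < N \<and> r x \<noteq> 0})"
    by (simp add: sum.If_cases Int_def)
  also have "\<dots> \<le> real i" using card by simp
  finally show False by simp
qed

text \<open>Two truncations: from \<open>p\<close> to its typical part \<open>r\<close>, at cost
  \<eta>, and then to the subspace by gentle compression. Each \<open>q i\<close> is an average of
  the \<open>r x\<close>, hence still at most \<open>b\<close>, and \<open>rank_bound\<close> makes
  all but the first \<open>K\<close> vanish.\<close>

lemma compressed_state:
  assumes V: "unitary N V" and r: "\<forall>x<N. 0 \<le> r x \<and> r x \<le> p x \<and> r x \<le> b" and p: "(\<Sum>x<N. p x) = 1"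
    and card: "card {x. x < N \<and> r x \<noteq> 0} \<le> K" and \<eta>: "(\<Sum>x<N. p x - r x) \<le> \<eta>"
    and F: "dim_row F = N" "dim_col F = D" "F\<dagger> * F = 1\<^sub>m D"
    and \<kappa>: "1 - Re (mtrace (F\<dagger> * (V * diag_of N p * V\<dagger>) * F)) \<le> \<kappa>"
  shows "\<exists>W q. unitary D W \<and> (\<forall>i j. i \<le> j \<longrightarrow> j < D \<longrightarrow> q j \<le> q i) \<and> (\<forall>i<D. 0 \<le> q i \<and> q i \<le> b)
    \<and> (\<forall>i<D. K \<le> i \<longrightarrow> q i = 0) \<and> (\<Sum>i<D. q i) \<le> 1 \<and> 1 - (\<Sum>i<D. q i) \<le> \<eta> + \<kappa>
    \<and> tbound (V * diag_of N p * V\<dagger> - F * (W * diag_of D q * W\<dagger>) * F\<dagger>) (\<eta> + 2 * sqrt \<kappa>)"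
proof -
  note dV = unitaryD[OF V]
  let ?\<rho> = "V * diag_of N p * V\<dagger>" and ?\<tau> = "V * diag_of N r * V\<dagger>"
  let ?\<tau>' = "V * diag_of N (\<lambda>x. p x - r x) * V\<dagger>"
  define \<sigma> where "\<sigma> = F\<dagger> * ?\<tau> * F"
  have d\<sigma>: "dim_row \<sigma> = D" "dim_col \<sigma> = D" using F by (auto simp: \<sigma>_def)
  have "hermitian \<sigma>" using d\<sigma> F dV by (simp add: hermitian_iff \<sigma>_def adj_mult mat_assoc)
  from spectral[OF this d\<sigma>(1)] obtain W q where W: "unitary D W" and \<sigma>W: "\<sigma> = W * diag_of D q * W\<dagger>"
    and anti: "\<forall>i j. i \<le> j \<longrightarrow> j < D \<longrightarrow> q j \<le> q i" by blast
  note dW = unitaryD[OF W]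
  define Z where "Z = V\<dagger> * (F * W)"
  have dZ: "dim_row Z = N" "dim_col Z = D" using dV dW F by (auto simp: Z_def)
  have Ziso: "Z\<dagger> * Z = 1\<^sub>m D"
    unfolding Z_def using dV dW F by (simp add: adj_mult mat_assoc unitary_cancel[OF V] isometry_cancel[OF F(3)])
  have "Z\<dagger> * (diag_of N r * Z) = W\<dagger> * (\<sigma> * W)"
    unfolding Z_def \<sigma>_def using dV dW F by (simp add: adj_mult mat_assoc)
  then have ZrZ: "Z\<dagger> * (diag_of N r * Z) = diag_of D q"
    unfolding \<sigma>W using dW by (simp add: mat_assoc unitary_cancel[OF W])
  have q: "q i = (\<Sum>x<N. r x * (cmod (Z $$ (x, i)))\<^sup>2)" if "i < D" for i
  proof -
    have "complex_of_real (q i) = of_real (\<Sum>x<N. r x * (cmod (Z $$ (x, i)))\<^sup>2)"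
      using quad_diag_of_diag[of Z N i r] dZ that unfolding ZrZ by simp
    then show ?thesis by (simp only: of_real_eq_iff)
  qed
  have Z1: "(\<Sum>x<N. (cmod (Z $$ (x, i)))\<^sup>2) = 1" if "i < D" for i
  proof -
    have "complex_of_real (\<Sum>x<N. (cmod (Z $$ (x, i)))\<^sup>2) = 1"
      using gram_index[of i Z] dZ that unfolding Ziso by simp
    then show ?thesis by (simp only: of_real_eq_1_iff)
  qed
  have q0: "0 \<le> q i \<and> q i \<le> b" if "i < D" for i
  proof
    show "0 \<le> q i" unfolding q[OF that] using r by (intro sum_nonneg mult_nonneg_nonneg) auto
    have "q i \<le> (\<Sum>x<N. b * (cmod (Z $$ (x, i)))\<^sup>2)"
      unfolding q[OF that] using r by (intro sum_mono mult_right_mono) auto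
    also have "\<dots> = b" using Z1[OF that] by (simp flip: sum_distrib_left)
    finally show "q i \<le> b" .
  qed
  have qK: "q i = 0" if "i < D" "K \<le> i" for i
    using rank_bound[OF dZ ZrZ _ anti _ that(1)] r card that(2) q0[OF that(1)] by fastforce
  have tr\<sigma>: "mtrace \<sigma> = of_real (\<Sum>i<D. q i)" unfolding \<sigma>W by (rule mtrace_unitary_diag[OF W])
  have tr\<tau>: "mtrace ?\<tau> = of_real (\<Sum>x<N. r x)" by (rule mtrace_unitary_diag[OF V])
  have "mtrace ?\<tau> - mtrace (F\<dagger> * ?\<tau> * F) = of_real ((fnorm ((1\<^sub>m N - F * F\<dagger>) * (V * diag_of N (\<lambda>i. sqrt (r i)))))\<^sup>2)"
    using r by (intro compression_defect[OF V _ F]) auto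
  then have def1: "0 \<le> Re (mtrace ?\<tau>) - Re (mtrace (F\<dagger> * ?\<tau> * F))"
    by (metis Re_complex_of_real minus_complex.sel(1) zero_le_power2)
  \<comment> \<open>The removed part loses a nonnegative trace too, so the typical part loses no
    more than the full state, that is at most \<kappa>.\<close>
  have "mtrace ?\<tau>' - mtrace (F\<dagger> * ?\<tau>' * F) = of_real ((fnorm ((1\<^sub>m N - F * F\<dagger>) * (V * diag_of N (\<lambda>i. sqrt (p i - r i)))))\<^sup>2)"
    using r by (intro compression_defect[OF V _ F]) auto
  then have def2: "0 \<le> Re (mtrace ?\<tau>') - Re (mtrace (F\<dagger> * ?\<tau>' * F))"
    by (metis Re_complex_of_real minus_complex.sel(1) zero_le_power2)
  have \<rho>\<tau>: "?\<rho> - ?\<tau> = ?\<tau>'"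
    unfolding diag_of_diff[symmetric] using dV by (simp add: mat_mult_diff mat_diff_mult)
  have tr': "mtrace ?\<tau>' = mtrace ?\<rho> - mtrace ?\<tau>" unfolding \<rho>\<tau>[symmetric] using dV by (intro mtrace_diff) auto
  have tr\<rho>: "mtrace ?\<rho> = 1" unfolding mtrace_unitary_diag[OF V] p by simp
  have "mtrace (F\<dagger> * ?\<tau>' * F) = mtrace (F\<dagger> * ?\<rho> * F) - mtrace (F\<dagger> * ?\<tau> * F)"
    unfolding \<rho>\<tau>[symmetric] using dV F by (simp add: mat_mult_diff mat_diff_mult mtrace_diff)
  then have \<kappa>\<tau>: "Re (mtrace ?\<tau>) - Re (mtrace (F\<dagger> * ?\<tau> * F)) \<le> \<kappa>"
    using def2 \<kappa> tr' tr\<rho> by simp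
  have sr: "(\<Sum>x<N. r x) \<le> 1" using r p sum_mono[of "{..<N}" r p] by simp
  have sq1: "(\<Sum>i<D. q i) \<le> 1"
    using def1 sr unfolding \<sigma>_def[symmetric] tr\<sigma> tr\<tau> by simp
  have sq2: "1 - (\<Sum>i<D. q i) \<le> \<eta> + \<kappa>"
    using \<kappa>\<tau> \<eta> p unfolding \<sigma>_def[symmetric] tr\<sigma> tr\<tau> by (simp add: sum_subtractf)
  have "tbound (?\<tau> - F * \<sigma> * F\<dagger>) (2 * sqrt (Re (mtrace ?\<tau>) - Re (mtrace \<sigma>)))"
    unfolding \<sigma>_def using r sr by (intro gentle_compression[OF V _ _ F]) auto
  then have t1: "tbound (?\<tau> - F * \<sigma> * F\<dagger>) (2 * sqrt \<kappa>)"
    by (rule tbound_mono) (use \<kappa>\<tau> in \<open>simp add: \<sigma>_def\<close>)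
  have "(\<Sum>x<N. \<bar>p x - r x\<bar>) \<le> \<eta>" using \<eta> r by simp
  then have t2: "tbound ?\<tau>' \<eta>" using tbound_mono tbound_unitary_diag[OF V] by blast
  have "tbound (?\<tau>' + (?\<tau> - F * \<sigma> * F\<dagger>)) (\<eta> + 2 * sqrt \<kappa>)"
    using dV F by (intro tbound_add t1 t2) auto
  also have "?\<tau>' + (?\<tau> - F * \<sigma> * F\<dagger>) = ?\<rho> - F * \<sigma> * F\<dagger>"
    unfolding \<rho>\<tau>[symmetric] using dV F by (intro eq_matI) (auto simp del: index_mult_mat(1))
  finally show ?thesis
    using W anti q0 qK sq1 sq2 unfolding \<sigma>W by blast
qed

section \<open>Flattening a nearly uniform spectrum\<close>

text \<open>The drops inside consecutive blocks of a decreasing sequence are part of its total drop;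
  the drops between blocks are discarded.\<close>

lemma block_spread:
  fixes q :: "nat \<Rightarrow> real"
  assumes anti: "\<And>i j. i \<le> j \<Longrightarrow> j < D \<Longrightarrow> q j \<le> q i" and L: "0 < L"
  shows "m * L \<le> D \<Longrightarrow> 0 < m \<Longrightarrow> (\<Sum>t<m. q (t * L) - q (t * L + (L - 1))) \<le> q 0 - q (m * L - 1)"
proof (induction m)
  case (Suc m)
  show ?case
  proof (cases "m = 0")
    case False
    have "(\<Sum>t<m. q (t * L) - q (t * L + (L - 1))) \<le> q 0 - q (m * L - 1)"
      using Suc False by simp
    moreover have "q (m * L) \<le> q (m * L - 1)"
      using Suc.prems L by (intro anti) auto
    moreover have "Suc m * L - 1 = m * L + (L - 1)" using L by simp
    ultimately show ?thesis by simp
  qed simp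
qed simp

text \<open>Inside a block \<open>q\<close> differs from its mean by at most the spread, and the
  spreads sum to at most \<open>b\<close>. The factor is \<open>real L - 1\<close> because blocks of
  length one are exact, so rounding \<open>L\<close> up is harmless even if its intended value is
  below one. The 4 is a 2 from L \<le> 2 (L - 1) and another 2 for the tail weight, which is removed
  and then added back.\<close>

lemma block_approximation:
  fixes q :: "nat \<Rightarrow> real"
  assumes anti: "\<And>i j. i \<le> j \<Longrightarrow> j < D \<Longrightarrow> q j \<le> q i" and q: "\<And>i. i < D \<Longrightarrow> 0 \<le> q i \<and> q i \<le> b"
    and sum: "(\<Sum>i<D. q i) \<le> 1" and L: "0 < L" and m: "0 < m" and mL: "m * L \<le> D"
    and tail: "(\<forall>i<D. m * L \<le> i \<longrightarrow> q i = 0) \<or> D < m * L + L"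
  shows "\<exists>f. (\<forall>t<m. 0 \<le> f t) \<and> (\<Sum>t<m. f t) = 1
    \<and> (\<Sum>i<D. \<bar>q i - (if i < m * L then f (i div L) / real L else 0)\<bar>) \<le> 4 * ((real L - 1) * b) + (1 - (\<Sum>i<D. q i))"
proof -
  have D: "0 < D" using L m mL by (metis gr0I mult_is_0 neq0_conv leD)
  then have b: "0 \<le> b" using q[of 0] by linarith
  define B where "B t = (\<Sum>l<L. q (t * L + l))" for t
  define w where "w = (\<Sum>i=m * L..<D. q i)"
  \<comment> \<open>The weight missing from the blocks: the defect from one plus the tail. Putting
    it into block 0 turns \<open>f\<close> into a probability vector.\<close>
  define \<eta> where "\<eta> = 1 - (\<Sum>i<D. q i) + w"
  define f where "f t = B t + (if t = 0 then \<eta> else 0)" for t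
  have idx: "t * L + l < m * L" if "t < m" "l < L" for t l
  proof -
    have "t * L + l < Suc t * L" using that by simp
    also have "\<dots> \<le> m * L" using that by (intro mult_le_mono1) simp
    finally show ?thesis .
  qed
  have sumB: "(\<Sum>t<m. B t) = (\<Sum>i<m * L. q i)"
    unfolding B_def using sum_div_mod[where f = "\<lambda>t l. q (t * L + l)" and a = m and b = L] by simp
  have split: "(\<Sum>i<D. h i) = (\<Sum>i<m * L. h i) + (\<Sum>i=m * L..<D. h i)" for h :: "nat \<Rightarrow> real"
    using sum.atLeastLessThan_concat[of 0 "m * L" D h] mL by (simp add: lessThan_atLeast0)
  have w0: "0 \<le> w" unfolding w_def using q by (intro sum_nonneg) auto
  \<comment> \<open>Either the tail vanishes, or fewer than \<open>L\<close> indices remain, each of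
    weight at most \<open>b\<close>.\<close>
  have w: "w \<le> (real L - 1) * b"
    using tail
  proof
    assume "\<forall>i<D. m * L \<le> i \<longrightarrow> q i = 0"
    then have "w = 0" unfolding w_def by (intro sum.neutral) auto
    then show ?thesis using L b by simp
  next
    assume "D < m * L + L"
    then have "Suc (D - m * L) \<le> L" using mL by linarith
    then have "real (Suc (D - m * L)) \<le> real L" by (simp only: of_nat_le_iff)
    then have "real (D - m * L) \<le> real L - 1" by simp
    moreover have "w \<le> (\<Sum>i=m * L..<D. b)" unfolding w_def using q by (intro sum_mono) auto
    ultimately show ?thesis using mult_right_mono[of "real (D - m * L)" "real L - 1" b] b by simp
  qed
  have \<eta>0: "0 \<le> \<eta>" using sum w0 by (simp add: \<eta>_def)
  have f0: "0 \<le> f t" if "t < m" for t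
  proof -
    have "0 \<le> B t" unfolding B_def using q idx[OF that] mL by (intro sum_nonneg) (meson lessThan_iff less_le_trans)
    then show ?thesis using \<eta>0 by (simp add: f_def)
  qed
  have sumf: "(\<Sum>t<m. f t) = 1"
    using split[of q] m by (simp add: f_def sum.distrib sumB \<eta>_def w_def)
  have block: "(\<Sum>l<L. \<bar>q (t * L + l) - f t / real L\<bar>) \<le> 2 * (real L - 1) * (q (t * L) - q (t * L + (L - 1))) + (if t = 0 then \<eta> else 0)"
    if t: "t < m" for t
  proof -
    let ?s = "q (t * L) - q (t * L + (L - 1))"
    have bd: "q (t * L + (L - 1)) \<le> q (t * L + l)" "q (t * L + l) \<le> q (t * L)" if "l < L" for l
      using that idx[OF t, of l] idx[OF t, of "L - 1"] mL L by (auto intro!: anti)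
    have s0: "0 \<le> ?s" using bd(1)[of 0] L by simp
    have B1: "B t / real L \<le> q (t * L)" "q (t * L + (L - 1)) \<le> B t / real L"
    proof -
      have "B t \<le> (\<Sum>l<L. q (t * L))" unfolding B_def using bd by (intro sum_mono) auto
      then show "B t / real L \<le> q (t * L)" using L by (simp add: field_simps)
      have "(\<Sum>l<L. q (t * L + (L - 1))) \<le> B t" unfolding B_def using bd by (intro sum_mono) auto
      then show "q (t * L + (L - 1)) \<le> B t / real L" using L by (simp add: field_simps)
    qed
    have "(\<Sum>l<L. \<bar>q (t * L + l) - f t / real L\<bar>) \<le> (\<Sum>l<L. ?s + (if t = 0 then \<eta> else 0) / real L)"
    proof (rule sum_mono)
      fix l assume "l \<in> {..<L}"
      then have l: "l < L" by simp
      have "f t / real L = B t / real L + (if t = 0 then \<eta> else 0) / real L" by (simp add: f_def add_divide_distrib)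
      moreover have "0 \<le> (if t = 0 then \<eta> else 0) / real L" using \<eta>0 by simp
      ultimately show "\<bar>q (t * L + l) - f t / real L\<bar> \<le> ?s + (if t = 0 then \<eta> else 0) / real L"
        using bd[OF l] B1 by linarith
    qed
    also have "\<dots> = real L * ?s + (if t = 0 then \<eta> else 0)" using L by (simp add: distrib_left)
    \<comment> \<open>A block of length one has spread zero; otherwise \<open>L\<close> is at least
      2.\<close>
    also have "real L * ?s \<le> 2 * (real L - 1) * ?s"
    proof (cases "L = 1")
      case False
      then have "2 \<le> L" using L by linarith
      then have "2 \<le> real L" by simp
      then have "real L \<le> 2 * (real L - 1)" by simp
      then show ?thesis using s0 by (intro mult_right_mono)
    qed simp
    finally show ?thesis by simp
  qed
  have "(\<Sum>i<D. \<bar>q i - (if i < m * L then f (i div L) / real L else 0)\<bar>)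
    = (\<Sum>i<m * L. \<bar>q i - f (i div L) / real L\<bar>) + (\<Sum>i=m * L..<D. \<bar>q i\<bar>)"
    unfolding split by (intro arg_cong2[where f = "(+)"] sum.cong) auto
  also have "(\<Sum>i=m * L..<D. \<bar>q i\<bar>) = w" unfolding w_def using q by (intro sum.cong) auto
  also have "(\<Sum>i<m * L. \<bar>q i - f (i div L) / real L\<bar>) = (\<Sum>t<m. \<Sum>l<L. \<bar>q (t * L + l) - f t / real L\<bar>)"
    using sum_div_mod[where f = "\<lambda>t l. \<bar>q (t * L + l) - f t / real L\<bar>" and a = m and b = L] by simp
  also have "\<dots> \<le> (\<Sum>t<m. 2 * (real L - 1) * (q (t * L) - q (t * L + (L - 1))) + (if t = 0 then \<eta> else 0))"
    using block by (intro sum_mono) auto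
  also have "\<dots> = 2 * (real L - 1) * (\<Sum>t<m. q (t * L) - q (t * L + (L - 1))) + \<eta>"
    using m by (simp add: sum.distrib sum_distrib_left)
  also have "\<dots> \<le> 2 * (real L - 1) * b + \<eta>"
  proof -
    have "(\<Sum>t<m. q (t * L) - q (t * L + (L - 1))) \<le> q 0 - q (m * L - 1)"
      by (rule block_spread[OF anti L mL m])
    also have "\<dots> \<le> b" using q[of 0] q[of "m * L - 1"] D mL m L by force
    finally show ?thesis using L by (intro add_right_mono mult_left_mono) auto
  qed
  finally have "(\<Sum>i<D. \<bar>q i - (if i < m * L then f (i div L) / real L else 0)\<bar>) \<le> 2 * (real L - 1) * b + \<eta> + w" by simp
  also have "\<dots> \<le> 4 * ((real L - 1) * b) + (1 - (\<Sum>i<D. q i))"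
  proof -
    have "2 * (real L - 1) * b = 2 * ((real L - 1) * b)" by simp
    then show ?thesis using w unfolding \<eta>_def by linarith
  qed
  finally show ?thesis using f0 sumf by blast
qed

text \<open>With \<open>i = t L + l\<close>, the index \<open>(i, s)\<close>, encoded as \<open>i m + s\<close>, is sent to \<open>(s L + l, t)\<close>: the block number
  is exchanged with the ancilla.\<close>

definition block_swap :: "nat \<Rightarrow> nat \<Rightarrow> nat \<Rightarrow> nat" where
  "block_swap m L x = (if x div m < m * L then (x mod m * L + x div m mod L) * m + x div m div L else x)"

lemma block_swap_props:
  assumes L: "0 < L" and mL: "m * L \<le> D" and x: "x < D * m"
  shows "block_swap m L x < D * m" "block_swap m L (block_swap m L x) = x"
    "block_swap m L x div m < m * L \<longleftrightarrow> x div m < m * L"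
    "x div m < m * L \<Longrightarrow> block_swap m L x div m div L = x mod m"
    "x div m < m * L \<Longrightarrow> block_swap m L x mod m = x div m div L"
proof -
  have m: "0 < m" using x by (cases m) auto
  have *: "block_swap m L x < D * m \<and> block_swap m L (block_swap m L x) = x \<and> block_swap m L x div m < m * L
    \<and> block_swap m L x div m div L = x mod m \<and> block_swap m L x mod m = x div m div L" if lt: "x div m < m * L"
  proof -
    define s t l where "s = x mod m" and "t = x div m div L" and "l = x div m mod L"
    have s: "s < m" using m by (simp add: s_def)
    have t: "t < m" using lt by (simp add: t_def less_mult_imp_div_less)
    have l: "l < L" using L by (simp add: l_def)
    define y where "y = block_swap m L x"
    have y: "y = (s * L + l) * m + t" using lt by (simp add: y_def block_swap_def s_def t_def l_def)
    have yd: "y div m = s * L + l" "y mod m = t" using t by (simp_all add: y)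
    have "s * L + l < Suc s * L" using l by simp
    also have "\<dots> \<le> m * L" using s by (intro mult_le_mono1) simp
    finally have sl: "s * L + l < m * L" .
    have "y < Suc (s * L + l) * m" using t by (simp add: y)
    also have "\<dots> \<le> D * m" using sl mL by (intro mult_le_mono1) simp
    finally have yD: "y < D * m" .
    have "block_swap m L y = (t * L + l) * m + s"
      using sl l by (simp add: block_swap_def yd)
    also have "t * L + l = x div m" by (simp add: t_def l_def)
    finally have "block_swap m L y = x" by (simp add: s_def)
    then show ?thesis unfolding y_def[symmetric] s_def[symmetric] t_def[symmetric] yd using yD sl l by simp
  qed
  show "block_swap m L x < D * m" "block_swap m L (block_swap m L x) = x"
    using * x by (cases "x div m < m * L", simp_all add: block_swap_def)+
  show "block_swap m L x div m < m * L \<longleftrightarrow> x div m < m * L"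
    using * by (cases "x div m < m * L") (simp_all, simp add: block_swap_def)
  show "x div m < m * L \<Longrightarrow> block_swap m L x div m div L = x mod m"
    "x div m < m * L \<Longrightarrow> block_swap m L x mod m = x div m div L" using * by auto
qed

lemma block_swap_bij:
  assumes "0 < L" "m * L \<le> D"
  shows "bij_betw (block_swap m L) {..<D * m} {..<D * m}"
  using block_swap_props(1,2)[OF assms] by (intro bij_betwI[of _ _ _ "block_swap m L"]) auto

text \<open>The flattened weights are f(t) g(s) / L on both sides, with \<open>t\<close> and
  \<open>s\<close> exchanged, so they agree exactly under the swap. Only the two flattening errors
  remain, and tensoring with a probability vector preserves an l1 distance.\<close>

lemma block_swap_distance:
  fixes p q f g :: "nat \<Rightarrow> real"
  assumes L: "0 < L" and mL: "m * L \<le> D"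
    and f: "\<forall>t<m. 0 \<le> f t" "(\<Sum>t<m. f t) = 1" and g: "\<forall>t<m. 0 \<le> g t" "(\<Sum>t<m. g t) = 1"
    and pf: "(\<Sum>i<D. \<bar>p i - (if i < m * L then f (i div L) / real L else 0)\<bar>) \<le> e"
    and qg: "(\<Sum>i<D. \<bar>q i - (if i < m * L then g (i div L) / real L else 0)\<bar>) \<le> e"
  shows "(\<Sum>x<D * m. \<bar>p (x div m) * g (x mod m) - q (block_swap m L x div m) * f (block_swap m L x mod m)\<bar>) \<le> 2 * e"
proof -
  let ?\<pi> = "block_swap m L"
  define bp where "bp i = (if i < m * L then f (i div L) / real L else 0)" for i
  define bq where "bq i = (if i < m * L then g (i div L) / real L else 0)" for i
  have "(\<Sum>x<D * m. \<bar>p (x div m) * g (x mod m) - q (?\<pi> x div m) * f (?\<pi> x mod m)\<bar>)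
    \<le> (\<Sum>x<D * m. \<bar>p (x div m) - bp (x div m)\<bar> * g (x mod m) + \<bar>q (?\<pi> x div m) - bq (?\<pi> x div m)\<bar> * f (?\<pi> x mod m))"
  proof (rule sum_mono)
    fix x assume "x \<in> {..<D * m}"
    then have x: "x < D * m" by simp
    note bs = block_swap_props[OF L mL x]
    have g0: "0 \<le> g (x mod m)" using g(1) div_mod_less(2)[OF x] by blast
    have f0: "0 \<le> f (?\<pi> x mod m)" using f(1) div_mod_less(2)[OF bs(1)] by blast
    have eq: "bp (x div m) * g (x mod m) = bq (?\<pi> x div m) * f (?\<pi> x mod m)"
      using bs by (simp add: bp_def bq_def)
    have "p (x div m) * g (x mod m) - q (?\<pi> x div m) * f (?\<pi> x mod m)
      = (p (x div m) - bp (x div m)) * g (x mod m) - (q (?\<pi> x div m) - bq (?\<pi> x div m)) * f (?\<pi> x mod m)"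
      using eq by (simp add: left_diff_distrib)
    then show "\<bar>p (x div m) * g (x mod m) - q (?\<pi> x div m) * f (?\<pi> x mod m)\<bar>
      \<le> \<bar>p (x div m) - bp (x div m)\<bar> * g (x mod m) + \<bar>q (?\<pi> x div m) - bq (?\<pi> x div m)\<bar> * f (?\<pi> x mod m)"
      using abs_triangle_ineq4[of "(p (x div m) - bp (x div m)) * g (x mod m)" "(q (?\<pi> x div m) - bq (?\<pi> x div m)) * f (?\<pi> x mod m)"]
        g0 f0 by (simp add: abs_mult)
  qed
  also have "\<dots> = (\<Sum>x<D * m. \<bar>p (x div m) - bp (x div m)\<bar> * g (x mod m)) + (\<Sum>x<D * m. \<bar>q (x div m) - bq (x div m)\<bar> * f (x mod m))"
    unfolding sum.distrib
    using sum.reindex_bij_betw[OF block_swap_bij[OF L mL], of "\<lambda>x. \<bar>q (x div m) - bq (x div m)\<bar> * f (x mod m)"] by simp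
  also have "\<dots> = (\<Sum>i<D. \<bar>p i - bp i\<bar>) + (\<Sum>i<D. \<bar>q i - bq i\<bar>)"
    using sum_product_div_mod[where p = "\<lambda>i. \<bar>p i - bp i\<bar>" and q = g and a = D and b = m]
      sum_product_div_mod[where p = "\<lambda>i. \<bar>q i - bq i\<bar>" and q = f and a = D and b = m] f(2) g(2) by simp
  also have "\<dots> \<le> 2 * e" using pf qg unfolding bp_def bq_def by simp
  finally show ?thesis .
qed

section \<open>Unitaries acting on a subspace\<close>

text \<open>\<open>U\<close> is \<open>W\<close> on the range of \<open>J\<close> and the identity
  on its complement. Its commutator with \<open>K\<close> contains \<open>K\<close> only through
  \<open>K * J\<close> and the adjoint of that, so it is small whenever \<open>K\<close> is small on
  the subspace, whichever \<open>W\<close> is chosen. The 4 is two terms times the bound 2 for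
  \<open>W - 1\<^sub>m n\<close>.\<close>

lemma subspace_unitary:
  assumes J: "dim_row J = M" "dim_col J = n" "J\<dagger> * J = 1\<^sub>m n" and W: "unitary n W"
  defines "U \<equiv> 1\<^sub>m M + J * ((W - 1\<^sub>m n) * J\<dagger>)"
  shows "unitary M U" "U * J = J * W"
    "\<And>K \<theta>. dim_row K = M \<Longrightarrow> dim_col K = M \<Longrightarrow> K\<dagger> = K \<Longrightarrow> opbound (K * J) \<theta> \<Longrightarrow> opbound (U * K - K * U) (4 * \<theta>)"
proof -
  note dW = unitaryD[OF W]
  define C where "C = W - 1\<^sub>m n"
  have dC: "dim_row C = n" "dim_col C = n" using dW by (auto simp: C_def)
  \<comment> \<open>Unitarity of W = 1 + C, expressed through C.\<close>
  have C0: "C\<dagger> + (C + C\<dagger> * C) = 0\<^sub>m n n"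
  proof -
    have Ca: "C\<dagger> = W\<dagger> - 1\<^sub>m n" using dW by (simp add: C_def adj_diff)
    have "C\<dagger> * C = (1\<^sub>m n - W\<dagger>) - (W - 1\<^sub>m n)"
      unfolding Ca unfolding C_def using dW
      by (simp add: mat_diff_mult mat_mult_diff) (intro eq_matI, auto simp del: index_adj)
    then show ?thesis unfolding Ca using dW unfolding C_def by (intro eq_matI) (auto simp del: index_mult_mat(1) index_adj)
  qed
  have U: "U = 1\<^sub>m M + J * (C * J\<dagger>)" by (simp add: U_def C_def)
  have dU: "dim_row U = M" "dim_col U = M" using J by (auto simp: U)
  have Ua: "U\<dagger> = 1\<^sub>m M + J * (C\<dagger> * J\<dagger>)" unfolding U using J dC by (simp add: adj_add adj_mult mat_assoc)
  note cancel = isometry_cancel[OF J(3)]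
  have "U\<dagger> * U = 1\<^sub>m M + J * (C\<dagger> * J\<dagger>) + (J * (C * J\<dagger>) + J * (C\<dagger> * (C * J\<dagger>)))"
    unfolding Ua unfolding U using J dC by (simp add: mat_add_mult mat_mult_add mat_assoc cancel)
  also have "\<dots> = 1\<^sub>m M + (J * (C\<dagger> * J\<dagger>) + (J * (C * J\<dagger>) + J * (C\<dagger> * (C * J\<dagger>))))"
    using J by (intro assoc_add_mat[of _ M M]) auto
  also have "J * (C\<dagger> * J\<dagger>) + (J * (C * J\<dagger>) + J * (C\<dagger> * (C * J\<dagger>))) = J * ((C\<dagger> + (C + C\<dagger> * C)) * J\<dagger>)"
    using J dC by (simp add: mat_add_mult mat_mult_add mat_assoc)
  also have "\<dots> = 0\<^sub>m M M" unfolding C0 using J by simp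
  finally have "U\<dagger> * U = 1\<^sub>m M" by simp
  then show "unitary M U" using dU by (intro isometry_square_unitary)
  show "U * J = J * W"
  proof -
    have "U * J = J + J * C" unfolding U using J dC by (simp add: mat_add_mult mat_assoc)
    also have "\<dots> = J * (1\<^sub>m n + C)" using J dC by (simp add: mat_mult_add)
    also have "1\<^sub>m n + C = W" unfolding C_def using dW by (intro eq_matI) auto
    finally show ?thesis .
  qed
  fix K \<theta> assume K: "dim_row K = M" "dim_col K = M" "K\<dagger> = K" "opbound (K * J) \<theta>"
  have C2: "opbound C (1 + 1)"
    unfolding C_def using dW by (intro opbound_diff opbound_unitary[OF W] opbound_one) auto
  have J1: "opbound J 1" using J by (intro opbound_isometry) auto
  have "U * K - K * U = J * (C * (K * J)\<dagger>) - (K * J) * (C * J\<dagger>)"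
  proof -
    have UK: "U * K = K + J * (C * (K * J)\<dagger>)" unfolding U using J dC K by (simp add: mat_add_mult mat_assoc adj_mult)
    have KU: "K * U = K + (K * J) * (C * J\<dagger>)" unfolding U using J dC K by (simp add: mat_mult_add mat_assoc)
    show ?thesis unfolding UK KU using J K by (intro eq_matI) (auto simp del: index_mult_mat(1))
  qed
  moreover have "opbound (J * (C * (K * J)\<dagger>)) (1 * ((1 + 1) * \<theta>))"
    using J dC K by (intro opbound_mult J1 C2 opbound_adj) auto
  moreover have "opbound ((K * J) * (C * J\<dagger>)) (\<theta> * ((1 + 1) * 1))"
    using J dC K by (intro opbound_mult J1 C2 opbound_adj) auto
  ultimately have "opbound (U * K - K * U) (1 * ((1 + 1) * \<theta>) + \<theta> * ((1 + 1) * 1))"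
    using J K by (simp only:) (intro opbound_diff, auto)
  then show "opbound (U * K - K * U) (4 * \<theta>)" by simp
qed

text \<open>Rotate the first eigenbasis to the standard basis, apply the block swap, and rotate into
  the second eigenbasis.\<close>

lemma flat_spectra_interconvertible:
  assumes V: "unitary D V" and V': "unitary D V'" and L: "0 < L" and mL: "m * L \<le> D"
    and f: "\<forall>t<m. 0 \<le> f t" "(\<Sum>t<m. f t) = 1" and g: "\<forall>t<m. 0 \<le> g t" "(\<Sum>t<m. g t) = 1"
    and pf: "(\<Sum>i<D. \<bar>p i - (if i < m * L then f (i div L) / real L else 0)\<bar>) \<le> e"
    and qg: "(\<Sum>i<D. \<bar>q i - (if i < m * L then g (i div L) / real L else 0)\<bar>) \<le> e"
  shows "\<exists>W. unitary (D * m) W \<and>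
    tbound (W * kron (V * diag_of D p * V\<dagger>) (diag_of m g) * W\<dagger> - kron (V' * diag_of D q * V'\<dagger>) (diag_of m f)) (2 * e)"
proof -
  let ?\<pi> = "block_swap m L"
  let ?n = "D * m"
  define P where "P = perm_mat ?n ?\<pi>"
  have P: "unitary ?n P" unfolding P_def by (rule unitary_perm_mat[OF block_swap_bij[OF L mL]])
  define G where "G = kron V (1\<^sub>m m)"
  define G' where "G' = kron V' (1\<^sub>m m)"
  have G: "unitary ?n G" "unitary ?n G'" unfolding G_def G'_def using V V' unitary_one by (auto intro: unitary_kron)
  let ?a = "\<lambda>x. p (x div m) * g (x mod m)" and ?c = "\<lambda>x. q (x div m) * f (x mod m)"
  have R: "kron (V * diag_of D p * V\<dagger>) (diag_of m g) = G * diag_of ?n ?a * G\<dagger>"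
    using kron_unitary_diag[of V D "1\<^sub>m m" m p g] unitaryD[OF V] by (simp add: G_def)
  have S: "kron (V' * diag_of D q * V'\<dagger>) (diag_of m f) = G' * diag_of ?n ?c * G'\<dagger>"
    using kron_unitary_diag[of V' D "1\<^sub>m m" m q f] unitaryD[OF V'] by (simp add: G'_def)
  note d = unitaryD[OF P] unitaryD[OF G(1)] unitaryD[OF G(2)]
  define W where "W = G' * (P * G\<dagger>)"
  have W: "unitary ?n W" unfolding W_def by (intro unitary_mult unitary_adj G P)
  have "W * (G * diag_of ?n ?a * G\<dagger>) * W\<dagger> = (G' * P) * diag_of ?n ?a * (G' * P)\<dagger>"
    unfolding W_def using d by (simp add: adj_mult mat_assoc unitary_cancel[OF G(1)])
  moreover have "G' * diag_of ?n ?c * G'\<dagger> = (G' * P) * diag_of ?n (\<lambda>x. ?c (?\<pi> x)) * (G' * P)\<dagger>"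
    unfolding perm_mat_conj[OF block_swap_bij[OF L mL], of ?c, symmetric] P_def[symmetric]
    using d by (simp add: adj_mult mat_assoc unitary_cancel[OF P])
  ultimately have eq: "W * (G * diag_of ?n ?a * G\<dagger>) * W\<dagger> - G' * diag_of ?n ?c * G'\<dagger>
    = (G' * P) * diag_of ?n (\<lambda>x. ?a x - ?c (?\<pi> x)) * (G' * P)\<dagger>"
    unfolding diag_of_diff[symmetric] using d by (simp add: mat_mult_diff mat_diff_mult)
  have "tbound ((G' * P) * diag_of ?n (\<lambda>x. ?a x - ?c (?\<pi> x)) * (G' * P)\<dagger>) (\<Sum>x<?n. \<bar>?a x - ?c (?\<pi> x)\<bar>)"
    by (rule tbound_unitary_diag[OF unitary_mult[OF G(2) P]])
  then have "tbound (W * (G * diag_of ?n ?a * G\<dagger>) * W\<dagger> - G' * diag_of ?n ?c * G'\<dagger>) (2 * e)"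
    unfolding eq by (rule tbound_mono) (rule block_swap_distance[OF L mL f g pf qg])
  then show ?thesis unfolding R S using W by blast
qed

text \<open>Compress both states, interconvert them inside the subspace and extend the unitary by
  the identity. The input ancilla \<open>\<omega>'\<close> carries the block weights of the target,
  the output ancilla \<open>\<omega>\<close> those of the source. The error consists of two
  compressions and the two flattenings.\<close>

lemma one_shot_conversion:
  assumes V: "unitary N V" and r: "\<forall>x<N. 0 \<le> r x \<and> r x \<le> p x \<and> r x \<le> b" and p: "(\<Sum>x<N. p x) = 1"
    and card: "card {x. x < N \<and> r x \<noteq> 0} \<le> M * L" and \<eta>: "(\<Sum>x<N. p x - r x) \<le> \<eta>"
    and V': "unitary N V'" and r': "\<forall>x<N. 0 \<le> r' x \<and> r' x \<le> p' x \<and> r' x \<le> b" and p': "(\<Sum>x<N. p' x) = 1"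
    and card': "card {x. x < N \<and> r' x \<noteq> 0} \<le> M * L" and \<eta>': "(\<Sum>x<N. p' x - r' x) \<le> \<eta>"
    and F: "dim_row F = N" "dim_col F = D" "F\<dagger> * F = 1\<^sub>m D"
    and \<kappa>: "1 - Re (mtrace (F\<dagger> * (V * diag_of N p * V\<dagger>) * F)) \<le> \<kappa>"
    and \<kappa>': "1 - Re (mtrace (F\<dagger> * (V' * diag_of N p' * V'\<dagger>) * F)) \<le> \<kappa>"
    and L: "0 < L" and M: "0 < M" and small: "(real L - 1) * b + \<eta> + \<kappa> < 1"
  shows "\<exists>m \<omega> \<omega>' U. 0 < m \<and> m \<le> M \<and> density m \<omega> \<and> density m \<omega>' \<and> unitary (N * m) U
    \<and> (\<forall>X \<theta>. dim_row X = N \<longrightarrow> dim_col X = N \<longrightarrow> X\<dagger> = X \<longrightarrow> opbound (X * F) \<theta> \<longrightarrow>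
         opbound (U * kron X (1\<^sub>m m) - kron X (1\<^sub>m m) * U) (4 * \<theta>))
    \<and> tbound (U * kron (V * diag_of N p * V\<dagger>) \<omega>' * U\<dagger> - kron (V' * diag_of N p' * V'\<dagger>) \<omega>)
        (2 * (\<eta> + 2 * sqrt \<kappa>) + 2 * (4 * ((real L - 1) * b) + (\<eta> + \<kappa>)))"
proof -
  let ?\<rho> = "V * diag_of N p * V\<dagger>" and ?\<sigma> = "V' * diag_of N p' * V'\<dagger>"
  obtain W q where W: "unitary D W" and qa: "\<forall>i j. i \<le> j \<longrightarrow> j < D \<longrightarrow> q j \<le> q i" and qb: "\<forall>i<D. 0 \<le> q i \<and> q i \<le> b"
    and qK: "\<forall>i<D. M * L \<le> i \<longrightarrow> q i = 0" and q1: "(\<Sum>i<D. q i) \<le> 1" and q2: "1 - (\<Sum>i<D. q i) \<le> \<eta> + \<kappa>"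
    and qt: "tbound (?\<rho> - F * (W * diag_of D q * W\<dagger>) * F\<dagger>) (\<eta> + 2 * sqrt \<kappa>)"
    using compressed_state[OF V r p card \<eta> F \<kappa>] by (elim exE conjE) (rule that; assumption)
  obtain W' q' where W': "unitary D W'" and qa': "\<forall>i j. i \<le> j \<longrightarrow> j < D \<longrightarrow> q' j \<le> q' i" and qb': "\<forall>i<D. 0 \<le> q' i \<and> q' i \<le> b"
    and qK': "\<forall>i<D. M * L \<le> i \<longrightarrow> q' i = 0" and q1': "(\<Sum>i<D. q' i) \<le> 1" and q2': "1 - (\<Sum>i<D. q' i) \<le> \<eta> + \<kappa>"
    and qt': "tbound (?\<sigma> - F * (W' * diag_of D q' * W'\<dagger>) * F\<dagger>) (\<eta> + 2 * sqrt \<kappa>)"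
    using compressed_state[OF V' r' p' card' \<eta>' F \<kappa>'] by (elim exE conjE) (rule that; assumption)
  let ?r = "W * diag_of D q * W\<dagger>" and ?s = "W' * diag_of D q' * W'\<dagger>"
  have "0 < N" using p by (cases N) auto
  then have b: "0 \<le> b" using r by force
  \<comment> \<open>Otherwise the weight in the subspace would be at most
    \<open>(real L - 1) * b\<close>, against \<open>small\<close>.\<close>
  have LD: "L \<le> D"
  proof (rule ccontr)
    assume "\<not> L \<le> D"
    then have "Suc D \<le> L" by simp
    then have "real (Suc D) \<le> real L" by (simp only: of_nat_le_iff)
    then have "real D \<le> real L - 1" by simp
    have "(\<Sum>i<D. q i) \<le> (\<Sum>i<D. b)" using qb by (intro sum_mono) auto
    also have "\<dots> = real D * b" by simp
    also have "\<dots> \<le> (real L - 1) * b"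
      using \<open>real D \<le> real L - 1\<close> b by (rule mult_right_mono)
    finally show False using small q2 by linarith
  qed
  \<comment> \<open>As many blocks as fit into the subspace, but no more than the rank bound calls
    for.\<close>
  define m where "m = min (D div L) M"
  have m: "0 < m" "m \<le> M" using LD L M by (auto simp: m_def div_greater_zero_iff)
  have mL: "m * L \<le> D"
  proof -
    have "m * L \<le> D div L * L" by (intro mult_le_mono1) (simp add: m_def)
    also have "\<dots> \<le> D" by (rule div_times_less_eq_dividend)
    finally show ?thesis .
  qed
  \<comment> \<open>If \<open>m = M\<close>, the rank bound makes the tail vanish; if the dimension
    is the bottleneck, less than one block is left over.\<close>
  have tail: "(\<forall>i<D. m * L \<le> i \<longrightarrow> u i = 0) \<or> D < m * L + L" if "\<forall>i<D. M * L \<le> i \<longrightarrow> u i = 0" for u :: "nat \<Rightarrow> real"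
  proof (cases "M \<le> D div L")
    case True
    then show ?thesis using that by (simp add: m_def)
  next
    case False
    then have "m = D div L" by (simp add: m_def)
    moreover have "D < D div L * L + L" using L by (metis add_less_cancel_left div_mult_mod_eq mod_less_divisor)
    ultimately show ?thesis by simp
  qed
  let ?e = "4 * ((real L - 1) * b) + (\<eta> + \<kappa>)"
  have "\<exists>f. (\<forall>t<m. 0 \<le> f t) \<and> (\<Sum>t<m. f t) = 1
    \<and> (\<Sum>i<D. \<bar>q i - (if i < m * L then f (i div L) / real L else 0)\<bar>) \<le> 4 * ((real L - 1) * b) + (1 - (\<Sum>i<D. q i))"
    using qa qb q1 L m(1) mL tail[OF qK] by (intro block_approximation) blast+
  then obtain f where f: "\<forall>t<m. 0 \<le> f t" "(\<Sum>t<m. f t) = 1"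
    and qf: "(\<Sum>i<D. \<bar>q i - (if i < m * L then f (i div L) / real L else 0)\<bar>) \<le> 4 * ((real L - 1) * b) + (1 - (\<Sum>i<D. q i))"
    by blast
  have "\<exists>f. (\<forall>t<m. 0 \<le> f t) \<and> (\<Sum>t<m. f t) = 1
    \<and> (\<Sum>i<D. \<bar>q' i - (if i < m * L then f (i div L) / real L else 0)\<bar>) \<le> 4 * ((real L - 1) * b) + (1 - (\<Sum>i<D. q' i))"
    using qa' qb' q1' L m(1) mL tail[OF qK'] by (intro block_approximation) blast+
  then obtain g where g: "\<forall>t<m. 0 \<le> g t" "(\<Sum>t<m. g t) = 1"
    and qg: "(\<Sum>i<D. \<bar>q' i - (if i < m * L then g (i div L) / real L else 0)\<bar>) \<le> 4 * ((real L - 1) * b) + (1 - (\<Sum>i<D. q' i))"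
    by blast
  have qf': "(\<Sum>i<D. \<bar>q i - (if i < m * L then f (i div L) / real L else 0)\<bar>) \<le> ?e" using qf q2 by linarith
  have qg': "(\<Sum>i<D. \<bar>q' i - (if i < m * L then g (i div L) / real L else 0)\<bar>) \<le> ?e" using qg q2' by linarith
  obtain Y where Y: "unitary (D * m) Y"
    and Yt: "tbound (Y * kron ?r (diag_of m g) * Y\<dagger> - kron ?s (diag_of m f)) (2 * ?e)"
    using flat_spectra_interconvertible[OF W W' L mL f g qf' qg'] by blast
  define \<omega> where "\<omega> = diag_of m f"
  define \<omega>' where "\<omega>' = diag_of m g"
  have om: "density m \<omega>" "density m \<omega>'" unfolding \<omega>_def \<omega>'_def density_diag_of using f g by auto
  define J where "J = kron F (1\<^sub>m m)"
  have J: "dim_row J = N * m" "dim_col J = D * m" "J\<dagger> * J = 1\<^sub>m (D * m)"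
    unfolding J_def using F kron_isometry[OF F(3), of "1\<^sub>m m" m] by auto
  define U where "U = 1\<^sub>m (N * m) + J * ((Y - 1\<^sub>m (D * m)) * J\<dagger>)"
  note U = subspace_unitary[OF J Y, folded U_def]
  note d = unitaryD[OF V] unitaryD[OF V'] unitaryD[OF W] unitaryD[OF W'] unitaryD[OF Y] unitaryD[OF U(1)]
    densityD[OF om(1)] densityD[OF om(2)]
  have lift: "kron (F * R * F\<dagger>) \<nu> = J * kron R \<nu> * J\<dagger>"
    if "dim_row R = D" "dim_col R = D" "dim_row \<nu> = m" "dim_col \<nu> = m" for R \<nu>
    unfolding J_def using that F by (simp add: kron_adj kron_mult)
  have comm: "opbound (U * kron X (1\<^sub>m m) - kron X (1\<^sub>m m) * U) (4 * \<theta>)"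
    if X: "dim_row X = N" "dim_col X = N" "X\<dagger> = X" "opbound (X * F) \<theta>" for X \<theta>
  proof (rule U(3))
    have "kron X (1\<^sub>m m) * J = kron (X * F) (1\<^sub>m m)" unfolding J_def using X F by (simp add: kron_mult)
    then show "opbound (kron X (1\<^sub>m m) * J) \<theta>" using opbound_kron_one[OF X(4)] by simp
  qed (use X in \<open>auto simp: kron_adj\<close>)
  have herm: "hermitian (?\<rho> - F * ?r * F\<dagger>)" "hermitian (F * ?s * F\<dagger> - ?\<sigma>)"
    using d F by (auto simp: hermitian_iff adj_diff adj_mult mat_assoc)
  have "tbound (kron (?\<rho> - F * ?r * F\<dagger>) \<omega>') (\<eta> + 2 * sqrt \<kappa>)"
    by (rule tbound_kron_density[OF herm(1) qt om(2)])
  then have t1: "tbound (U * kron (?\<rho> - F * ?r * F\<dagger>) \<omega>' * U\<dagger>) (\<eta> + 2 * sqrt \<kappa>)"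
    using d F by (intro tbound_conj) auto
  have t2: "tbound (J * (Y * kron ?r \<omega>' * Y\<dagger> - kron ?s \<omega>) * J\<dagger>) (2 * ?e)"
    using Yt J d unfolding \<omega>_def[symmetric] \<omega>'_def[symmetric] by (intro tbound_conj) auto
  have "tbound (F * ?s * F\<dagger> - ?\<sigma>) (\<eta> + 2 * sqrt \<kappa>)"
    using d F by (intro tbound_minus_commute[OF _ _ qt']) auto
  then have t3: "tbound (kron (F * ?s * F\<dagger> - ?\<sigma>) \<omega>) (\<eta> + 2 * sqrt \<kappa>)"
    by (rule tbound_kron_density[OF herm(2) _ om(1)])
  have e1: "U * kron (?\<rho> - F * ?r * F\<dagger>) \<omega>' * U\<dagger> = U * kron ?\<rho> \<omega>' * U\<dagger> - J * (Y * kron ?r \<omega>' * Y\<dagger>) * J\<dagger>"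
  proof -
    have "U * (J * kron ?r \<omega>' * J\<dagger>) * U\<dagger> = (U * J) * kron ?r \<omega>' * (U * J)\<dagger>"
      using d J F by (simp add: adj_mult mat_assoc)
    also have "\<dots> = J * (Y * kron ?r \<omega>' * Y\<dagger>) * J\<dagger>"
      unfolding U(2) using d J by (simp add: adj_mult mat_assoc)
    finally have 1: "U * kron (F * ?r * F\<dagger>) \<omega>' * U\<dagger> = J * (Y * kron ?r \<omega>' * Y\<dagger>) * J\<dagger>"
      using d by (simp add: lift)
    have "kron (?\<rho> - F * ?r * F\<dagger>) \<omega>' = kron ?\<rho> \<omega>' - kron (F * ?r * F\<dagger>) \<omega>'"
      using d F by (intro kron_diff_left) auto
    then have "U * kron (?\<rho> - F * ?r * F\<dagger>) \<omega>' * U\<dagger> = U * kron ?\<rho> \<omega>' * U\<dagger> - U * kron (F * ?r * F\<dagger>) \<omega>' * U\<dagger>"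
      using d F by (simp add: mat_mult_diff mat_diff_mult)
    then show ?thesis unfolding 1 .
  qed
  have e2: "J * (Y * kron ?r \<omega>' * Y\<dagger> - kron ?s \<omega>) * J\<dagger> = J * (Y * kron ?r \<omega>' * Y\<dagger>) * J\<dagger> - kron (F * ?s * F\<dagger>) \<omega>"
    using d J by (simp add: lift mat_mult_diff mat_diff_mult)
  have e3: "kron (F * ?s * F\<dagger> - ?\<sigma>) \<omega> = kron (F * ?s * F\<dagger>) \<omega> - kron ?\<sigma> \<omega>"
    using d F by (intro kron_diff_left) auto
  \<comment> \<open>Triangle inequality in telescoping form, passing through the two compressed
    states.\<close>
  have "tbound ((U * kron (?\<rho> - F * ?r * F\<dagger>) \<omega>' * U\<dagger> + J * (Y * kron ?r \<omega>' * Y\<dagger> - kron ?s \<omega>) * J\<dagger>)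
      + kron (F * ?s * F\<dagger> - ?\<sigma>) \<omega>) (((\<eta> + 2 * sqrt \<kappa>) + 2 * ?e) + (\<eta> + 2 * sqrt \<kappa>))"
    using d J F by (intro tbound_add t1 t2 t3) auto
  also have "(U * kron (?\<rho> - F * ?r * F\<dagger>) \<omega>' * U\<dagger> + J * (Y * kron ?r \<omega>' * Y\<dagger> - kron ?s \<omega>) * J\<dagger>)
      + kron (F * ?s * F\<dagger> - ?\<sigma>) \<omega> = U * kron ?\<rho> \<omega>' * U\<dagger> - kron ?\<sigma> \<omega>"
    unfolding e1 e2 e3 using d J F by (intro eq_matI) (auto simp del: index_mult_mat(1))
  finally have "tbound (U * kron ?\<rho> \<omega>' * U\<dagger> - kron ?\<sigma> \<omega>) (2 * (\<eta> + 2 * sqrt \<kappa>) + 2 * ?e)"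
    by (rule tbound_mono) simp
  then show ?thesis using m om U(1) comm by blast
qed

section \<open>Conversion at a fixed number of copies\<close>

lemma trace_norm_nonneg:
  assumes "hermitian X"
  shows "0 \<le> trace_norm X"
proof -
  define n where "n = dim_row X"
  from spectral[OF assms n_def[symmetric]] obtain V l where V: "unitary n V" and X: "X = V * diag_of n l * V\<dagger>" by blast
  show ?thesis unfolding X trace_norm_unitary_diag[OF V] by (intro sum_nonneg) auto
qed

text \<open>Variance plus squared bias. The shift may be the expectation in another state, which is
  how one subspace serves both sequences.\<close>

lemma second_moment_shifted_charge:
  fixes n :: nat
  assumes A: "dim_row A = d" "dim_col A = d" "hermitian A" and \<rho>: "\<And>i. density d (\<rho> i)"
  defines "T \<equiv> total_charge d A n"
  shows "Re (mtrace (prod_state \<rho> n * ((T - \<mu> \<cdot>\<^sub>m 1\<^sub>m (d ^ n)) * (T - \<mu> \<cdot>\<^sub>m 1\<^sub>m (d ^ n)))))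
    \<le> real n * (2 * (op_norm A)\<^sup>2) + (cmod (mtrace (prod_state \<rho> n * T) - \<mu>))\<^sup>2"
proof -
  let ?R = "prod_state \<rho> n" and ?I = "1\<^sub>m (d ^ n) :: complex mat"
  note R = densityD[OF density_prod_state[of d \<rho> n, OF \<rho>]]
  note T = total_charge_basic[OF A opbound_op_norm, of n, folded T_def]
  have "?R * ((T - \<mu> \<cdot>\<^sub>m ?I) * (T - \<mu> \<cdot>\<^sub>m ?I)) = (?R * (T * T) - \<mu> \<cdot>\<^sub>m (?R * T)) - \<mu> \<cdot>\<^sub>m (?R * T - \<mu> \<cdot>\<^sub>m ?R)"
  proof -
    have sl: "(\<mu> \<cdot>\<^sub>m ?I) * X = \<mu> \<cdot>\<^sub>m X" if "dim_row X = d ^ n" for X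
      using that by (subst mult_smult_assoc_mat[of _ "d ^ n" "d ^ n" _ "dim_col X"]) auto
    have sr: "Y * (\<mu> \<cdot>\<^sub>m X) = \<mu> \<cdot>\<^sub>m (Y * X)" if "dim_row X = d ^ n" "dim_col Y = d ^ n" for X Y
      using that by (intro mult_smult_distrib[of _ "dim_row Y" "d ^ n" _ "dim_col X"]) auto
    show ?thesis using T(1,2) R(1,2) by (simp add: mat_diff_mult mat_mult_diff sl sr)
  qed
  then have "mtrace (?R * ((T - \<mu> \<cdot>\<^sub>m ?I) * (T - \<mu> \<cdot>\<^sub>m ?I)))
    = (mtrace (?R * (T * T)) - (mtrace (?R * T))\<^sup>2) + (mtrace (?R * T) - \<mu>)\<^sup>2"
    using T(1,2) R(1,2,4) by (simp add: mtrace_diff mtrace_smult power2_eq_square algebra_simps)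
  moreover have "cmod (mtrace (?R * (T * T)) - (mtrace (?R * T))\<^sup>2) \<le> real n * (2 * (op_norm A)\<^sup>2)"
    unfolding T_def by (rule variance_total_charge[OF A opbound_op_norm \<rho>])
  moreover have "Re (x + y\<^sup>2) \<le> cmod x + (cmod y)\<^sup>2" for x y :: complex
    using complex_Re_le_cmod[of x] complex_Re_le_cmod[of "y\<^sup>2"] by (simp add: norm_power)
  ultimately show ?thesis by (smt (verit))
qed

text \<open>Expectations of charges are real. A shift by the real part therefore keeps the charge
  Hermitian and still centres it exactly.\<close>

lemma mtrace_hermitian_product_real:
  assumes "dim_row X = N" "dim_col X = N" "X\<dagger> = X" "dim_row Y = N" "dim_col Y = N" "Y\<dagger> = Y"
  shows "of_real (Re (mtrace (X * Y))) = mtrace (X * Y)"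
proof -
  have "cnj (mtrace (X * Y)) = mtrace ((X * Y)\<dagger>)" using assms by (simp add: mtrace_adj)
  also have "\<dots> = mtrace (Y * X)" using assms by (simp add: adj_mult)
  also have "\<dots> = mtrace (X * Y)" using assms by (intro mtrace_comm) auto
  finally show ?thesis by (simp add: complex_eq_iff)
qed

text \<open>Both states share the parameters of the first: its entropy, with \<open>t\<close>
  enlarged to \<open>g\<close> by the entropy difference so that the typical window of the second
  state is covered as well, and its charge means, for which the second state pays the square of
  \<open>\<Delta> j\<close>.\<close>

lemma product_state_conversion:
  fixes c n :: nat
  assumes charges: "\<forall>j<c. A j \<in> carrier_mat d d \<and> hermitian (A j)"
    and rho: "\<forall>i. density d (\<rho> i)" and sigma: "\<forall>i. density d (\<sigma> i)"
    and t: "0 < t" and \<theta>: "0 < \<theta>"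
  defines "T \<equiv> \<lambda>j. total_charge d (A j) n"
  defines "\<Delta> \<equiv> \<lambda>j. cmod (mtrace (prod_state \<rho> n * T j) - mtrace (prod_state \<sigma> n * T j))"
  defines "g \<equiv> t + \<bar>entropy (prod_state \<rho> n) - entropy (prod_state \<sigma> n)\<bar>"
  defines "\<eta> \<equiv> real n * (real d * (4 / (ln 2)\<^sup>2)) / t\<^sup>2"
  assumes \<kappa>: "(\<Sum>j<c. real n * (2 * (op_norm (A j))\<^sup>2) + (\<Delta> j)\<^sup>2) / \<theta>\<^sup>2 \<le> \<kappa>"
    and small: "2 powr (- g) + \<eta> + \<kappa> < 1"
  shows "\<exists>m \<omega> \<omega>' U. 0 < m \<and> real m \<le> 2 powr (3 * g) + 1 \<and> density m \<omega> \<and> density m \<omega>' \<and> unitary (d ^ n * m) U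
    \<and> (\<forall>j<c. op_norm (U * kron (T j) (1\<^sub>m m) - kron (T j) (1\<^sub>m m) * U) \<le> 4 * \<theta>)
    \<and> trace_norm (U * kron (prod_state \<rho> n) \<omega>' * U\<dagger> - kron (prod_state \<sigma> n) \<omega>)
      \<le> 2 * (\<eta> + 2 * sqrt \<kappa>) + 2 * (4 * 2 powr (- g) + (\<eta> + \<kappa>))"
proof -
  define N where "N = d ^ n"
  let ?R = "prod_state \<rho> n" and ?S = "prod_state \<sigma> n"
  have R: "density N ?R" and S: "density N ?S" unfolding N_def using rho sigma by (auto intro: density_prod_state)
  define s where "s = entropy ?R"
  define s' where "s' = entropy ?S"
  have g: "t - s \<le> g - s" "t - s' \<le> g - s" "s + t \<le> s + g" "s' + t \<le> s + g"
    unfolding g_def s_def[symmetric] s'_def[symmetric] by linarith+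
  have A: "dim_row (A j) = d" "dim_col (A j) = d" "hermitian (A j)" if "j < c" for j
    using charges that by auto
  have Tb: "dim_row (T j) = N" "dim_col (T j) = N" "(T j)\<dagger> = T j" if "j < c" for j
    unfolding T_def N_def using total_charge_basic[OF A[OF that] opbound_op_norm] by auto
  define \<mu> where "\<mu> j = complex_of_real (Re (mtrace (?R * T j)))" for j
  define X where "X j = T j - \<mu> j \<cdot>\<^sub>m 1\<^sub>m N" for j
  have \<mu>: "\<mu> j = mtrace (?R * T j)" if "j < c" for j
    unfolding \<mu>_def using densityD[OF R] Tb[OF that] by (intro mtrace_hermitian_product_real) auto
  have X: "dim_row (X j) = N \<and> dim_col (X j) = N \<and> (X j)\<dagger> = X j" if "j < c" for j
    using Tb[OF that] by (simp add: X_def adj_diff adj_smult \<mu>_def)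
  have "\<exists>D F. dim_row F = N \<and> dim_col F = D \<and> F\<dagger> * F = 1\<^sub>m D
    \<and> (\<forall>j<c. opbound (X j * F) \<theta>)
    \<and> (\<forall>R. density N R \<longrightarrow> 1 - Re (mtrace (F\<dagger> * R * F)) \<le> Re (\<Sum>j<c. mtrace (R * (X j * X j))) / \<theta>\<^sup>2)"
    by (rule approximate_microcanonical_subspace[OF _ \<theta>]) (rule X)
  then obtain D F where F: "dim_row F = N" "dim_col F = D" "F\<dagger> * F = 1\<^sub>m D"
    and XF: "\<And>j. j < c \<Longrightarrow> opbound (X j * F) \<theta>"
    and mark: "\<And>R. density N R \<Longrightarrow> 1 - Re (mtrace (F\<dagger> * R * F)) \<le> Re (\<Sum>j<c. mtrace (R * (X j * X j))) / \<theta>\<^sup>2"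
    by (elim exE conjE) (rule that; blast)
  let ?v = "\<Sum>j<c. real n * (2 * (op_norm (A j))\<^sup>2) + (\<Delta> j)\<^sup>2"
  have v: "Re (\<Sum>j<c. mtrace (prod_state \<tau> n * (X j * X j))) \<le> ?v"
    if "\<And>i. density d (\<tau> i)" "\<And>j. j < c \<Longrightarrow> cmod (mtrace (prod_state \<tau> n * T j) - \<mu> j) \<le> \<Delta> j" for \<tau>
    unfolding Re_sum
  proof (rule sum_mono)
    fix j assume "j \<in> {..<c}"
    then have j: "j < c" by simp
    have "Re (mtrace (prod_state \<tau> n * (X j * X j)))
      \<le> real n * (2 * (op_norm (A j))\<^sup>2) + (cmod (mtrace (prod_state \<tau> n * T j) - \<mu> j))\<^sup>2"
      unfolding X_def T_def N_def by (intro second_moment_shifted_charge A j that(1))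
    also have "\<dots> \<le> real n * (2 * (op_norm (A j))\<^sup>2) + (\<Delta> j)\<^sup>2"
      by (intro add_left_mono power_mono that(2) j) simp
    finally show "Re (mtrace (prod_state \<tau> n * (X j * X j))) \<le> real n * (2 * (op_norm (A j))\<^sup>2) + (\<Delta> j)\<^sup>2" .
  qed
  have vR: "Re (\<Sum>j<c. mtrace (?R * (X j * X j))) \<le> ?v"
    using rho by (intro v) (simp_all add: \<mu> \<Delta>_def)
  have vS: "Re (\<Sum>j<c. mtrace (?S * (X j * X j))) \<le> ?v"
    using sigma by (intro v) (simp_all add: \<mu> \<Delta>_def norm_minus_commute)
  have \<kappa>R: "1 - Re (mtrace (F\<dagger> * ?R * F)) \<le> \<kappa>"
    using order_trans[OF mark[OF R] order_trans[OF divide_right_mono[OF vR] \<kappa>]] by simp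
  have \<kappa>S: "1 - Re (mtrace (F\<dagger> * ?S * F)) \<le> \<kappa>"
    using order_trans[OF mark[OF S] order_trans[OF divide_right_mono[OF vS] \<kappa>]] by simp
  \<comment> \<open>These values give \<open>(real L - 1) * b\<close> at most
    \<open>2 powr (- g)\<close>, and \<open>M * L\<close> at least the common rank bound
    \<open>2 powr (s + g)\<close>. Rounding up keeps \<open>L\<close> and \<open>M\<close>
    positive.\<close>
  define b where "b = 2 powr (g - s)"
  define L where "L = nat \<lceil>2 powr (s - 2 * g)\<rceil>"
  define M where "M = nat \<lceil>2 powr (3 * g)\<rceil>"
  have "0 < (2::real) powr (s - 2 * g)" "0 < (2::real) powr (3 * g)" by auto
  then have LM0: "0 < L" "0 < M" by (simp_all add: L_def M_def)
  have "2 powr (s - 2 * g) \<le> real L" "real L - 1 \<le> 2 powr (s - 2 * g)"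
    unfolding L_def using ceiling_correct[of "2 powr (s - 2 * g)"] by (auto simp: of_nat_nat)
  note L = this
  have "2 powr (3 * g) \<le> real M" "real M \<le> 2 powr (3 * g) + 1"
    unfolding M_def using ceiling_correct[of "2 powr (3 * g)"] by (auto simp: of_nat_nat)
  note M = this
  have KML: "k \<le> M * L" if "real k \<le> 2 powr (s + g)" for k
  proof -
    have "real k \<le> 2 powr (3 * g) * 2 powr (s - 2 * g)" using that by (simp add: add.commute flip: powr_add)
    also have "\<dots> \<le> real M * real L" using L M by (intro mult_mono) auto
    finally show ?thesis by (simp flip: of_nat_mult)
  qed
  have Lb: "(real L - 1) * b \<le> 2 powr (- g)"
  proof -
    have "(real L - 1) * b \<le> 2 powr (s - 2 * g) * b" using L by (intro mult_right_mono) (auto simp: b_def)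
    also have "\<dots> = 2 powr (- g)" unfolding b_def by (simp flip: powr_add)
    finally show ?thesis .
  qed
  have "\<exists>V p r. unitary N V \<and> ?R = V * diag_of N p * V\<dagger>
    \<and> (\<forall>x<N. 0 \<le> r x \<and> r x \<le> p x \<and> r x \<le> 2 powr (t - s))
    \<and> (\<Sum>x<N. p x) = 1 \<and> real (card {x. x < N \<and> r x \<noteq> 0}) \<le> 2 powr (s + t) \<and> (\<Sum>x<N. p x - r x) \<le> \<eta>"
    unfolding N_def s_def \<eta>_def using rho t by (intro typical_part) auto
  then obtain V p r where V: "unitary N V" "?R = V * diag_of N p * V\<dagger>"
    and r: "\<forall>x<N. 0 \<le> r x \<and> r x \<le> p x \<and> r x \<le> 2 powr (t - s)" and p: "(\<Sum>x<N. p x) = 1"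
    and card: "real (card {x. x < N \<and> r x \<noteq> 0}) \<le> 2 powr (s + t)" and \<eta>: "(\<Sum>x<N. p x - r x) \<le> \<eta>"
    by (elim exE conjE) (rule that; assumption)
  have "\<exists>V p r. unitary N V \<and> ?S = V * diag_of N p * V\<dagger>
    \<and> (\<forall>x<N. 0 \<le> r x \<and> r x \<le> p x \<and> r x \<le> 2 powr (t - s'))
    \<and> (\<Sum>x<N. p x) = 1 \<and> real (card {x. x < N \<and> r x \<noteq> 0}) \<le> 2 powr (s' + t) \<and> (\<Sum>x<N. p x - r x) \<le> \<eta>"
    unfolding N_def s'_def \<eta>_def using sigma t by (intro typical_part) auto
  then obtain V' p' r' where V': "unitary N V'" "?S = V' * diag_of N p' * V'\<dagger>"
    and r': "\<forall>x<N. 0 \<le> r' x \<and> r' x \<le> p' x \<and> r' x \<le> 2 powr (t - s')" and p': "(\<Sum>x<N. p' x) = 1"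
    and card': "real (card {x. x < N \<and> r' x \<noteq> 0}) \<le> 2 powr (s' + t)" and \<eta>': "(\<Sum>x<N. p' x - r' x) \<le> \<eta>"
    by (elim exE conjE) (rule that; assumption)
  have "(2::real) powr (t - s) \<le> b" "(2::real) powr (t - s') \<le> b"
    using g unfolding b_def by (auto intro: powr_mono)
  then have rb: "\<forall>x<N. 0 \<le> r x \<and> r x \<le> p x \<and> r x \<le> b" "\<forall>x<N. 0 \<le> r' x \<and> r' x \<le> p' x \<and> r' x \<le> b"
    using r r' by (meson order_trans)+
  have "(2::real) powr (s + t) \<le> 2 powr (s + g)" "(2::real) powr (s' + t) \<le> 2 powr (s + g)"
    using g by (auto intro: powr_mono)
  then have cards: "card {x. x < N \<and> r x \<noteq> 0} \<le> M * L" "card {x. x < N \<and> r' x \<noteq> 0} \<le> M * L"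
    using card card' by (meson KML order_trans)+
  have sm: "(real L - 1) * b + \<eta> + \<kappa> < 1" using small Lb by linarith
  from one_shot_conversion[OF V(1) rb(1) p cards(1) \<eta> V'(1) rb(2) p' cards(2) \<eta>' F
      \<kappa>R[unfolded V(2)] \<kappa>S[unfolded V'(2)] LM0 sm, folded V(2) V'(2)]
  obtain m \<omega> \<omega>' U where m: "0 < m" "m \<le> M" and om: "density m \<omega>" "density m \<omega>'" and U: "unitary (N * m) U"
    and comm: "\<forall>X \<theta>. dim_row X = N \<longrightarrow> dim_col X = N \<longrightarrow> X\<dagger> = X \<longrightarrow> opbound (X * F) \<theta> \<longrightarrow>
         opbound (U * kron X (1\<^sub>m m) - kron X (1\<^sub>m m) * U) (4 * \<theta>)"
    and tb: "tbound (U * kron ?R \<omega>' * U\<dagger> - kron ?S \<omega>) (2 * (\<eta> + 2 * sqrt \<kappa>) + 2 * (4 * ((real L - 1) * b) + (\<eta> + \<kappa>)))"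
    by (elim exE conjE) (rule that; assumption)
  have "real m \<le> 2 powr (3 * g) + 1" using m(2) M(2) by (meson of_nat_mono order_trans)
  moreover have "op_norm (U * kron (T j) (1\<^sub>m m) - kron (T j) (1\<^sub>m m) * U) \<le> 4 * \<theta>" if j: "j < c" for j
  proof -
    note Tj = Tb[OF j]
    note dU = unitaryD[OF U]
    \<comment> \<open>The shift is a multiple of the identity, so it drops out of the
      commutator.\<close>
    have "kron (X j) (1\<^sub>m m) = kron (T j) (1\<^sub>m m) - \<mu> j \<cdot>\<^sub>m 1\<^sub>m (N * m)"
    proof -
      have "kron (\<mu> j \<cdot>\<^sub>m 1\<^sub>m N) (1\<^sub>m m) = \<mu> j \<cdot>\<^sub>m kron (1\<^sub>m N) (1\<^sub>m m)"
        by (rule eq_matI) (auto simp: kron_index div_mod_less)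
      then show ?thesis unfolding X_def using Tj by (simp add: kron_diff_left kron_one)
    qed
    moreover have "U * (\<mu> j \<cdot>\<^sub>m 1\<^sub>m (N * m)) = \<mu> j \<cdot>\<^sub>m U" "(\<mu> j \<cdot>\<^sub>m 1\<^sub>m (N * m)) * U = \<mu> j \<cdot>\<^sub>m U"
      using dU by (subst mult_smult_distrib[of _ "N * m" "N * m" _ "N * m"] mult_smult_assoc_mat[of _ "N * m" "N * m" _ "N * m"]; auto)+
    ultimately have "U * kron (X j) (1\<^sub>m m) - kron (X j) (1\<^sub>m m) * U
      = (U * kron (T j) (1\<^sub>m m) - \<mu> j \<cdot>\<^sub>m U) - (kron (T j) (1\<^sub>m m) * U - \<mu> j \<cdot>\<^sub>m U)"
      using dU Tj by (simp add: mat_mult_diff mat_diff_mult)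
    also have "\<dots> = U * kron (T j) (1\<^sub>m m) - kron (T j) (1\<^sub>m m) * U"
      using dU Tj by (intro eq_matI) (auto simp del: index_mult_mat(1))
    finally have "opbound (U * kron (T j) (1\<^sub>m m) - kron (T j) (1\<^sub>m m) * U) (4 * \<theta>)"
      using comm X[OF j] XF[OF j] by metis
    then show ?thesis by (rule op_norm_le)
  qed
  moreover have "trace_norm (U * kron ?R \<omega>' * U\<dagger> - kron ?S \<omega>) \<le> 2 * (\<eta> + 2 * sqrt \<kappa>) + 2 * (4 * 2 powr (- g) + (\<eta> + \<kappa>))"
  proof (rule trace_norm_le)
    show "hermitian (U * kron ?R \<omega>' * U\<dagger> - kron ?S \<omega>)"
      by (rule hermitian_density_diff[OF entropy_unitary_conj(1)[OF density_kron[OF R om(2)] U] density_kron[OF S om(1)]])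
    show "tbound (U * kron ?R \<omega>' * U\<dagger> - kron ?S \<omega>) (2 * (\<eta> + 2 * sqrt \<kappa>) + 2 * (4 * 2 powr (- g) + (\<eta> + \<kappa>)))"
      by (rule tbound_mono[OF tb]) (intro add_mono mult_left_mono order_refl Lb, simp_all)
  qed
  ultimately show ?thesis using m(1) om U unfolding N_def by blast
qed

section \<open>Choice of parameters and passage to the limit\<close>

lemma unitaries_if_asymptotically_equivalent:
  assumes charges: "\<forall>j<c. A j \<in> carrier_mat d d \<and> hermitian (A j)"
    and rho: "\<forall>i. density d (\<rho> i)" and sigma: "\<forall>i. density d (\<sigma> i)"
    and ae: "asymptotically_equivalent d c A (prod_state \<rho>) (prod_state \<sigma>)"
  shows "\<exists>(k :: nat \<Rightarrow> nat) (\<omega> :: nat \<Rightarrow> complex mat) (\<omega>' :: nat \<Rightarrow> complex mat) (U :: nat \<Rightarrow> complex mat).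
       (\<forall>n. 0 < k n) \<and> (\<lambda>n. log 2 (real (k n))) \<in> o(\<lambda>n. real n) \<and>
       (\<forall>n. density (k n) (\<omega> n) \<and> density (k n) (\<omega>' n)) \<and>
       (\<forall>n. unitary (d ^ n * k n) (U n)) \<and>
       almost_commuting d c A k (\<lambda>n j. 0\<^sub>m (k n) (k n)) U \<and>
       (\<lambda>n. trace_norm (U n * kron (prod_state \<rho> n) (\<omega>' n) * mat_adjoint (U n)
                         - kron (prod_state \<sigma> n) (\<omega> n))) \<longlonglongrightarrow> 0"
proof -
  define T where "T n j = total_charge d (A j) n" for n j
  define \<Delta> where "\<Delta> n j = cmod (mtrace (prod_state \<rho> n * T n j) - mtrace (prod_state \<sigma> n * T n j))" for n j
  define E where "E n = \<bar>entropy (prod_state \<rho> n) - entropy (prod_state \<sigma> n)\<bar>" for n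
  \<comment> \<open>The exponent lies strictly between 1/2 and 1: Chebyshev needs n / t^2 to vanish,
    and the ancilla dimension needs t = o(n).\<close>
  define t where "t n = real n powr (3 / 4)" for n :: nat
  define g where "g n = t n + E n" for n
  define \<eta> where "\<eta> n = real n * (real d * (4 / (ln 2)\<^sup>2)) / (t n)\<^sup>2" for n
  define v where "v n = (\<Sum>j<c. real n * (2 * (op_norm (A j))\<^sup>2) + (\<Delta> n j)\<^sup>2)" for n
  \<comment> \<open>The summand 1 / n keeps \<open>h\<close>, and with it \<open>\<theta>\<close>,
    strictly positive even when \<open>v n = 0\<close>.\<close>
  define h where "h n = v n / (real n)\<^sup>2 + 1 / real n" for n
  \<comment> \<open>With \<theta>^2 = n^2 \<kappa> the Markov bound is (v / n^2) / \<kappa>, at most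
    h / \<kappa>. The choice \<kappa> = sqrt h makes this equal to \<kappa>, while \<kappa> and
    \<theta> / n both vanish.\<close>
  define \<kappa> where "\<kappa> n = sqrt (h n)" for n
  define \<theta> where "\<theta> n = real n * sqrt (\<kappa> n)" for n
  define e where "e n = 2 * (\<eta> n + 2 * sqrt (\<kappa> n)) + 2 * (4 * 2 powr (- g n) + (\<eta> n + \<kappa> n))" for n
  have E: "(\<lambda>n. E n / real n) \<longlonglongrightarrow> 0" and \<Delta>: "\<And>j. j < c \<Longrightarrow> (\<lambda>n. \<Delta> n j / real n) \<longlonglongrightarrow> 0"
    using ae unfolding asymptotically_equivalent_def E_def \<Delta>_def T_def by blast+
  have E0: "0 \<le> E n" for n by (simp add: E_def)
  have v0: "0 \<le> v n" for n unfolding v_def by (intro sum_nonneg add_nonneg_nonneg mult_nonneg_nonneg) auto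
  have tn: "(\<lambda>n. t n / real n) \<longlonglongrightarrow> 0" unfolding t_def by real_asymp
  have gn: "(\<lambda>n. g n / real n) \<longlonglongrightarrow> 0"
    using tendsto_add[OF tn E] by (simp add: g_def add_divide_distrib)
  have \<eta>: "(\<lambda>n. \<eta> n) \<longlonglongrightarrow> 0"
  proof -
    have "(\<lambda>n. real n / (real n powr (3 / 4))\<^sup>2) \<longlonglongrightarrow> 0" by real_asymp
    from tendsto_mult_left[OF this, of "real d * (4 / (ln 2)\<^sup>2)"] show ?thesis
      unfolding \<eta>_def t_def by (simp add: mult.commute)
  qed
  have pg: "(\<lambda>n. 2 powr (- g n)) \<longlonglongrightarrow> 0"
  proof (rule tendsto_sandwich[OF _ _ tendsto_const])
    show "(\<lambda>n. 2 powr (- t n)) \<longlonglongrightarrow> 0" unfolding t_def by real_asymp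
    show "\<forall>\<^sub>F n in sequentially. 0 \<le> (2::real) powr (- g n)" by simp
    show "\<forall>\<^sub>F n in sequentially. (2::real) powr (- g n) \<le> 2 powr (- t n)"
      using E0 by (intro always_eventually allI powr_mono) (auto simp: g_def)
  qed
  have h: "(\<lambda>n. h n) \<longlonglongrightarrow> 0"
  proof -
    have "(\<lambda>n. \<Sum>j<c. 2 * (op_norm (A j))\<^sup>2 * (1 / real n) + (\<Delta> n j / real n)\<^sup>2) \<longlonglongrightarrow> (\<Sum>j<c. 2 * (op_norm (A j))\<^sup>2 * 0 + 0\<^sup>2)"
      using \<Delta> by (intro tendsto_sum tendsto_add tendsto_mult tendsto_power tendsto_const lim_1_over_n) auto
    moreover have "(\<Sum>j<c. 2 * (op_norm (A j))\<^sup>2 * (1 / real n) + (\<Delta> n j / real n)\<^sup>2) = v n / (real n)\<^sup>2" for n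
      unfolding v_def sum_divide_distrib
      by (intro sum.cong refl) (simp add: add_divide_distrib power_divide power2_eq_square)
    ultimately have "(\<lambda>n. v n / (real n)\<^sup>2) \<longlonglongrightarrow> 0" by simp
    from tendsto_add[OF this lim_1_over_n] show ?thesis unfolding h_def by simp
  qed
  have \<kappa>: "(\<lambda>n. \<kappa> n) \<longlonglongrightarrow> 0" using tendsto_real_sqrt[OF h] by (simp add: \<kappa>_def)
  have sq\<kappa>: "(\<lambda>n. sqrt (\<kappa> n)) \<longlonglongrightarrow> 0" using tendsto_real_sqrt[OF \<kappa>] by simp
  have e: "(\<lambda>n. e n) \<longlonglongrightarrow> 0"
  proof -
    have "(\<lambda>n. e n) \<longlonglongrightarrow> 2 * (0 + 2 * 0) + 2 * (4 * 0 + (0 + 0))"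
      unfolding e_def by (intro tendsto_add tendsto_mult tendsto_const \<eta> sq\<kappa> pg \<kappa>)
    then show ?thesis by simp
  qed
  define good where "good n \<longleftrightarrow> 0 < n \<and> 2 powr (- g n) + \<eta> n + \<kappa> n < 1" for n
  have "(\<lambda>n. 2 powr (- g n) + \<eta> n + \<kappa> n) \<longlonglongrightarrow> 0 + 0 + 0" by (intro tendsto_add pg \<eta> \<kappa>)
  then have ev: "\<forall>\<^sub>F n in sequentially. good n"
    unfolding good_def by (intro eventually_conj eventually_gt_at_top order_tendstoD(2)) auto
  have "\<exists>m \<omega> \<omega>' U. 0 < m \<and> density m \<omega> \<and> density m \<omega>' \<and> unitary (d ^ n * m) U
    \<and> (good n \<longrightarrow> real m \<le> 2 powr (3 * g n) + 1
      \<and> (\<forall>j<c. op_norm (U * kron (T n j) (1\<^sub>m m) - kron (T n j) (1\<^sub>m m) * U) \<le> 4 * \<theta> n)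
      \<and> trace_norm (U * kron (prod_state \<rho> n) \<omega>' * U\<dagger> - kron (prod_state \<sigma> n) \<omega>) \<le> e n)" for n
  proof (cases "good n")
    \<comment> \<open>For the finitely many remaining \<open>n\<close>, a one-dimensional ancilla
      and the identity meet the unconditional requirements.\<close>
    case False
    then show ?thesis
      using density_one unitary_one[of "d ^ n * 1"]
      by (intro exI[of _ 1] exI[of _ "1\<^sub>m 1"] exI[of _ "1\<^sub>m (d ^ n * 1)"]) simp
  next
    case True
    then have n: "0 < n" and sm: "2 powr (- g n) + \<eta> n + \<kappa> n < 1" by (auto simp: good_def)
    have h0: "0 < h n" unfolding h_def using n v0[of n] by (intro add_nonneg_pos divide_nonneg_nonneg) auto
    then have \<kappa>0: "0 < \<kappa> n" "(\<kappa> n)\<^sup>2 = h n" by (simp_all add: \<kappa>_def)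
    have \<theta>0: "0 < \<theta> n" using \<kappa>0 n by (simp add: \<theta>_def)
    have \<theta>2: "(\<theta> n)\<^sup>2 = (real n)\<^sup>2 * \<kappa> n" using \<kappa>0 by (simp add: \<theta>_def power_mult_distrib)
    have "v n \<le> (real n)\<^sup>2 * h n" using n by (simp add: h_def distrib_left)
    also have "\<dots> = \<kappa> n * (\<theta> n)\<^sup>2" unfolding \<theta>2 \<kappa>0(2)[symmetric] by (simp add: power2_eq_square)
    finally have k: "v n / (\<theta> n)\<^sup>2 \<le> \<kappa> n" using \<theta>0 by (simp add: divide_le_eq)
    have tpos: "0 < t n" using n by (simp add: t_def)
    have "\<exists>m \<omega> \<omega>' U. 0 < m \<and> real m \<le> 2 powr (3 * g n) + 1 \<and> density m \<omega> \<and> density m \<omega>' \<and> unitary (d ^ n * m) U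
      \<and> (\<forall>j<c. op_norm (U * kron (T n j) (1\<^sub>m m) - kron (T n j) (1\<^sub>m m) * U) \<le> 4 * \<theta> n)
      \<and> trace_norm (U * kron (prod_state \<rho> n) \<omega>' * U\<dagger> - kron (prod_state \<sigma> n) \<omega>) \<le> e n"
      unfolding e_def T_def g_def E_def \<eta>_def
      using k sm unfolding v_def \<Delta>_def T_def g_def E_def \<eta>_def
      by (rule product_state_conversion[OF charges rho sigma tpos \<theta>0])
    then show ?thesis by blast
  qed
  then obtain k \<omega> \<omega>' U where k: "\<And>n. 0 < k n" "\<And>n. density (k n) (\<omega> n)" "\<And>n. density (k n) (\<omega>' n)" "\<And>n. unitary (d ^ n * k n) (U n)"
    and gd: "\<And>n. good n \<Longrightarrow> real (k n) \<le> 2 powr (3 * g n) + 1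
      \<and> (\<forall>j<c. op_norm (U n * kron (T n j) (1\<^sub>m (k n)) - kron (T n j) (1\<^sub>m (k n)) * U n) \<le> 4 * \<theta> n)
      \<and> trace_norm (U n * kron (prod_state \<rho> n) (\<omega>' n) * (U n)\<dagger> - kron (prod_state \<sigma> n) (\<omega> n)) \<le> e n"
    by metis
  have tn_nonneg: "0 \<le> trace_norm (U n * kron (prod_state \<rho> n) (\<omega>' n) * (U n)\<dagger> - kron (prod_state \<sigma> n) (\<omega> n))" for n
    by (rule trace_norm_nonneg, rule hermitian_density_diff[OF entropy_unitary_conj(1)[OF density_kron k(4)] density_kron])
      (use rho sigma k in \<open>auto intro: density_prod_state\<close>)
  have 1: "(\<lambda>n. trace_norm (U n * kron (prod_state \<rho> n) (\<omega>' n) * (U n)\<dagger> - kron (prod_state \<sigma> n) (\<omega> n))) \<longlonglongrightarrow> 0"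
    by (rule tendsto_sandwich[OF _ _ tendsto_const e]) (use tn_nonneg gd in \<open>auto intro: eventually_mono[OF ev]\<close>)
  have 2: "almost_commuting d c A k (\<lambda>n j. 0\<^sub>m (k n) (k n)) U"
    unfolding almost_commuting_def
  proof (intro allI impI)
    fix j assume j: "j < c"
    have A: "dim_row (A j) = d" "dim_col (A j) = d" "hermitian (A j)" using charges j by auto
    note Tb = total_charge_basic[OF A opbound_op_norm]
    have "(\<lambda>n. op_norm (U n * kron (T n j) (1\<^sub>m (k n)) - kron (T n j) (1\<^sub>m (k n)) * U n) / real n) \<longlonglongrightarrow> 0"
    proof (rule tendsto_sandwich[OF _ _ tendsto_const])
      show "(\<lambda>n. 4 * sqrt (\<kappa> n)) \<longlonglongrightarrow> 0" using tendsto_mult_left[OF sq\<kappa>, of 4] by simp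
      show "\<forall>\<^sub>F n in sequentially. 0 \<le> op_norm (U n * kron (T n j) (1\<^sub>m (k n)) - kron (T n j) (1\<^sub>m (k n)) * U n) / real n"
        using opbound_nonneg[OF opbound_op_norm] by (intro always_eventually allI divide_nonneg_nonneg) auto
      show "\<forall>\<^sub>F n in sequentially. op_norm (U n * kron (T n j) (1\<^sub>m (k n)) - kron (T n j) (1\<^sub>m (k n)) * U n) / real n \<le> 4 * sqrt (\<kappa> n)"
        using ev
      proof eventually_elim
        case (elim n)
        then have "0 < n" by (simp add: good_def)
        moreover have "op_norm (U n * kron (T n j) (1\<^sub>m (k n)) - kron (T n j) (1\<^sub>m (k n)) * U n) \<le> 4 * \<theta> n"
          using gd[OF elim] j by blast
        ultimately show ?case by (simp add: \<theta>_def field_simps)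
      qed
    qed
    then show "(\<lambda>n. let H = kron (total_charge d (A j) n) (1\<^sub>m (k n)) + kron (1\<^sub>m (d ^ n)) (0\<^sub>m (k n) (k n))
               in op_norm (U n * H - H * U n) / real n) \<longlonglongrightarrow> 0"
      unfolding Let_def total_charge_kron_trivial[OF Tb(1,2)] T_def .
  qed
  have 3: "(\<lambda>n. log 2 (real (k n))) \<in> o(\<lambda>n. real n)"
  proof (rule smalloI_tendsto)
    show "(\<lambda>n. log 2 (real (k n)) / real n) \<longlonglongrightarrow> 0"
    proof (rule tendsto_sandwich[OF _ _ tendsto_const])
      have "(\<lambda>n. 3 * (g n / real n) + 1 / real n) \<longlonglongrightarrow> 3 * 0 + 0"
        by (intro tendsto_add tendsto_mult tendsto_const gn lim_1_over_n)
      then show "(\<lambda>n. 3 * (g n / real n) + 1 / real n) \<longlonglongrightarrow> 0" by simp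
      show "\<forall>\<^sub>F n in sequentially. 0 \<le> log 2 (real (k n)) / real n"
        using k(1) by (intro always_eventually allI divide_nonneg_nonneg) (auto simp: Suc_le_eq)
      show "\<forall>\<^sub>F n in sequentially. log 2 (real (k n)) / real n \<le> 3 * (g n / real n) + 1 / real n"
        using ev
      proof eventually_elim
        case (elim n)
        have g0: "0 \<le> 3 * g n" using E0[of n] by (simp add: g_def t_def)
        have "real (k n) \<le> 2 powr (3 * g n) + 1" using gd[OF elim] by blast
        \<comment> \<open>The 1 from rounding \<open>M\<close> up is absorbed into one extra
          bit.\<close>
        also have "\<dots> \<le> 2 powr (3 * g n) + 2 powr (3 * g n)" using ge_one_powr_ge_zero[of 2 "3 * g n"] g0 by simp
        also have "\<dots> = 2 powr (3 * g n + 1)" by (simp add: powr_add)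
        finally have "log 2 (real (k n)) \<le> log 2 (2 powr (3 * g n + 1))"
          using k(1)[of n] by (intro log_mono) auto
        then have "log 2 (real (k n)) \<le> 3 * g n + 1" by simp
        then have "log 2 (real (k n)) / real n \<le> (3 * g n + 1) / real n" by (intro divide_right_mono) auto
        then show ?case by (simp add: add_divide_distrib)
      qed
    qed
    show "\<forall>\<^sub>F n in sequentially. real n \<noteq> 0" using eventually_gt_at_top[of "0::nat"] by eventually_elim simp
  qed
  show ?thesis using k 1 2 3 by blast
qed

theorem theorem7p1:
  fixes d c :: nat and A \<rho> \<sigma> :: "nat \<Rightarrow> complex mat"
  assumes charges: "\<forall>j<c. A j \<in> carrier_mat d d \<and> hermitian (A j)"
    and rho: "\<forall>i. density d (\<rho> i)"
    and sigma: "\<forall>i. density d (\<sigma> i)"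
  shows "asymptotically_equivalent d c A (prod_state \<rho>) (prod_state \<sigma>) \<longleftrightarrow>
    (\<exists>(k :: nat \<Rightarrow> nat) (\<omega> :: nat \<Rightarrow> complex mat) (\<omega>' :: nat \<Rightarrow> complex mat) (U :: nat \<Rightarrow> complex mat).
       (\<forall>n. 0 < k n) \<and> (\<lambda>n. log 2 (real (k n))) \<in> o(\<lambda>n. real n) \<and>
       (\<forall>n. density (k n) (\<omega> n) \<and> density (k n) (\<omega>' n)) \<and>
       (\<forall>n. unitary (d ^ n * k n) (U n)) \<and>
       almost_commuting d c A k (\<lambda>n j. 0\<^sub>m (k n) (k n)) U \<and>
       (\<lambda>n. trace_norm (U n * kron (prod_state \<rho> n) (\<omega>' n) * mat_adjoint (U n)
                         - kron (prod_state \<sigma> n) (\<omega> n))) \<longlonglongrightarrow> 0)"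
    (is "?L \<longleftrightarrow> ?R")
proof
  assume ?L
  then show ?R by (rule unitaries_if_asymptotically_equivalent[OF charges rho sigma])
next
  assume ?R
  then show ?L
    by (elim exE conjE) (rule asymptotically_equivalent_if_unitaries[OF charges rho sigma])
qed

end
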